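(* Let $\Gamma\subset\mathbb R^N$ be a network with Hamiltonians $H_\gamma$ and a flux limiter $(c_x)_{x\in\mathbf V}$ as in the context, and let $L$ be the associated overall Lagrangian. Given $x,y\in\Gamma$ and $T>0$, there is an admissible curve $\xi:[0,T]\to\Gamma$ with $\xi(0)=x$, $\xi(T)=y$ which minimizes the action $\int_0^TL(\zeta,\dot\zeta)\,d\tau$ among all absolutely continuous curves $\zeta$ defined in $[0,T]$ with $\zeta(0)=x$, $\zeta(T)=y$.
   Context: Network. $\mathcal E$ is a finite collection of simple curves $\gamma:[0,1]\to\mathbb R^N$, called arcs, each $C^1$ up to the endpoints with nowhere vanishing derivative, and $\Gamma=\bigcup_{\gamma\in\mathcal E}\gamma([0,1])$. For each arc $\gamma$ the inverse arc $\widetilde\gamma(s)=\gamma(1-s)$ is also regarded as an arc. It is assumed that $\gamma((0,1))\cap\gamma'([0,1])=\emptyset$ whenever $\gamma\ne\gamma'$ and $\gamma\neq\widetilde{\gamma'}$. The set $\mathbf V$ of vertices is the set of initial and terminal points of arcs. $\Gamma$ is connected (any two vertices are linked by a finite concatenation of arcs) and there are no loops ($\gamma(0)\ne\gamma(1)$ for every arc). For $x\in\mathbf V$, $\Gamma_x=\{\gamma \text{ arc}: \gamma(1)=x\}$. The tangent bundle $T\Gamma$ is the set of $(x,q)\in\Gamma\times\mathbb R^N$ such that $q=\lambda\dot\gamma(s)$ for some arc $\gamma$, $s\in[0,1]$ with $x=\gamma(s)$, and $\lambda\in\mathbb R$. Hamiltonians and Lagrangians. For each arc $\gamma$, $H_\gamma:[0,1]\times\mathbb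 R\to\mathbb R$ is continuous, convex in the second variable $\mu$, satisfies $\lim_{|\mu|\to\infty}\inf_{s\in[0,1]}H_\gamma(s,\mu)/|\mu|=+\infty$, and $H_{\widetilde\gamma}(s,\mu)=H_\gamma(1-s,-\mu)$. Set $L_\gamma(s,\lambda)=\max_{\mu\in\mathbb R}(\lambda\mu-H_\gamma(s,\mu))$ and $c_\gamma=-\max_{s\in[0,1]}\min_{\mu\in\mathbb R}H_\gamma(s,\mu)=\min_{s\in[0,1]}L_\gamma(s,0)$. A flux limiter is a function $x\mapsto c_x$ from $\mathbf V$ to $\mathbb R$ with $c_x\le\min_{\gamma\in\Gamma_x}c_\gamma$ for every $x\in\mathbf V$. Overall Lagrangian. $L:T\Gamma\to\mathbb R$ is defined by: if $x\in\gamma((0,1))$, $L(x,q)=L_\gamma\big(\gamma^{-1}(x),\tfrac{q\cdot\dot\gamma(\gamma^{-1}(x))}{|\dot\gamma(\gamma^{-1}(x))|^2}\big)$; if $x\in\mathbf V$, $q\ne0$, $L(x,q)=\min L_\gamma\big(1,\tfrac{q\cdot\dot\gamma(1)}{|\dot\gamma(1)|^2}\big)$, the minimum being over those $\gamma\in\Gamma_x$ with $\dot\gamma(1)$ parallel to $q$; if $x\in\mathbf V$, $L(x,0)=c_x$. It is extended by $L=+\infty$ to $(\mathbb R^N\times\mathbb R^N)\setminus T\Gamma$. Admissible curves. An absolutely continuous curve $\xi:[0,T]\to\Gamma$ is admissible if there is a finite partition $0=t_1<\dots<t_m=T$ of $[0,T]$ such that $\xi(t_i)\in\mathbf V$ for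 $i=2,\dots,m-1$ (if $m>2$) and, for every $i\in\{1,\dots,m-1\}$, either $\xi((t_i,t_{i+1}))\cap\mathbf V=\emptyset$ and $\xi(t_i)\neq\xi(t_{i+1})$, or $\xi$ is constantly equal to some vertex on $(t_i,t_{i+1})$.
   Formalization: If x = y is not a vertex, the minimizer need not be admissible: it may instead be a curve meeting no vertex, since with the given definition the claim fails there (e.g. a constant curve at the midpoint of a segment with H = μ², c = 0 is the unique minimizer). *)

theory Defs
  imports "HOL-Analysis.Analysis"
begin

section \<open>Networks\<close>

(* An arc is a function on [0,1], represented as a function on the reals that is
   extensional on {0..1}; equality of arcs is then equality on [0,1], and Hamiltonians
   can be indexed by the arcs themselves. *)

type_synonym 'a curve = "real \<Rightarrow> 'a"

definition inverse_arc :: "'a::euclidean_space curve \<Rightarrow> 'a curve" where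
  "inverse_arc \<gamma> = restrict (reversepath \<gamma>) {0..1}"

definition velocity :: "'a::euclidean_space curve \<Rightarrow> real \<Rightarrow> 'a" where
  "velocity \<gamma> s = vector_derivative \<gamma> (at s within {0..1})"

definition network_set :: "'a::euclidean_space curve set \<Rightarrow> 'a set" where
  "network_set E = (\<Union>\<gamma>\<in>E. \<gamma> ` {0..1})"

definition vertices :: "'a::euclidean_space curve set \<Rightarrow> 'a set" where
  "vertices E = (\<Union>\<gamma>\<in>E. {\<gamma> 0, \<gamma> 1})"

definition arcs_into :: "'a::euclidean_space curve set \<Rightarrow> 'a \<Rightarrow> 'a curve set" where
  "arcs_into E x = {\<gamma> \<in> E. \<gamma> 1 = x}"

definition tangent_bundle :: "'a::euclidean_space curve set \<Rightarrow> ('a \<times> 'a) set" where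
  "tangent_bundle E =
     {(x, q). \<exists>\<gamma>\<in>E. \<exists>s\<in>{0..1}. \<exists>l::real. x = \<gamma> s \<and> q = l *\<^sub>R velocity \<gamma> s}"

(* E is the set of all arcs, i.e. it already contains the inverse of each of its members. *)

locale network =
  fixes E :: "'a::euclidean_space curve set"
  assumes finite_arcs: "finite E"
    and extensional_arcs: "E \<subseteq> extensional {0..1}"
    and simple_arcs: "\<gamma> \<in> E \<Longrightarrow> simple_path \<gamma>"
    and differentiable_arcs: "\<gamma> \<in> E \<Longrightarrow> s \<in> {0..1} \<Longrightarrow>
          (\<gamma> has_vector_derivative velocity \<gamma> s) (at s within {0..1})"
    and continuous_velocity: "\<gamma> \<in> E \<Longrightarrow> continuous_on {0..1} (velocity \<gamma>)"
    and velocity_nonzero: "\<gamma> \<in> E \<Longrightarrow> s \<in> {0..1} \<Longrightarrow> velocity \<gamma> s \<noteq> 0"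
    and inverse_arcs: "\<gamma> \<in> E \<Longrightarrow> inverse_arc \<gamma> \<in> E"
    and disjoint_arcs: "\<gamma> \<in> E \<Longrightarrow> \<gamma>' \<in> E \<Longrightarrow> \<gamma> \<noteq> \<gamma>' \<Longrightarrow> \<gamma> \<noteq> inverse_arc \<gamma>' \<Longrightarrow>
          \<gamma> ` {0<..<1} \<inter> \<gamma>' ` {0..1} = {}"
    and connected_vertices: "x \<in> vertices E \<Longrightarrow> y \<in> vertices E \<Longrightarrow>
          (x, y) \<in> {(\<gamma> 0, \<gamma> 1) | \<gamma>. \<gamma> \<in> E}\<^sup>*"
    and no_loops: "\<gamma> \<in> E \<Longrightarrow> \<gamma> 0 \<noteq> \<gamma> 1"

section \<open>Hamiltonians, Lagrangians, flux limiters\<close>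

locale network_hamiltonian = network E
  for E :: "'a::euclidean_space curve set" +
  fixes H :: "'a curve \<Rightarrow> real \<Rightarrow> real \<Rightarrow> real"
  assumes H_continuous: "\<gamma> \<in> E \<Longrightarrow> continuous_on ({0..1} \<times> UNIV) (\<lambda>(s, \<mu>). H \<gamma> s \<mu>)"
    and H_convex: "\<gamma> \<in> E \<Longrightarrow> s \<in> {0..1} \<Longrightarrow> convex_on UNIV (H \<gamma> s)"
    and H_superlinear: "\<gamma> \<in> E \<Longrightarrow>
          filterlim (\<lambda>\<mu>. INF s\<in>{0..1}. H \<gamma> s \<mu> / \<bar>\<mu>\<bar>) at_top at_infinity"
    and H_inverse_arc: "\<gamma> \<in> E \<Longrightarrow> s \<in> {0..1} \<Longrightarrow> H (inverse_arc \<gamma>) s \<mu> = H \<gamma> (1 - s) (- \<mu>)"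

(* For Hamiltonians as above the suprema and infima over the reals in the next two
   definitions are attained. *)

definition arc_lagrangian ::
    "('a::euclidean_space curve \<Rightarrow> real \<Rightarrow> real \<Rightarrow> real) \<Rightarrow> 'a curve \<Rightarrow> real \<Rightarrow> real \<Rightarrow> real" where
  "arc_lagrangian H \<gamma> s l = (SUP \<mu>. l * \<mu> - H \<gamma> s \<mu>)"

definition arc_flux ::
    "('a::euclidean_space curve \<Rightarrow> real \<Rightarrow> real \<Rightarrow> real) \<Rightarrow> 'a curve \<Rightarrow> real" where
  "arc_flux H \<gamma> = - (SUP s\<in>{0..1}. INF \<mu>. H \<gamma> s \<mu>)"

definition flux_limiter ::
    "'a::euclidean_space curve set \<Rightarrow> ('a curve \<Rightarrow> real \<Rightarrow> real \<Rightarrow> real) \<Rightarrow> ('a \<Rightarrow> real) \<Rightarrow> bool" where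
  "flux_limiter E H c \<longleftrightarrow> (\<forall>x\<in>vertices E. c x \<le> Min (arc_flux H ` arcs_into E x))"

(* The Lagrangian of the arc \<gamma> at parameter s, evaluated at the component of q
   along the velocity of \<gamma>. *)

definition lagrangian_along ::
    "('a::euclidean_space curve \<Rightarrow> real \<Rightarrow> real \<Rightarrow> real) \<Rightarrow> 'a curve \<Rightarrow> real \<Rightarrow> 'a \<Rightarrow> real" where
  "lagrangian_along H \<gamma> s q =
     arc_lagrangian H \<gamma> s ((q \<bullet> velocity \<gamma> s) / (norm (velocity \<gamma> s))\<^sup>2)"

(* A non-vertex point lies on exactly two arcs, inverse to each other; by the symmetry
   of H the choice between them does not affect the value. *)

definition overall_lagrangian ::
    "'a::euclidean_space curve set \<Rightarrow> ('a curve \<Rightarrow> real \<Rightarrow> real \<Rightarrow> real) \<Rightarrow> ('a \<Rightarrow> real)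
       \<Rightarrow> 'a \<Rightarrow> 'a \<Rightarrow> ereal" where
  "overall_lagrangian E H c x q =
     (if (x, q) \<notin> tangent_bundle E then \<infinity>
      else if x \<notin> vertices E then
        (let \<gamma> = (SOME \<gamma>. \<gamma> \<in> E \<and> x \<in> \<gamma> ` {0<..<1})
         in ereal (lagrangian_along H \<gamma> (inv_into {0..1} \<gamma> x) q))
      else if q \<noteq> 0 then
        ereal (Min ((\<lambda>\<gamma>. lagrangian_along H \<gamma> 1 q) `
          {\<gamma> \<in> arcs_into E x. \<exists>k. velocity \<gamma> 1 = k *\<^sub>R q}))
      else ereal (c x))"

section \<open>Absolutely continuous curves, action, admissible curves\<close>

definition abs_continuous_on :: "real \<Rightarrow> real \<Rightarrow> (real \<Rightarrow> 'a::euclidean_space) \<Rightarrow> bool" where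
  "abs_continuous_on a b f \<longleftrightarrow>
     (\<forall>\<epsilon>>0. \<exists>\<delta>>0. \<forall>D S. D division_of S \<longrightarrow> S \<subseteq> {a..b} \<longrightarrow>
        (\<Sum>I\<in>D. Sup I - Inf I) < \<delta> \<longrightarrow> (\<Sum>I\<in>D. norm (f (Sup I) - f (Inf I))) < \<epsilon>)"

(* Lebesgue integral of an extended-real function as positive minus negative part. The
   overall Lagrangian is bounded below, so in the action the negative part is finite. *)

definition ereal_integral :: "real \<Rightarrow> real \<Rightarrow> (real \<Rightarrow> ereal) \<Rightarrow> ereal" where
  "ereal_integral a b f =
     enn2ereal (\<integral>\<^sup>+ t. e2ennreal (f t) \<partial>lebesgue_on {a..b})
     - enn2ereal (\<integral>\<^sup>+ t. e2ennreal (- f t) \<partial>lebesgue_on {a..b})"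

definition action ::
    "'a::euclidean_space curve set \<Rightarrow> ('a curve \<Rightarrow> real \<Rightarrow> real \<Rightarrow> real) \<Rightarrow> ('a \<Rightarrow> real)
       \<Rightarrow> real \<Rightarrow> (real \<Rightarrow> 'a) \<Rightarrow> ereal" where
  "action E H c T \<zeta> = ereal_integral 0 T
     (\<lambda>t. overall_lagrangian E H c (\<zeta> t) (vector_derivative \<zeta> (at t within {0..T})))"

definition admissible ::
    "'a::euclidean_space curve set \<Rightarrow> real \<Rightarrow> (real \<Rightarrow> 'a) \<Rightarrow> bool" where
  "admissible E T \<xi> \<longleftrightarrow>
     abs_continuous_on 0 T \<xi> \<and> \<xi> ` {0..T} \<subseteq> network_set E \<and>
     (\<exists>(m::nat) t. 2 \<le> m \<and> t 1 = 0 \<and> t m = T \<and> strict_mono_on {1..m} t \<and>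
        (\<forall>i\<in>{2..m-1}. \<xi> (t i) \<in> vertices E) \<and>
        (\<forall>i\<in>{1..m-1}.
           (\<xi> ` {t i<..<t (i + 1)} \<inter> vertices E = {} \<and> \<xi> (t i) \<noteq> \<xi> (t (i + 1))) \<or>
           (\<exists>v\<in>vertices E. \<forall>s\<in>{t i<..<t (i + 1)}. \<xi> s = v)))"

end

(* The direct method, run with subsolutions instead of convexity of the overall Lagrangian, which
   fails at the vertices. A potential Phi on the network, C^1 along arcs, together with a continuous
   G such that H_gamma(s, (Phi o gamma)'(s)) <= G(gamma(s)) on arcs and -c_v <= G(v) at vertices,
   bounds the action of every curve zeta on [a,b] from below by
   Phi(zeta(b)) - Phi(zeta(a)) - (integral of G(zeta)), a quantity that is continuous under uniform
   convergence. At almost every time the overall Lagrangian is the supremum of the derivatives of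
   these bounds, so taking the best bound on each cell of a fine partition and applying Fatou's lemma
   shows that the action is lower semicontinuous; superlinear growth gives uniform absolute
   continuity, hence compactness by Arzela-Ascoli, and a minimizer exists.

   To make it admissible, note that c_v <= c_gamma for the arcs ending at v provides, for every
   epsilon > 0, a subsolution with G = -c_v + epsilon along these arcs away from their other ends, so
   a loop based at v that meets no other vertex costs at least as much as resting at v. Only finitely
   many loops have to be replaced by rests, because distinct vertices have positive distance and the
   minimizer is uniformly continuous. *)

theory Submission
  imports Defs "HOL-Complex_Analysis.Great_Picard"
begin

section \<open>Absolutely continuous functions\<close>

text \<open>A curve can pass through a vertex with nonzero derivative only at isolated times. So at
  almost every time it either rests at a vertex, at cost \<open>c\<close>, or has a differentiable
  coordinate on an open arc; the minimum over arcs in the overall Lagrangian is met only on a null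
  set.

  Momenta prescribed on several arcs need not be the derivatives of one function on a network with
  cycles. Each is therefore completed to a function of mean zero on its arc, and the excess of the
  Hamiltonian that this causes elsewhere is put into \<open>G\<close>, a constant plus a large
  multiple of the distance to a compact set. Such a subsolution is sharp only on that set, a point
  or the trace of a loop, which is why every cell of a partition gets its own.

  The integrand of the action is never shown to be measurable. It is compared almost everywhere with
  integrable functions, below for the bounds and above for semicontinuity. Both need derivatives of
  absolutely continuous curves, which are obtained from the definition through Stieltjes measures
  and the theorem of Radon and Nikodym.\<close>

definition interval_family :: "real \<Rightarrow> real \<Rightarrow> 'i set \<Rightarrow> ('i \<Rightarrow> real) \<Rightarrow> ('i \<Rightarrow> real) \<Rightarrow> bool" where
  "interval_family a b J c d \<longleftrightarrow>
     finite J \<and> (\<forall>j\<in>J. a \<le> c j \<and> c j \<le> d j \<and> d j \<le> b) \<and>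
     pairwise (\<lambda>i j. {c i<..<d i} \<inter> {c j<..<d j} = {}) J"

lemma interval_familyI_division:
  assumes D: "D division_of S" and S: "S \<subseteq> {a..b::real}"
  shows "interval_family a b D Inf Sup"
proof -
  have box: "\<exists>l u. I = {l..u} \<and> l \<le> u \<and> I \<subseteq> {a..b}" if "I \<in> D" for I
    using division_ofD(2,3,4)[OF D that] S by fastforce
  have 1: "a \<le> Inf I \<and> Inf I \<le> Sup I \<and> Sup I \<le> b" if "I \<in> D" for I
    using box[OF that] by fastforce
  have 2: "{Inf I<..<Sup I} = interior I" if "I \<in> D" for I
    using box[OF that] by fastforce
  show ?thesis
    unfolding interval_family_def pairwise_def
    using division_ofD(1,5)[OF D] 1 2 by simp
qed

text \<open>Indexed families may repeat degenerate intervals, which a division excludes. Those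
  contribute nothing and are dropped; on the rest the map from indices to intervals is injective,
  because equal nondegenerate intervals would overlap. The free index type lets callers use single
  intervals, sequences or pairs.\<close>

lemma abs_continuous_onD:
  fixes f :: "real \<Rightarrow> 'a::euclidean_space"
  assumes f: "abs_continuous_on a b f" and "\<epsilon> > 0"
  obtains \<delta> where "\<delta> > 0"
    "\<And>(J :: 'i set) c d. interval_family a b J c d \<Longrightarrow> (\<Sum>j\<in>J. d j - c j) < \<delta> \<Longrightarrow>
        (\<Sum>j\<in>J. norm (f (d j) - f (c j))) < \<epsilon>"
proof -
  obtain \<delta> where "\<delta> > 0" and \<delta>: "\<And>D S. D division_of S \<Longrightarrow> S \<subseteq> {a..b} \<Longrightarrow>
      (\<Sum>I\<in>D. Sup I - Inf I) < \<delta> \<Longrightarrow> (\<Sum>I\<in>D. norm (f (Sup I) - f (Inf I))) < \<epsilon>"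
    using f \<open>\<epsilon> > 0\<close> unfolding abs_continuous_on_def by metis
  have "(\<Sum>j\<in>J. norm (f (d j) - f (c j))) < \<epsilon>"
    if J: "interval_family a b J c d" and len: "(\<Sum>j\<in>J. d j - c j) < \<delta>" for J :: "'i set" and c d
  proof -
    define K where "K = {j \<in> J. c j < d j}"
    have K: "finite K" "K \<subseteq> J" "\<And>j. j \<in> K \<Longrightarrow> c j < d j" "\<And>j. j \<in> J - K \<Longrightarrow> c j = d j"
      using J unfolding K_def interval_family_def by force+
    have disj: "{c i<..<d i} \<inter> {c j<..<d j} = {}" if "i \<in> J" "j \<in> J" "i \<noteq> j" for i j
      using J that unfolding interval_family_def pairwise_def by blast
    have inj: "inj_on (\<lambda>j. {c j..d j}) K"
    proof
      fix i j assume ij: "i \<in> K" "j \<in> K" "{c i..d i} = {c j..d j}"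
      then have "c i = c j" "d i = d j" using K(3) by (metis Icc_eq_Icc less_le_not_le)+
      then show "i = j" using disj[of i j] ij K(2) K(3)[of i] by (metis greaterThanLessThan_empty_iff inf.idem not_le subsetD)
    qed
    have div: "(\<lambda>j. {c j..d j}) ` K division_of (\<Union>j\<in>K. {c j..d j})"
      unfolding division_of_def
    proof (intro conjI ballI impI)
      fix I assume I: "I \<in> (\<lambda>j. {c j..d j}) ` K"
      show "\<exists>l u. I = cbox l u" using I by auto
      show "I \<noteq> {}" using I K(3) by force
      fix I' assume I': "I' \<in> (\<lambda>j. {c j..d j}) ` K" "I \<noteq> I'"
      then obtain i j where "i \<in> K" "j \<in> K" "I = {c i..d i}" "I' = {c j..d j}" "i \<noteq> j" using I by auto
      then show "interior I \<inter> interior I' = {}" using disj K(2) by auto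
    qed (use K in auto)
    have sub: "(\<Union>j\<in>K. {c j..d j}) \<subseteq> {a..b}"
      using J K(2) unfolding interval_family_def by fastforce
    have "(\<Sum>I\<in>(\<lambda>j. {c j..d j}) ` K. Sup I - Inf I) = (\<Sum>j\<in>K. d j - c j)"
      using K(3) by (subst sum.reindex[OF inj]) (auto intro!: sum.cong simp: less_imp_le)
    also have "\<dots> = (\<Sum>j\<in>J. d j - c j)"
      using J K unfolding interval_family_def by (intro sum.mono_neutral_left) auto
    finally have "(\<Sum>I\<in>(\<lambda>j. {c j..d j}) ` K. norm (f (Sup I) - f (Inf I))) < \<epsilon>"
      using len by (intro \<delta>[OF div sub]) simp
    moreover have "(\<Sum>I\<in>(\<lambda>j. {c j..d j}) ` K. norm (f (Sup I) - f (Inf I))) = (\<Sum>j\<in>K. norm (f (d j) - f (c j)))"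
      using K(3) by (subst sum.reindex[OF inj]) (auto intro!: sum.cong simp: less_imp_le)
    moreover have "\<dots> = (\<Sum>j\<in>J. norm (f (d j) - f (c j)))"
      using J K unfolding interval_family_def by (intro sum.mono_neutral_left) auto
    ultimately show ?thesis by simp
  qed
  with \<open>\<delta> > 0\<close> show thesis by (rule that)
qed

text \<open>The index type \<open>real set\<close> is chosen because a division is a family indexed
  by its own members, with \<open>Inf\<close> and \<open>Sup\<close> as the maps to the end
  points.\<close>

lemma abs_continuous_onI:
  fixes f :: "real \<Rightarrow> 'a::euclidean_space"
  assumes "\<And>\<epsilon>. \<epsilon> > 0 \<Longrightarrow> \<exists>\<delta>>0. \<forall>J c d. interval_family a b (J :: real set set) c d \<longrightarrow> (\<Sum>j\<in>J. d j - c j) < \<delta> \<longrightarrow>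
        (\<Sum>j\<in>J. norm (f (d j) - f (c j))) < \<epsilon>"
  shows "abs_continuous_on a b f"
  unfolding abs_continuous_on_def
proof (intro allI impI)
  fix \<epsilon> :: real assume "\<epsilon> > 0"
  then obtain \<delta> where \<delta>: "\<delta> > 0" "\<And>J c d. interval_family a b (J :: real set set) c d \<Longrightarrow> (\<Sum>j\<in>J. d j - c j) < \<delta> \<Longrightarrow>
        (\<Sum>j\<in>J. norm (f (d j) - f (c j))) < \<epsilon>"
    using assms by meson
  show "\<exists>\<delta>>0. \<forall>D S. D division_of S \<longrightarrow> S \<subseteq> {a..b} \<longrightarrow>
        (\<Sum>I\<in>D. Sup I - Inf I) < \<delta> \<longrightarrow> (\<Sum>I\<in>D. norm (f (Sup I) - f (Inf I))) < \<epsilon>"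
    using \<delta>(1) \<delta>(2)[OF interval_familyI_division] by blast
qed

lemma interval_family_single: "interval_family a b {()} (\<lambda>_. c) (\<lambda>_. d) \<longleftrightarrow> a \<le> c \<and> c \<le> d \<and> d \<le> b"
  by (auto simp: interval_family_def pairwise_def)

lemma interval_family_shrink:
  assumes "interval_family a b J c d"
    and "\<And>j. j \<in> J \<Longrightarrow> c j \<le> c' j \<and> c' j \<le> d' j \<and> d' j \<le> d j"
  shows "interval_family a b J c' d'"
proof -
  have "{c' i<..<d' i} \<subseteq> {c i<..<d i}" if "i \<in> J" for i
    using assms(2)[OF that] by auto
  then show ?thesis
    using assms unfolding interval_family_def pairwise_def by (smt (verit) disjoint_iff subsetD)
qed

lemma sum_length_interval_family:
  assumes J: "interval_family a b J c d"
  shows "emeasure lborel (\<Union>j\<in>J. {c j<..<d j}) = ennreal (\<Sum>j\<in>J. d j - c j)"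
proof -
  have "emeasure lborel (\<Union>j\<in>J. {c j<..<d j}) = (\<Sum>j\<in>J. emeasure lborel {c j<..<d j})"
    using J by (intro sum_emeasure[symmetric])
      (auto simp: interval_family_def disjoint_family_on_def pairwise_def)
  also have "\<dots> = (\<Sum>j\<in>J. ennreal (d j - c j))"
    using J by (intro sum.cong) (auto simp: interval_family_def)
  also have "\<dots> = ennreal (\<Sum>j\<in>J. d j - c j)"
    using J by (intro sum_ennreal) (auto simp: interval_family_def)
  finally show ?thesis .
qed

lemma sum_length_le_measure:
  assumes J: "interval_family a b J c d" and U: "open U" "\<And>j. j \<in> J \<Longrightarrow> {c j<..<d j} \<subseteq> U"
  shows "ennreal (\<Sum>j\<in>J. d j - c j) \<le> emeasure lborel U"
  unfolding sum_length_interval_family[OF J, symmetric]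
  using U by (intro emeasure_mono) auto

lemma abs_continuous_on_imp_continuous_on:
  fixes f :: "real \<Rightarrow> 'a::euclidean_space"
  assumes f: "abs_continuous_on a b f"
  shows "continuous_on {a..b} f"
  unfolding continuous_on_iff
proof (intro ballI allI impI)
  fix x \<epsilon> :: real assume x: "x \<in> {a..b}" "\<epsilon> > 0"
  obtain \<delta> where \<delta>: "\<delta> > 0" "\<And>(J :: unit set) c d. interval_family a b J c d \<Longrightarrow> (\<Sum>j\<in>J. d j - c j) < \<delta> \<Longrightarrow>
        (\<Sum>j\<in>J. norm (f (d j) - f (c j))) < \<epsilon>"
    using abs_continuous_onD[OF f \<open>\<epsilon> > 0\<close>, where 'i = unit] by blast
  have *: "norm (f v - f u) < \<epsilon>" if "a \<le> u" "u \<le> v" "v \<le> b" "v - u < \<delta>" for u v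
    using \<delta>(2)[of "{()}" "\<lambda>_. u" "\<lambda>_. v"] that by (simp add: interval_family_single)
  have "dist (f y) (f x) < \<epsilon>" if "y \<in> {a..b}" "dist y x < \<delta>" for y
    using *[of x y] *[of y x] that x
    by (cases "x \<le> y") (auto simp: dist_norm dist_real_def norm_minus_commute)
  with \<delta>(1) show "\<exists>d>0. \<forall>y\<in>{a..b}. dist y x < d \<longrightarrow> dist (f y) (f x) < \<epsilon>" by blast
qed

lemma lipschitz_on_imp_abs_continuous_on:
  assumes f: "L-lipschitz_on {a..b} f"
  shows "abs_continuous_on a b f"
proof (rule abs_continuous_onI)
  fix \<epsilon> :: real assume "\<epsilon> > 0"
  have L: "L \<ge> 0" using f lipschitz_on_nonneg by blast
  show "\<exists>\<delta>>0. \<forall>J c d. interval_family a b (J :: real set set) c d \<longrightarrow> (\<Sum>j\<in>J. d j - c j) < \<delta> \<longrightarrow>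
        (\<Sum>j\<in>J. norm (f (d j) - f (c j))) < \<epsilon>"
  proof (intro exI conjI allI impI)
    show "\<epsilon> / (L + 1) > 0" using \<open>\<epsilon> > 0\<close> L by simp
    fix J :: "real set set" and c d
    assume J: "interval_family a b J c d" "(\<Sum>j\<in>J. d j - c j) < \<epsilon> / (L + 1)"
    have "norm (f (d j) - f (c j)) \<le> L * (d j - c j)" if "j \<in> J" for j
      using lipschitz_onD[OF f, of "d j" "c j"] J(1) that
      by (force simp: interval_family_def dist_norm)
    then have "(\<Sum>j\<in>J. norm (f (d j) - f (c j))) \<le> L * (\<Sum>j\<in>J. d j - c j)"
      by (simp add: sum_distrib_left sum_mono)
    also have "\<dots> \<le> (L + 1) * (\<Sum>j\<in>J. d j - c j)"
      using J(1) by (intro mult_right_mono sum_nonneg) (auto simp: interval_family_def)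
    also have "\<dots> < \<epsilon>" using J(2) L by (simp add: field_simps)
    finally show "(\<Sum>j\<in>J. norm (f (d j) - f (c j))) < \<epsilon>" .
  qed
qed

lemma abs_continuous_on_le:
  assumes f: "abs_continuous_on a b f"
    and g: "\<And>u v. a \<le> u \<Longrightarrow> u \<le> v \<Longrightarrow> v \<le> b \<Longrightarrow> norm (g v - g u) \<le> norm (f v - f u)"
  shows "abs_continuous_on a b g"
proof (rule abs_continuous_onI)
  fix \<epsilon> :: real assume "\<epsilon> > 0"
  from abs_continuous_onD[OF f \<open>\<epsilon> > 0\<close>, where 'i = "real set"]
  obtain \<delta> where \<delta>: "\<delta> > 0" "\<And>(J :: real set set) c d. interval_family a b J c d \<Longrightarrow> (\<Sum>j\<in>J. d j - c j) < \<delta> \<Longrightarrow>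
        (\<Sum>j\<in>J. norm (f (d j) - f (c j))) < \<epsilon>" by blast
  show "\<exists>\<delta>>0. \<forall>J c d. interval_family a b (J :: real set set) c d \<longrightarrow> (\<Sum>j\<in>J. d j - c j) < \<delta> \<longrightarrow>
        (\<Sum>j\<in>J. norm (g (d j) - g (c j))) < \<epsilon>"
  proof (intro exI conjI allI impI)
    fix J :: "real set set" and c d
    assume J: "interval_family a b J c d" "(\<Sum>j\<in>J. d j - c j) < \<delta>"
    have "(\<Sum>j\<in>J. norm (g (d j) - g (c j))) \<le> (\<Sum>j\<in>J. norm (f (d j) - f (c j)))"
      using J(1) by (intro sum_mono g) (auto simp: interval_family_def)
    also have "\<dots> < \<epsilon>" by (rule \<delta>(2)[OF J])
    finally show "(\<Sum>j\<in>J. norm (g (d j) - g (c j))) < \<epsilon>" .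
  qed (rule \<delta>(1))
qed

subsection \<open>Monotone functions with absolutely continuous Stieltjes measure\<close>

text \<open>The density is the Radon-Nikodym derivative of the Stieltjes measure \<open>M\<close> of
  \<open>F\<close>. Constancy outside \<open>{a..b}\<close> makes \<open>M\<close> finite and
  carried by \<open>{a..b}\<close>; the \<epsilon>-\<delta> condition on \<open>F\<close> has to be
  turned into absolute continuity of \<open>M\<close> with respect to Lebesgue measure.\<close>

lemma mono_abs_continuous_density:
  fixes F :: "real \<Rightarrow> real"
  assumes mono: "mono F" and cont: "continuous_on UNIV F"
    and const: "\<And>x. x \<le> a \<Longrightarrow> F x = F a" "\<And>x. b \<le> x \<Longrightarrow> F x = F b" and "a < b"
    and ac: "\<And>\<epsilon>. \<epsilon> > 0 \<Longrightarrow> \<exists>\<delta>>0. \<forall>(J::nat set) c d. interval_family a b J c d \<longrightarrow> (\<Sum>j\<in>J. d j - c j) < \<delta> \<longrightarrow>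
        (\<Sum>j\<in>J. F (d j) - F (c j)) < \<epsilon>"
  shows "\<exists>\<rho>. integrable lborel \<rho> \<and> (\<forall>c d. c \<le> d \<longrightarrow> (\<rho> has_integral (F d - F c)) {c..d})"
proof -
  define M where "M = interval_measure F"
  have sets_M [simp, measurable_cong]: "sets M = sets borel" and space_M [simp]: "space M = UNIV"
    by (simp_all add: M_def)
  have Icc: "emeasure M {c..d} = ennreal (F d - F c)" if "c \<le> d" for c d
    unfolding M_def using that monoD[OF mono] continuous_on_subset[OF cont subset_UNIV]
    by (intro emeasure_interval_measure_Icc) auto
  have total: "emeasure M UNIV = ennreal (F b - F a)"
  proof -
    have "(SUP n. emeasure M {- real n..real n}) = emeasure M (\<Union>n. {- real n..real n})"
      by (intro SUP_emeasure_incseq) (auto simp: incseq_def)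
    also have "(\<Union>n. {- real n..real n}) = UNIV"
      using real_arch_simple[of "\<bar>x\<bar>" for x] by (force simp: abs_le_iff)
    finally have "emeasure M UNIV = (SUP n. emeasure M {- real n..real n})" by simp
    also have "\<dots> \<le> ennreal (F b - F a)"
    proof (rule SUP_least)
      fix n :: nat
      have "F (real n) \<le> F b" "F a \<le> F (- real n)"
        using const[of "real n"] const[of "- real n"] monoD[OF mono, of "real n" b] monoD[OF mono, of a "- real n"]
        by (metis linear order_refl)+
      then show "emeasure M {- real n..real n} \<le> ennreal (F b - F a)"
        by (subst Icc) (auto intro!: ennreal_leI)
    qed
    finally have "emeasure M UNIV \<le> ennreal (F b - F a)" .
    moreover have "ennreal (F b - F a) \<le> emeasure M UNIV"
      using Icc[of a b] \<open>a < b\<close> emeasure_mono[of "{a..b}" UNIV M] by simp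
    ultimately show ?thesis by simp
  qed
  then interpret M: finite_measure M by (intro finite_measureI) simp
  have out: "emeasure M (- {a..b}) = 0"
    using Icc[of a b] total \<open>a < b\<close> emeasure_compl[of "{a..b}" M] by (simp add: Compl_eq_Diff_UNIV)
  \<comment> \<open>A compact null set has an open neighbourhood \<open>U\<close> of length below
    \<delta>. Compactness leaves a margin \<open>r\<close> around \<open>K\<close> inside
    \<open>U\<close>, so finitely many grid cells suffice and the condition on finite families
    applies.\<close>
  have small: "emeasure M K \<le> ennreal \<epsilon>"
    if "\<epsilon> > 0" and K: "compact K" "K \<subseteq> {a..b}" "emeasure lborel K = 0" for K \<epsilon>
  proof -
    obtain \<delta> where \<delta>: "\<delta> > 0" "\<And>(J::nat set) c d. interval_family a b J c d \<Longrightarrow> (\<Sum>j\<in>J. d j - c j) < \<delta> \<Longrightarrow>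
        (\<Sum>j\<in>J. F (d j) - F (c j)) < \<epsilon>"
      using ac[OF \<open>\<epsilon> > 0\<close>] by blast
    have "K \<in> sets borel" using K(1) borel_compact by blast
    then obtain U where U: "open U" "K \<subseteq> U" "emeasure lborel (U - K) < ennreal \<delta>"
      using outer_regular_lborel[of K \<delta>] \<delta>(1) by blast
    have "emeasure lborel U \<le> emeasure lborel (U - K) + emeasure lborel K"
      using U \<open>K \<in> sets borel\<close> by (subst plus_emeasure) (auto intro!: emeasure_mono)
    then have lamU: "emeasure lborel U < ennreal \<delta>" using U(3) K(3) by simp
    obtain r where r: "r > 0" "(\<Union>x\<in>K. ball x r) \<subseteq> U"
      using compact_subset_open_imp_ball_epsilon_subset[OF K(1) U(1,2)] by blast
    obtain n :: nat where n: "n > 0" "(b - a) / r < n"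
      by (metis gr0I of_nat_0 less_trans not_less reals_Archimedean2 divide_pos_pos diff_gt_0_iff_gt \<open>a < b\<close> r(1) of_nat_0_less_iff)
    define h where "h = (b - a) / n"
    have h: "h > 0" "h < r" using n \<open>a < b\<close> r(1) by (auto simp: h_def field_simps)
    define t where "t i = a + real i * h" for i :: nat
    have t0: "t 0 = a" "t n = b" using n by (auto simp: t_def h_def)
    have tS: "t (Suc i) = t i + h" for i by (simp add: t_def algebra_simps)
    have tmono: "i \<le> j \<Longrightarrow> t i \<le> t j" for i j using h by (simp add: t_def)
    \<comment> \<open>The grid cells that meet \<open>K\<close>. The mesh \<open>h\<close> is below
      \<open>r\<close>, so their interiors lie in \<open>U\<close> and their total length is below
      \<delta>.\<close>
    define J where "J = {i. i < n \<and> {t i..t (Suc i)} \<inter> K \<noteq> {}}"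
    have fam: "interval_family a b J t (\<lambda>i. t (Suc i))"
      unfolding interval_family_def pairwise_def
    proof (intro conjI ballI impI)
      show "finite J" by (simp add: J_def)
      fix i assume "i \<in> J"
      then have "i < n" by (simp add: J_def)
      then show "a \<le> t i" "t i \<le> t (Suc i)" "t (Suc i) \<le> b"
        using tmono[of 0 i] tmono[of i "Suc i"] tmono[of "Suc i" n] t0 by auto
      fix j assume "j \<in> J" "i \<noteq> j"
      then have "t (Suc i) \<le> t j \<or> t (Suc j) \<le> t i"
        by (metis tmono Suc_leI nat_neq_iff)
      then show "{t i<..<t (Suc i)} \<inter> {t j<..<t (Suc j)} = {}" by auto
    qed
    have "{t i<..<t (Suc i)} \<subseteq> U" if "i \<in> J" for i
    proof -
      have "{t i..t (Suc i)} \<inter> K \<noteq> {}" using that by (simp add: J_def)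
      then obtain x where x: "x \<in> K" "t i \<le> x" "x \<le> t (Suc i)" by fastforce
      have "{t i<..<t (Suc i)} \<subseteq> ball x r"
        using x h tS[of i] by (auto simp: dist_real_def)
      then show ?thesis using r(2) x(1) by blast
    qed
    then have "ennreal (\<Sum>j\<in>J. t (Suc j) - t j) \<le> emeasure lborel U"
      by (intro sum_length_le_measure[OF fam U(1)])
    then have "ennreal (\<Sum>j\<in>J. t (Suc j) - t j) < ennreal \<delta>" using lamU by simp
    then have "(\<Sum>j\<in>J. t (Suc j) - t j) < \<delta>" using \<delta>(1) by (simp add: ennreal_less_iff sum_nonneg h(1) less_imp_le tS)
    then have F: "(\<Sum>j\<in>J. F (t (Suc j)) - F (t j)) < \<epsilon>" by (rule \<delta>(2)[OF fam])
    have "K \<subseteq> (\<Union>i\<in>J. {t i..t (Suc i)})"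
    proof
      fix x assume x: "x \<in> K"
      then have xab: "a \<le> x" "x \<le> b" using K(2) by auto
      define i where "i = (LEAST i. x \<le> t (Suc i))"
      have "x \<le> t (Suc (n - 1))" using xab t0 n by simp
      then have i: "x \<le> t (Suc i)" "i \<le> n - 1" unfolding i_def by (rule LeastI, rule Least_le)
      have "t i \<le> x"
      proof (cases i)
        case (Suc k)
        then have "\<not> x \<le> t (Suc k)" using not_less_Least[of k "\<lambda>i. x \<le> t (Suc i)"] i_def by auto
        then show ?thesis using Suc by simp
      qed (use xab t0 in auto)
      moreover have "i < n" using i(2) n by simp
      ultimately have "i \<in> J" using i(1) x by (auto simp: J_def)
      then show "x \<in> (\<Union>i\<in>J. {t i..t (Suc i)})" using i(1) \<open>t i \<le> x\<close> by auto
    qed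
    then have "emeasure M K \<le> emeasure M (\<Union>i\<in>J. {t i..t (Suc i)})"
      by (intro emeasure_mono) (auto simp: J_def)
    also have "\<dots> \<le> (\<Sum>i\<in>J. emeasure M {t i..t (Suc i)})"
      by (intro emeasure_subadditive_finite) (auto simp: J_def)
    also have "\<dots> = (\<Sum>i\<in>J. ennreal (F (t (Suc i)) - F (t i)))"
      by (intro sum.cong refl Icc tmono) simp
    also have "\<dots> = ennreal (\<Sum>i\<in>J. F (t (Suc i)) - F (t i))"
      by (intro sum_ennreal) (simp add: monoD[OF mono] tmono)
    also have "\<dots> \<le> ennreal \<epsilon>" using F by (intro ennreal_leI) simp
    finally show ?thesis .
  qed
  have "absolutely_continuous lborel M"
    unfolding absolutely_continuous_def
  proof
    fix N :: "real set" assume N: "N \<in> null_sets lborel"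
    then have Nb: "N \<in> sets borel" by auto
    \<comment> \<open>Inner regularity of the finite measure \<open>M\<close> reduces an arbitrary
      null set to its compact subsets.\<close>
    have "emeasure M K = 0" if "K \<subseteq> N \<inter> {a..b}" "compact K" for K
    proof -
      have "emeasure lborel K \<le> emeasure lborel N"
        using that Nb by (intro emeasure_mono) auto
      then have "emeasure lborel K = 0" using N by auto
      then have "emeasure M K \<le> ennreal \<epsilon>" if "\<epsilon> > 0" for \<epsilon>
        using small[OF that \<open>compact K\<close>] \<open>K \<subseteq> _\<close> by blast
      then show ?thesis using ennreal_le_epsilon[of 0 "emeasure M K"] by (metis add_0 le_zero_eq)
    qed
    then have "emeasure M (N \<inter> {a..b}) = 0"
      using Nb total by (subst inner_regular) (auto intro!: antisym SUP_least)
    moreover have "emeasure M N \<le> emeasure M (N \<inter> {a..b}) + emeasure M (- {a..b})"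
      using Nb by (subst plus_emeasure) (auto intro!: emeasure_mono)
    ultimately show "N \<in> null_sets M" using Nb out by auto
  qed
  then obtain f where f: "f \<in> borel_measurable lborel" "density lborel f = M"
    using sigma_finite_measure.Radon_Nikodym[OF sigma_finite_lborel, of M] by auto
  have f_int: "(\<integral>\<^sup>+x. f x * indicator A x \<partial>lborel) = emeasure M A" if "A \<in> sets borel" for A
    using emeasure_density[OF f(1), of A] f(2) that by simp
  have "(\<integral>\<^sup>+x. f x \<partial>lborel) = ennreal (F b - F a)" using f_int[of UNIV] total by simp
  then have fin: "AE x in lborel. f x \<noteq> \<infinity>" using f(1) by (intro nn_integral_PInf_AE) auto
  define \<rho> where "\<rho> x = enn2real (f x)" for x
  have [measurable]: "\<rho> \<in> borel_measurable borel" "f \<in> borel_measurable borel" using f(1) unfolding \<rho>_def by measurable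
  have \<rho>f: "AE x in lborel. ennreal (\<rho> x) = f x"
    using fin by eventually_elim (auto simp: \<rho>_def less_top)
  have "integrable lborel \<rho>"
  proof (rule integrableI_nonneg)
    have "(\<integral>\<^sup>+x. ennreal (\<rho> x) \<partial>lborel) = (\<integral>\<^sup>+x. f x \<partial>lborel)"
      using \<rho>f by (intro nn_integral_cong_AE)
    then show "(\<integral>\<^sup>+x. ennreal (\<rho> x) \<partial>lborel) < \<infinity>"
      using \<open>(\<integral>\<^sup>+x. f x \<partial>lborel) = _\<close> by simp
  qed (auto simp: \<rho>_def)
  moreover have "(\<rho> has_integral (F d - F c)) {c..d}" if "c \<le> d" for c d
  proof -
    have "(\<integral>\<^sup>+x. ennreal (\<rho> x * indicator {c..d} x) \<partial>lborel) = (\<integral>\<^sup>+x. f x * indicator {c..d} x \<partial>lborel)"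
      using \<rho>f by (intro nn_integral_cong_AE) (auto elim!: eventually_mono split: split_indicator)
    also have "\<dots> = ennreal (F d - F c)" using f_int Icc that by simp
    finally have "((\<lambda>x. \<rho> x * indicator {c..d} x) has_integral (F d - F c)) UNIV"
      using monoD[OF mono that]
      by (intro nn_integral_has_integral[where f = "\<lambda>x. \<rho> x * indicator {c..d} x"]) (auto simp: \<rho>_def)
    moreover have "(\<lambda>x. \<rho> x * indicator {c..d} x) = (\<lambda>x. if x \<in> {c..d} then \<rho> x else 0)"
      by auto
    ultimately show ?thesis by (simp only: has_integral_restrict_UNIV)
  qed
  ultimately show ?thesis by blast
qed

subsection \<open>Total variation\<close>

text \<open>The total variation on \<open>{c..d}\<close>. A partition is a monotone sequence
  together with its number of cells. Repeated points are allowed, so truncating a partition with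
  \<open>min\<close> or \<open>max\<close> yields a partition again.\<close>

definition variation :: "(real \<Rightarrow> 'a::real_normed_vector) \<Rightarrow> real \<Rightarrow> real \<Rightarrow> ennreal" where
  "variation f c d = (SUP p\<in>{p. mono (fst p) \<and> c \<le> fst p 0 \<and> fst p (snd p) \<le> d}.
     \<Sum>i<snd p. ennreal (norm (f (fst p (Suc i)) - f (fst p (i::nat)))))"

lemma variation_upper:
  "mono t \<Longrightarrow> c \<le> t 0 \<Longrightarrow> t n \<le> d \<Longrightarrow> (\<Sum>i<n. ennreal (norm (f (t (Suc i)) - f (t i)))) \<le> variation f c d"
  unfolding variation_def by (rule SUP_upper2[of "(t, n)"]) auto

lemma variation_least:
  assumes "\<And>t n. mono t \<Longrightarrow> c \<le> t 0 \<Longrightarrow> t n \<le> d \<Longrightarrow> (\<Sum>i<n. ennreal (norm (f (t (Suc i)) - f (t i)))) \<le> y"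
  shows "variation f c d \<le> y"
  unfolding variation_def using assms by (intro SUP_least) auto

lemma norm_le_variation: "c \<le> d \<Longrightarrow> ennreal (norm (f d - f c)) \<le> variation f c d"
  using variation_upper[of "\<lambda>i. if i = 0 then c else d" c 1 d f] by (simp add: mono_def)

text \<open>Truncating a partition of the whole interval at \<open>d\<close> gives one of each half,
  and the triangle inequality handles the cell that contains \<open>d\<close>. Conversely,
  partitions of the halves are concatenated, and the cell that joins them can only increase the
  sum.\<close>

lemma variation_add:
  assumes "c \<le> d" "d \<le> e"
  shows "variation f c e = variation f c d + variation f d e"
proof (rule antisym)
  let ?N = "\<lambda>x y. ennreal (norm (f y - f x))"
  show "variation f c e \<le> variation f c d + variation f d e"
  proof (rule variation_least)
    fix t :: "nat \<Rightarrow> real" and n assume t: "mono t" "c \<le> t 0" "t n \<le> e"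
    have "?N (t i) (t (Suc i)) \<le> ?N (min (t i) d) (min (t (Suc i)) d) + ?N (max (t i) d) (max (t (Suc i)) d)" for i
    proof (cases "t i \<le> d \<and> d \<le> t (Suc i)")
      case True
      then have "?N (min (t i) d) (min (t (Suc i)) d) + ?N (max (t i) d) (max (t (Suc i)) d)
        = ennreal (norm (f d - f (t i)) + norm (f (t (Suc i)) - f d))"
        by (simp add: min_absorb1 min_absorb2 max_absorb1 max_absorb2)
      moreover have "norm (f (t (Suc i)) - f (t i)) \<le> norm (f d - f (t i)) + norm (f (t (Suc i)) - f d)"
        using norm_triangle_ineq[of "f d - f (t i)" "f (t (Suc i)) - f d"] by simp
      ultimately show ?thesis by (metis ennreal_leI)
    next
      case False
      then show ?thesis using monoD[OF t(1), of i "Suc i"] by (auto simp: min_def max_def)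
    qed
    then have "(\<Sum>i<n. ?N (t i) (t (Suc i))) \<le> (\<Sum>i<n. ?N (min (t i) d) (min (t (Suc i)) d)) + (\<Sum>i<n. ?N (max (t i) d) (max (t (Suc i)) d))"
      unfolding sum.distrib[symmetric] by (rule sum_mono)
    also have "\<dots> \<le> variation f c d + variation f d e"
      using t assms by (intro add_mono variation_upper[of "\<lambda>i. min (t i) d"] variation_upper[of "\<lambda>i. max (t i) d"])
        (auto simp: mono_def min_def max_def intro: order_trans)
    finally show "(\<Sum>i<n. ?N (t i) (t (Suc i))) \<le> variation f c d + variation f d e" .
  qed
  have "(\<Sum>i<n. ?N (t i) (t (Suc i))) + (\<Sum>i<m. ?N (s i) (s (Suc i))) \<le> variation f c e"
    if t: "mono t" "c \<le> t 0" "t n \<le> d" and s: "mono s" "d \<le> s 0" "s m \<le> e" for t s :: "nat \<Rightarrow> real" and n m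
  proof -
    \<comment> \<open>Cell number \<open>n\<close> of the concatenation runs from \<open>t n\<close>
      to \<open>s 0\<close>; it accounts for \<open>Suc n + m\<close> cells instead of
      \<open>n + m\<close>.\<close>
    define u where "u i = (if i \<le> n then t i else s (i - Suc n))" for i
    have "t i \<le> s j" if "i \<le> n" for i j
      using monoD[OF t(1) that] monoD[OF s(1), of 0 j] t s by linarith
    then have "u i \<le> u j" if "i \<le> j" for i j
      unfolding u_def using monoD[OF t(1)] monoD[OF s(1)] that by auto
    then have "mono u" by (rule monoI)
    then have "(\<Sum>i<Suc n + m. ?N (u i) (u (Suc i))) \<le> variation f c e"
      using t s assms by (intro variation_upper \<open>mono u\<close>) (auto simp: u_def simp del: sum.lessThan_Suc)
    moreover have "(\<Sum>i<n. ?N (t i) (t (Suc i))) + (\<Sum>i<m. ?N (s i) (s (Suc i))) \<le> (\<Sum>i<Suc n + m. ?N (u i) (u (Suc i)))"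
    proof -
      have "(\<Sum>i<Suc n + m. ?N (u i) (u (Suc i))) = (\<Sum>i<Suc n. ?N (u i) (u (Suc i))) + (\<Sum>i<m. ?N (u (Suc n + i)) (u (Suc (Suc n + i))))"
        by (induction m) (simp_all add: add.assoc)
      moreover have "(\<Sum>i<n. ?N (t i) (t (Suc i))) \<le> (\<Sum>i<Suc n. ?N (u i) (u (Suc i)))"
        by (simp add: u_def)
      moreover have "(\<Sum>i<m. ?N (s i) (s (Suc i))) = (\<Sum>i<m. ?N (u (Suc n + i)) (u (Suc (Suc n + i))))"
        by (intro sum.cong) (auto simp: u_def)
      ultimately show ?thesis by (simp add: add_mono)
    qed
    ultimately show ?thesis by simp
  qed
  then have "variation f c d + (\<Sum>i<m. ?N (s i) (s (Suc i))) \<le> variation f c e"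
    if s: "mono s" "d \<le> s 0" "s m \<le> e" for s :: "nat \<Rightarrow> real" and m
    unfolding variation_def[of f c d] using that
    by (subst ennreal_SUP_add_left[symmetric]) (auto intro!: SUP_least exI[of _ "\<lambda>_. c"] simp: mono_def assms)
  then show "variation f c d + variation f d e \<le> variation f c e"
    unfolding variation_def[of f d e]
    by (subst ennreal_SUP_add_right) (auto intro!: SUP_least exI[of _ "\<lambda>_. d"] simp: mono_def assms)
qed

text \<open>Choices in different summands are independent, so a bound for every simultaneous choice
  bounds the sum of the suprema. In the induction \<open>x\<close> collects the terms whose choice
  is already fixed.\<close>

lemma sum_SUP_le_ennreal:
  fixes g :: "'i \<Rightarrow> 'j \<Rightarrow> ennreal"
  assumes "finite J" "\<And>j. j \<in> J \<Longrightarrow> P j \<noteq> {}"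
    and "\<And>p. (\<And>j. j \<in> J \<Longrightarrow> p j \<in> P j) \<Longrightarrow> x + (\<Sum>j\<in>J. g j (p j)) \<le> y"
  shows "x + (\<Sum>j\<in>J. SUP q\<in>P j. g j q) \<le> y"
  using assms
proof (induction J arbitrary: x rule: finite_induct)
  case empty
  then show ?case by simp
next
  case (insert j J)
  let ?S = "\<Sum>j\<in>J. SUP q\<in>P j. g j q"
  have "g j q + (x + ?S) \<le> y" if q: "q \<in> P j" for q
  proof -
    have "x + g j q + (\<Sum>j\<in>J. g j (p j)) \<le> y" if "\<And>i. i \<in> J \<Longrightarrow> p i \<in> P i" for p
    proof -
      have "x + (\<Sum>i\<in>insert j J. g i ((p(j := q)) i)) \<le> y"
        using that q insert.hyps by (intro insert.prems(2)) auto
      moreover have "(\<Sum>i\<in>J. g i ((p(j := q)) i)) = (\<Sum>i\<in>J. g i (p i))"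
        using insert.hyps by (intro sum.cong) auto
      ultimately show ?thesis using insert.hyps by (simp add: add.assoc)
    qed
    then have "x + g j q + ?S \<le> y" using insert.prems by (intro insert.IH) auto
    then show ?thesis by (simp add: ac_simps)
  qed
  then have "(SUP q\<in>P j. g j q + (x + ?S)) \<le> y" by (intro SUP_least)
  then have "(SUP q\<in>P j. g j q) + (x + ?S) \<le> y"
    using insert.prems(1) by (subst (asm) ennreal_SUP_add_left) auto
  then show ?case using insert.hyps by (simp add: ac_simps)
qed

text \<open>Partitions chosen inside the intervals of a family merge into one family indexed by
  pairs. Its total length telescopes to at most the old one, so the \<delta> of \<open>f\<close>
  serves for the variation too; the supremum turns the strict bound into a weak one.\<close>

lemma variation_small:
  fixes f :: "real \<Rightarrow> 'a::euclidean_space"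
  assumes f: "abs_continuous_on a b f" and "\<epsilon> > 0"
  obtains \<delta> where "\<delta> > 0"
    "\<And>(J :: nat set) c d. interval_family a b J c d \<Longrightarrow> (\<Sum>j\<in>J. d j - c j) < \<delta> \<Longrightarrow>
        (\<Sum>j\<in>J. variation f (c j) (d j)) \<le> ennreal \<epsilon>"
proof -
  obtain \<delta> where \<delta>: "\<delta> > 0" "\<And>(J :: (nat \<times> nat) set) c d. interval_family a b J c d \<Longrightarrow> (\<Sum>j\<in>J. d j - c j) < \<delta> \<Longrightarrow>
        (\<Sum>j\<in>J. norm (f (d j) - f (c j))) < \<epsilon>"
    using abs_continuous_onD[OF f \<open>\<epsilon> > 0\<close>, where 'i = "nat \<times> nat"] by blast
  have "(\<Sum>j\<in>J. variation f (c j) (d j)) \<le> ennreal \<epsilon>"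
    if J: "interval_family a b J c d" "(\<Sum>j\<in>J. d j - c j) < \<delta>" for J :: "nat set" and c d
  proof -
    have fin: "finite J" and le: "\<And>j. j \<in> J \<Longrightarrow> a \<le> c j \<and> c j \<le> d j \<and> d j \<le> b"
      and disj: "\<And>i j. i \<in> J \<Longrightarrow> j \<in> J \<Longrightarrow> i \<noteq> j \<Longrightarrow> {c i<..<d i} \<inter> {c j<..<d j} = {}"
      using J(1) by (auto simp: interval_family_def pairwise_def)
    have "0 + (\<Sum>j\<in>J. variation f (c j) (d j)) \<le> ennreal \<epsilon>"
      unfolding variation_def
    proof (rule sum_SUP_le_ennreal[OF fin])
      show "{p. mono (fst p) \<and> c j \<le> fst p 0 \<and> fst p (snd p) \<le> d j} \<noteq> {}" if "j \<in> J" for j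
        using le[OF that] by (auto intro!: exI[of _ "\<lambda>_. c j"] simp: mono_def)
      fix p :: "nat \<Rightarrow> (nat \<Rightarrow> real) \<times> nat"
      define t where "t j = fst (p j)" for j
      define n where "n j = snd (p j)" for j
      assume "\<And>j. j \<in> J \<Longrightarrow> p j \<in> {p. mono (fst p) \<and> c j \<le> fst p 0 \<and> fst p (snd p) \<le> d j}"
      then have tm: "\<And>i k. i \<le> k \<Longrightarrow> t j i \<le> t j k" and t: "c j \<le> t j 0" "t j (n j) \<le> d j" if "j \<in> J" for j
        using that by (auto simp: t_def n_def mono_def)
      have t1: "c j \<le> t j i" if "j \<in> J" for i j using tm[of j 0 i] t[of j] that by simp
      have t2: "t j (Suc i) \<le> d j" if "j \<in> J" "i < n j" for i j using tm[of j "Suc i" "n j"] t[of j] that by simp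
      define K where "K = Sigma J (\<lambda>j. {..<n j})"
      have fam: "interval_family a b K (\<lambda>(j, i). t j i) (\<lambda>(j, i). t j (Suc i))"
        unfolding interval_family_def pairwise_def
      proof (intro conjI ballI impI)
        show "finite K" using fin by (simp add: K_def)
        fix k assume k: "k \<in> K"
        obtain j i where ki: "k = (j, i)" "j \<in> J" "i < n j" using k by (auto simp: K_def)
        show "a \<le> (case k of (j, i) \<Rightarrow> t j i)" "(case k of (j, i) \<Rightarrow> t j i) \<le> (case k of (j, i) \<Rightarrow> t j (Suc i))"
           "(case k of (j, i) \<Rightarrow> t j (Suc i)) \<le> b"
          using t1[of j i] t2[of j i] le[of j] tm[of j i "Suc i"] ki by auto
        fix k' assume k': "k' \<in> K" "k \<noteq> k'"
        obtain j' i' where ki': "k' = (j', i')" "j' \<in> J" "i' < n j'" using k' by (auto simp: K_def)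
        have "{t j i<..<t j (Suc i)} \<inter> {t j' i'<..<t j' (Suc i')} = {}"
        proof (cases "j = j'")
          case True
          then have "Suc i \<le> i' \<or> Suc i' \<le> i" using ki ki' k' by auto
          then have "t j (Suc i) \<le> t j i' \<or> t j (Suc i') \<le> t j i" using tm[OF ki(2)] by blast
          then show ?thesis using True by auto
        next
          case False
          have "{t j i<..<t j (Suc i)} \<subseteq> {c j<..<d j}" "{t j' i'<..<t j' (Suc i')} \<subseteq> {c j'<..<d j'}"
            using t1[of j i] t2[of j i] t1[of j' i'] t2[of j' i'] ki ki' by auto
          then show ?thesis using disj[of j j'] False ki ki' by blast
        qed
        then show "{case k of (j, i) \<Rightarrow> t j i<..<case k of (j, i) \<Rightarrow> t j (Suc i)} \<inter>
           {case k' of (j, i) \<Rightarrow> t j i<..<case k' of (j, i) \<Rightarrow> t j (Suc i)} = {}"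
          by (simp add: ki ki')
      qed
      have "(\<Sum>(j, i)\<in>K. t j (Suc i) - t j i) = (\<Sum>j\<in>J. \<Sum>i<n j. t j (Suc i) - t j i)"
        using fin by (simp add: K_def sum.Sigma)
      also have "\<dots> \<le> (\<Sum>j\<in>J. d j - c j)"
        using t by (intro sum_mono) (auto simp: sum_lessThan_telescope intro: diff_mono)
      also have "\<dots> < \<delta>" by (rule J(2))
      finally have "(\<Sum>k\<in>K. (case k of (j, i) \<Rightarrow> t j (Suc i)) - (case k of (j, i) \<Rightarrow> t j i)) < \<delta>"
        by (simp add: case_prod_unfold)
      from \<delta>(2)[OF fam this] have "(\<Sum>(j, i)\<in>K. norm (f (t j (Suc i)) - f (t j i))) < \<epsilon>"
        by (simp add: case_prod_unfold)
      moreover have "(\<Sum>(j, i)\<in>K. norm (f (t j (Suc i)) - f (t j i))) = (\<Sum>j\<in>J. \<Sum>i<n j. norm (f (t j (Suc i)) - f (t j i)))"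
        using fin by (simp add: K_def sum.Sigma)
      ultimately have "ennreal (\<Sum>j\<in>J. \<Sum>i<n j. norm (f (t j (Suc i)) - f (t j i))) \<le> ennreal \<epsilon>"
        by (intro ennreal_leI) simp
      then show "0 + (\<Sum>j\<in>J. \<Sum>i<snd (p j). ennreal (norm (f (fst (p j) (Suc i)) - f (fst (p j) i)))) \<le> ennreal \<epsilon>"
        by (simp add: t_def n_def sum_nonneg)
    qed
    then show ?thesis by simp
  qed
  with \<delta>(1) show thesis by (rule that)
qed

text \<open>An interval shorter than the \<delta> belonging to \<epsilon> = 1 has variation at most
  1, and finitely many such intervals fill \<open>{c..d}\<close>.\<close>

lemma variation_finite:
  fixes f :: "real \<Rightarrow> 'a::euclidean_space"
  assumes f: "abs_continuous_on a b f" and cd: "a \<le> c" "c \<le> d" "d \<le> b"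
  shows "variation f c d < \<infinity>"
proof -
  obtain \<delta> where \<delta>: "\<delta> > 0" "\<And>(J :: nat set) c d. interval_family a b J c d \<Longrightarrow> (\<Sum>j\<in>J. d j - c j) < \<delta> \<Longrightarrow>
        (\<Sum>j\<in>J. variation f (c j) (d j)) \<le> ennreal 1"
    using variation_small[OF f, of 1] by auto
  have short: "variation f x y < \<infinity>" if "a \<le> x" "x \<le> y" "y \<le> b" "y - x < \<delta>" for x y
  proof -
    have "variation f x y \<le> ennreal 1"
      using \<delta>(2)[of "{0}" "\<lambda>_. x" "\<lambda>_. y"] that by (simp add: interval_family_def pairwise_def)
    then show ?thesis by (simp add: le_less_trans)
  qed
  obtain n :: nat where n: "n > 0" "(d - c) / \<delta> < n"
    using reals_Archimedean2[of "max 0 ((d - c) / \<delta>)"] by (metis max_less_iff_conj of_nat_0_less_iff)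
  define h where "h = (d - c) / n"
  have h: "h \<ge> 0" "h < \<delta>" "n * h = d - c" using n cd \<delta>(1) by (auto simp: h_def field_simps)
  have "k \<le> n \<Longrightarrow> variation f c (c + k * h) < \<infinity>" for k :: nat
  proof (induction k)
    case 0
    show ?case using short[of c c] \<delta>(1) cd by simp
  next
    case (Suc k)
    have "real (Suc k) * h \<le> n * h" using Suc.prems h by (intro mult_right_mono) auto
    then have 1: "c + Suc k * h \<le> b" using h cd by linarith
    have 2: "c + k * h \<le> c + Suc k * h" "c \<le> c + k * h" "c + Suc k * h - (c + k * h) < \<delta>"
      using h by (auto simp: algebra_simps)
    have "variation f c (c + Suc k * h) = variation f c (c + k * h) + variation f (c + k * h) (c + Suc k * h)"
      using 2 by (intro variation_add)
    then show ?case using Suc short[of "c + k * h" "c + Suc k * h"] 1 2 cd by simp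
  qed
  from this[of n] show ?thesis using h by simp
qed

text \<open>Jordan decomposition: with \<open>v\<close> the variation from \<open>a\<close>, both
  \<open>v\<close> and \<open>v + f\<close> are nondecreasing and inherit absolute continuity from
  \<open>v\<close>. The density of \<open>f\<close> is the difference of their densities.\<close>

lemma abs_continuous_on_density_real:
  fixes f :: "real \<Rightarrow> real"
  assumes f: "abs_continuous_on a b f" and ab: "a < b"
  shows "\<exists>\<rho>. integrable lborel \<rho> \<and> (\<forall>c d. a \<le> c \<and> c \<le> d \<and> d \<le> b \<longrightarrow> (\<rho> has_integral (f d - f c)) {c..d})"
proof -
  define v where "v t = enn2real (variation f a t)" for t
  have var: "variation f c d = ennreal (v d - v c)" and v_mono: "v c \<le> v d"
    if "a \<le> c" "c \<le> d" "d \<le> b" for c d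
  proof -
    have fin: "variation f a c < \<infinity>" "variation f a d < \<infinity>" "variation f c d < \<infinity>"
      using variation_finite[OF f] that by auto
    have "variation f a d = variation f a c + variation f c d"
      using that by (intro variation_add) auto
    then have "v d = v c + enn2real (variation f c d)"
      unfolding v_def using fin by (simp add: enn2real_plus)
    then show "variation f c d = ennreal (v d - v c)" "v c \<le> v d" using fin by simp_all
  qed
  have fv: "\<bar>f d - f c\<bar> \<le> v d - v c" if "a \<le> c" "c \<le> d" "d \<le> b" for c d
    using norm_le_variation[OF that(2), of f] var[OF that] v_mono[OF that] by simp
  define cl where "cl x = max a (min x b)" for x
  have cl: "a \<le> cl x" "cl x \<le> b" "x \<le> y \<Longrightarrow> cl x \<le> cl y" "\<bar>cl x - cl y\<bar> \<le> \<bar>x - y\<bar>" for x y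
    using ab by (auto simp: cl_def)
  \<comment> \<open>The factor 2 covers \<open>v + f\<close>, whose increments are at most twice
    those of \<open>v\<close>. Clamping the argument with \<open>cl\<close> extends \<open>F\<close>
    to the line by constants, as \<open>mono_abs_continuous_density\<close> requires.\<close>
  have *: "\<exists>\<rho>. integrable lborel \<rho> \<and> (\<forall>c d. a \<le> c \<and> c \<le> d \<and> d \<le> b \<longrightarrow> (\<rho> has_integral (F d - F c)) {c..d})"
    if F: "\<And>c d. a \<le> c \<Longrightarrow> c \<le> d \<Longrightarrow> d \<le> b \<Longrightarrow> F c \<le> F d \<and> F d - F c \<le> 2 * (v d - v c)" for F
  proof -
    have ac: "\<exists>\<delta>>0. \<forall>(J::nat set) c d. interval_family a b J c d \<longrightarrow> (\<Sum>j\<in>J. d j - c j) < \<delta> \<longrightarrow>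
        (\<Sum>j\<in>J. F (d j) - F (c j)) < \<epsilon>" if "\<epsilon> > 0" for \<epsilon>
    proof -
      have "\<epsilon> / 3 > 0" using that by simp
      then obtain \<delta> where \<delta>: "\<delta> > 0" "\<And>(J :: nat set) c d. interval_family a b J c d \<Longrightarrow> (\<Sum>j\<in>J. d j - c j) < \<delta> \<Longrightarrow>
        (\<Sum>j\<in>J. variation f (c j) (d j)) \<le> ennreal (\<epsilon> / 3)"
        using variation_small[OF f] by blast
      have "(\<Sum>j\<in>J. F (d j) - F (c j)) < \<epsilon>"
        if J: "interval_family a b J c d" "(\<Sum>j\<in>J. d j - c j) < \<delta>" for J :: "nat set" and c d
      proof -
        have le: "\<And>j. j \<in> J \<Longrightarrow> a \<le> c j \<and> c j \<le> d j \<and> d j \<le> b"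
          using J(1) by (auto simp: interval_family_def pairwise_def)
        have "(\<Sum>j\<in>J. ennreal (v (d j) - v (c j))) = (\<Sum>j\<in>J. variation f (c j) (d j))"
          using le var by (intro sum.cong) auto
        also have "\<dots> \<le> ennreal (\<epsilon> / 3)" by (rule \<delta>(2)[OF J])
        finally have "ennreal (\<Sum>j\<in>J. v (d j) - v (c j)) \<le> ennreal (\<epsilon> / 3)"
          using le v_mono by simp
        then have "(\<Sum>j\<in>J. v (d j) - v (c j)) \<le> \<epsilon> / 3" using \<open>\<epsilon> > 0\<close> by (simp add: ennreal_le_iff)
        moreover have "(\<Sum>j\<in>J. F (d j) - F (c j)) \<le> (\<Sum>j\<in>J. 2 * (v (d j) - v (c j)))"
          using le F by (intro sum_mono) auto
        ultimately show ?thesis using \<open>\<epsilon> > 0\<close> unfolding sum_distrib_left[symmetric] by linarith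
      qed
      with \<delta>(1) show ?thesis by blast
    qed
    have "isCont (\<lambda>x. F (cl x)) x" for x
      unfolding continuous_at_eps_delta
    proof (intro allI impI)
      fix \<epsilon> :: real assume "\<epsilon> > 0"
      obtain \<delta> where \<delta>: "\<delta> > 0" "\<And>(J :: nat set) c d. interval_family a b J c d \<Longrightarrow> (\<Sum>j\<in>J. d j - c j) < \<delta> \<Longrightarrow>
        (\<Sum>j\<in>J. F (d j) - F (c j)) < \<epsilon>"
        using ac[OF \<open>\<epsilon> > 0\<close>] by blast
      have "F d - F c < \<epsilon>" if "a \<le> c" "c \<le> d" "d \<le> b" "d - c < \<delta>" for c d
        using \<delta>(2)[of "{0}" "\<lambda>_. c" "\<lambda>_. d"] that by (simp add: interval_family_def pairwise_def)
      then have "\<bar>F (cl y) - F (cl x)\<bar> < \<epsilon>" if "\<bar>y - x\<bar> < \<delta>" for y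
        using F[of "cl x" "cl y"] F[of "cl y" "cl x"] cl(1,2)[of x] cl(1,2)[of y] cl(4)[of x y] that
        by (smt (verit))
      then show "\<exists>d>0. \<forall>x'. dist x' x < d \<longrightarrow> dist (F (cl x')) (F (cl x)) < \<epsilon>"
        using \<delta>(1) by (auto simp: dist_real_def)
    qed
    then have cont: "continuous_on UNIV (\<lambda>x. F (cl x))" by (simp add: continuous_on_eq_continuous_at)
    have clid: "cl x = x" if "a \<le> x" "x \<le> b" for x using that by (simp add: cl_def)
    have ac': "\<exists>\<delta>>0. \<forall>(J::nat set) c d. interval_family a b J c d \<longrightarrow> (\<Sum>j\<in>J. d j - c j) < \<delta> \<longrightarrow>
        (\<Sum>j\<in>J. F (cl (d j)) - F (cl (c j))) < \<epsilon>" if "\<epsilon> > 0" for \<epsilon>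
    proof -
      have "(\<Sum>j\<in>J. F (cl (d j)) - F (cl (c j))) = (\<Sum>j\<in>J. F (d j) - F (c j))"
        if "interval_family a b J c d" for J :: "nat set" and c d
        using that by (intro sum.cong) (auto simp: interval_family_def clid)
      then show ?thesis using ac[OF that] by (simp cong: imp_cong)
    qed
    have "\<exists>\<rho>. integrable lborel \<rho> \<and> (\<forall>c d. c \<le> d \<longrightarrow> (\<rho> has_integral (F (cl d) - F (cl c))) {c..d})"
      using ab F cl(1-3)
      by (intro mono_abs_continuous_density[OF _ cont _ _ ab ac']) (auto intro!: monoI simp: cl_def)
    then show ?thesis by (metis clid order_trans)
  qed
  obtain \<rho>1 where \<rho>1: "integrable lborel \<rho>1" "\<And>c d. a \<le> c \<Longrightarrow> c \<le> d \<Longrightarrow> d \<le> b \<Longrightarrow> (\<rho>1 has_integral (v d - v c)) {c..d}"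
    using *[of v] v_mono by fastforce
  obtain \<rho>2 where \<rho>2: "integrable lborel \<rho>2" "\<And>c d. a \<le> c \<Longrightarrow> c \<le> d \<Longrightarrow> d \<le> b \<Longrightarrow>
     (\<rho>2 has_integral ((v d + f d) - (v c + f c))) {c..d}"
    using *[of "\<lambda>x. v x + f x"] fv by (smt (verit))
  have "((\<lambda>x. \<rho>2 x - \<rho>1 x) has_integral (f d - f c)) {c..d}" if "a \<le> c" "c \<le> d" "d \<le> b" for c d
    using has_integral_diff[OF \<rho>2(2) \<rho>1(2), OF that that] by (simp add: algebra_simps)
  moreover have "integrable lborel (\<lambda>x. \<rho>2 x - \<rho>1 x)" using \<rho>1 \<rho>2 by simp
  ultimately show ?thesis by blast
qed

section \<open>Almost everywhere derivatives of absolutely continuous functions\<close>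

lemma straddle_quotient:
  fixes g :: "real \<Rightarrow> real"
  assumes g: "(g has_real_derivative D) (at t)" and "\<epsilon> > 0"
  obtains \<delta> where "\<delta> > 0" "\<And>u v. u \<le> t \<Longrightarrow> t \<le> v \<Longrightarrow> v - u < \<delta> \<Longrightarrow> \<bar>g v - g u - D * (v - u)\<bar> \<le> \<epsilon> * (v - u)"
proof -
  obtain \<delta> where \<delta>: "\<delta> > 0" "\<And>y. \<bar>y - t\<bar> < \<delta> \<Longrightarrow> \<bar>g y - g t - D * (y - t)\<bar> \<le> \<epsilon> * \<bar>y - t\<bar>"
    using g \<open>\<epsilon> > 0\<close> unfolding has_field_derivative_def has_derivative_within_alt
    by (auto simp: dist_real_def)
  \<comment> \<open>Since \<open>u\<close> and \<open>v\<close> lie on opposite sides of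
    \<open>t\<close>, their distances to \<open>t\<close> add up to \<open>v - u\<close>, so the two
    one-sided errors combine without loss.\<close>
  have "\<bar>g v - g u - D * (v - u)\<bar> \<le> \<epsilon> * (v - u)" if "u \<le> t" "t \<le> v" "v - u < \<delta>" for u v
    using \<delta>(2)[of u] \<delta>(2)[of v] that by (simp add: abs_le_iff algebra_simps)
  with \<delta>(1) show thesis by (rule that)
qed

text \<open>\<open>integrable_ccontinuous_explicit\<close> controls averages over intervals that
  start at the point, that is, derivatives from the right. Applied to the reflected function it
  controls those from the left. The null set depends on \<rho> alone.\<close>

lemma indefinite_integral_derivative_AE:
  fixes \<rho> :: "real \<Rightarrow> real"
  assumes \<rho>: "integrable lborel \<rho>"
  obtains N where "negligible N"
    "\<And>f a b t. (\<And>c d. a \<le> c \<Longrightarrow> c \<le> d \<Longrightarrow> d \<le> b \<Longrightarrow> (\<rho> has_integral (f d - f c)) {c..d}) \<Longrightarrow>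
        t \<in> {a<..<b} - N \<Longrightarrow> (f has_real_derivative \<rho> t) (at t)"
proof -
  have int: "\<rho> integrable_on cbox u v" for u v
    using integrable_on_lborel[OF \<rho>] integrable_on_subcbox by blast
  have int': "(\<lambda>x. \<rho> (- x)) integrable_on cbox u v" for u v
    using int[of "-v" "-u"] Henstock_Kurzweil_Integration.integrable_reflect_real[where f = \<rho> and a = "-v" and b = "-u"] by simp
  obtain N1 where N1: "negligible N1" "\<And>x e. x \<notin> N1 \<Longrightarrow> 0 < e \<Longrightarrow>
     \<exists>d>0. \<forall>h. 0 < h \<and> h < d \<longrightarrow> norm (integral (cbox x (x + h *\<^sub>R One)) \<rho> /\<^sub>R h ^ DIM(real) - \<rho> x) < e"
    using integrable_ccontinuous_explicit[OF int] by blast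
  obtain N2 where N2: "negligible N2" "\<And>x e. x \<notin> N2 \<Longrightarrow> 0 < e \<Longrightarrow>
     \<exists>d>0. \<forall>h. 0 < h \<and> h < d \<longrightarrow> norm (integral (cbox x (x + h *\<^sub>R One)) (\<lambda>x. \<rho> (- x)) /\<^sub>R h ^ DIM(real) - \<rho> (- x)) < e"
    using integrable_ccontinuous_explicit[OF int'] by blast
  have "negligible (uminus ` N2)"
    using N2(1) by (intro negligible_differentiable_image_negligible) (auto intro: differentiable_on_minus differentiable_on_ident)
  then have N: "negligible (N1 \<union> uminus ` N2)" using N1(1) by (rule negligible_Un[rotated])
  have "(f has_real_derivative \<rho> t) (at t)"
    if f: "\<And>c d. a \<le> c \<Longrightarrow> c \<le> d \<Longrightarrow> d \<le> b \<Longrightarrow> (\<rho> has_integral (f d - f c)) {c..d}"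
      and t: "t \<in> {a<..<b} - (N1 \<union> uminus ` N2)" for f a b t
  proof -
    have t1: "t \<notin> N1" "- t \<notin> N2" using t by force+
    have "\<exists>\<delta>>0. \<forall>y. \<bar>y - t\<bar> < \<delta> \<longrightarrow> \<bar>f y - f t - \<rho> t * (y - t)\<bar> \<le> e * \<bar>y - t\<bar>" if e: "e > 0" for e
    proof -
      obtain d1 where d1: "d1 > 0" "\<And>h. 0 < h \<Longrightarrow> h < d1 \<Longrightarrow> \<bar>integral {t..t + h} \<rho> / h - \<rho> t\<bar> < e"
        using N1(2)[OF t1(1) e] by (auto simp: divide_inverse mult.commute)
      obtain d2 where d2: "d2 > 0" "\<And>h. 0 < h \<Longrightarrow> h < d2 \<Longrightarrow> \<bar>integral {-t..-t + h} (\<lambda>x. \<rho> (- x)) / h - \<rho> t\<bar> < e"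
        using N2(2)[OF t1(2) e] by (auto simp: divide_inverse mult.commute)
      define \<delta> where "\<delta> = min (min d1 d2) (min (t - a) (b - t))"
      have "\<bar>f y - f t - \<rho> t * (y - t)\<bar> \<le> e * \<bar>y - t\<bar>" if y: "\<bar>y - t\<bar> < \<delta>" for y
      proof (cases y t rule: linorder_cases)
        case equal then show ?thesis by simp
      next
        case greater
        have i: "integral {t..y} \<rho> = f y - f t"
          using f[of t y] y greater t by (auto simp: \<delta>_def intro!: integral_unique)
        show ?thesis using d1(2)[of "y - t"] y greater i by (simp add: \<delta>_def abs_less_iff abs_le_iff field_simps)
      next
        case less
        have "integral {- t..- y} (\<lambda>x. \<rho> (- x)) = integral {y..t} \<rho>"
          by (rule Henstock_Kurzweil_Integration.integral_reflect_real)
        also have i: "integral {y..t} \<rho> = f t - f y"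
          using f[of y t] y less t by (auto simp: \<delta>_def intro!: integral_unique)
        finally show ?thesis using d2(2)[of "t - y"] y less by (simp add: \<delta>_def abs_less_iff abs_le_iff field_simps)
      qed
      moreover have "\<delta> > 0" using d1(1) d2(1) t by (simp add: \<delta>_def)
      ultimately show ?thesis by blast
    qed
    then show ?thesis
      unfolding has_field_derivative_def has_derivative_within_alt
      by (auto simp: dist_real_def bounded_linear_mult_right)
  qed
  with N show thesis by (rule that)
qed

theorem abs_continuous_on_derivative_real:
  fixes f :: "real \<Rightarrow> real"
  assumes f: "abs_continuous_on a b f" and ab: "a < b"
  obtains \<rho> N where "integrable lborel \<rho>" "negligible N"
    "\<And>c d. a \<le> c \<Longrightarrow> c \<le> d \<Longrightarrow> d \<le> b \<Longrightarrow> (\<rho> has_integral (f d - f c)) {c..d}"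
    "\<And>t. t \<in> {a<..<b} - N \<Longrightarrow> (f has_real_derivative \<rho> t) (at t)"
proof -
  obtain \<rho> where \<rho>: "integrable lborel \<rho>" "\<And>c d. a \<le> c \<Longrightarrow> c \<le> d \<Longrightarrow> d \<le> b \<Longrightarrow> (\<rho> has_integral (f d - f c)) {c..d}"
    using abs_continuous_on_density_real[OF f ab] by blast
  obtain N where "negligible N" "\<And>f a b t. (\<And>c d. a \<le> c \<Longrightarrow> c \<le> d \<Longrightarrow> d \<le> b \<Longrightarrow> (\<rho> has_integral (f d - f c)) {c..d}) \<Longrightarrow>
        t \<in> {a<..<b} - N \<Longrightarrow> (f has_real_derivative \<rho> t) (at t)"
    using indefinite_integral_derivative_AE[OF \<rho>(1)] by blast
  then show thesis using \<rho> that by blast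
qed

theorem abs_continuous_on_derivative:
  fixes f :: "real \<Rightarrow> 'a::euclidean_space"
  assumes f: "abs_continuous_on a b f" and ab: "a < b"
  obtains \<rho> N where "integrable lborel \<rho>" "negligible N"
    "\<And>c d. a \<le> c \<Longrightarrow> c \<le> d \<Longrightarrow> d \<le> b \<Longrightarrow> (\<rho> has_integral (f d - f c)) {c..d}"
    "\<And>t. t \<in> {a<..<b} - N \<Longrightarrow> (f has_vector_derivative \<rho> t) (at t)"
proof -
  define Q where "Q i \<rho> N \<longleftrightarrow> integrable lborel \<rho> \<and> negligible N \<and>
    (\<forall>c d. a \<le> c \<longrightarrow> c \<le> d \<longrightarrow> d \<le> b \<longrightarrow> (\<rho> has_integral (f d \<bullet> i - f c \<bullet> i)) {c..d}) \<and>
    (\<forall>t. t \<in> {a<..<b} - N \<longrightarrow> ((\<lambda>t. f t \<bullet> i) has_real_derivative \<rho> t) (at t))" for i \<rho> N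
  have "\<exists>\<rho> N. Q i \<rho> N" if "i \<in> Basis" for i
  proof -
    have "norm (f v \<bullet> i - f u \<bullet> i) \<le> norm (f v - f u)" for u v
      using Basis_le_norm[OF that, of "f v - f u"] by (simp add: inner_diff_left)
    then have "abs_continuous_on a b (\<lambda>t. f t \<bullet> i)" by (intro abs_continuous_on_le[OF f])
    then show ?thesis
    proof (rule abs_continuous_on_derivative_real[OF _ ab])
      fix \<rho> N assume "integrable lborel \<rho>" "negligible N"
      "\<And>c d. a \<le> c \<Longrightarrow> c \<le> d \<Longrightarrow> d \<le> b \<Longrightarrow> (\<rho> has_integral (f d \<bullet> i - f c \<bullet> i)) {c..d}"
      "\<And>t. t \<in> {a<..<b} - N \<Longrightarrow> ((\<lambda>t. f t \<bullet> i) has_real_derivative \<rho> t) (at t)"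
      then have "Q i \<rho> N" unfolding Q_def by simp
      then show ?thesis by (intro exI)
    qed
  qed
  then have "\<forall>i\<in>Basis. \<exists>\<rho> N. Q i \<rho> N" by blast
  then obtain r N where "\<forall>i\<in>Basis. Q i (r i) (N i)" unfolding bchoice_iff by blast
  then have r: "\<And>i. i \<in> Basis \<Longrightarrow> integrable lborel (r i)" "\<And>i. i \<in> Basis \<Longrightarrow> negligible (N i)"
    "\<And>i c d. i \<in> Basis \<Longrightarrow> a \<le> c \<Longrightarrow> c \<le> d \<Longrightarrow> d \<le> b \<Longrightarrow> (r i has_integral (f d \<bullet> i - f c \<bullet> i)) {c..d}"
    "\<And>i t. i \<in> Basis \<Longrightarrow> t \<in> {a<..<b} - N i \<Longrightarrow> ((\<lambda>t. f t \<bullet> i) has_real_derivative r i t) (at t)"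
    unfolding Q_def by blast+
  define \<rho> where "\<rho> t = (\<Sum>i\<in>Basis. r i t *\<^sub>R i)" for t
  show thesis
  proof (rule that)
    show "integrable lborel \<rho>" unfolding \<rho>_def using r(1) by (intro Bochner_Integration.integrable_sum) auto
    show "negligible (\<Union>i\<in>(Basis::'a set). N i)" using r(2) by (intro negligible_Union) auto
    show "(\<rho> has_integral (f d - f c)) {c..d}" if "a \<le> c" "c \<le> d" "d \<le> b" for c d
      unfolding has_integral_componentwise_iff[of \<rho>]
      using r(3)[OF _ that] by (simp add: \<rho>_def inner_diff_left)
    show "(f has_vector_derivative \<rho> t) (at t)" if "t \<in> {a<..<b} - (\<Union>i\<in>(Basis::'a set). N i)" for t
    proof -
      have "((\<lambda>t. \<Sum>i\<in>Basis. (f t \<bullet> i) *\<^sub>R i) has_vector_derivative (\<Sum>i\<in>Basis. r i t *\<^sub>R i)) (at t)"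
      proof (rule has_vector_derivative_sum)
        fix i :: 'a assume i: "i \<in> Basis"
        then have "((\<lambda>t. f t \<bullet> i) has_real_derivative r i t) (at t)" using r(4)[OF i, of t] that by blast
        then show "((\<lambda>t. (f t \<bullet> i) *\<^sub>R i) has_vector_derivative r i t *\<^sub>R i) (at t)"
          unfolding has_real_derivative_iff_has_vector_derivative
          using bounded_linear.has_vector_derivative[OF bounded_linear_scaleR_left] by blast
      qed
      then show ?thesis by (simp add: euclidean_representation \<rho>_def)
    qed
  qed
qed

section \<open>The extended-real integral\<close>

text \<open>Here \<open>f\<close> need not be measurable: on arbitrary functions \<open>integral\<^sup>N\<close> is the lower integral. This
  spares a proof that the integrand of the action is measurable.\<close>

lemma nn_integral_disjoint_Un:
  fixes f :: "'a \<Rightarrow> ennreal"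
  assumes [measurable]: "A \<in> sets M" "B \<in> sets M" and disj: "A \<inter> B = {}"
  shows "(\<integral>\<^sup>+x. f x * indicator (A \<union> B) x \<partial>M) = (\<integral>\<^sup>+x. f x * indicator A x \<partial>M) + (\<integral>\<^sup>+x. f x * indicator B x \<partial>M)"
proof (rule antisym)
  let ?S = "\<lambda>f. {g. simple_function M g \<and> g \<le> f}"
  show "(\<integral>\<^sup>+x. f x * indicator (A \<union> B) x \<partial>M) \<le> (\<integral>\<^sup>+x. f x * indicator A x \<partial>M) + (\<integral>\<^sup>+x. f x * indicator B x \<partial>M)"
    unfolding nn_integral_def[of M "\<lambda>x. f x * indicator (A \<union> B) x"]
  proof (rule SUP_least)
    fix g assume g: "g \<in> ?S (\<lambda>x. f x * indicator (A \<union> B) x)"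
    then have sg: "simple_function M g" and le: "\<And>x. g x \<le> f x * indicator (A \<union> B) x" by (auto simp: le_fun_def)
    have [measurable]: "g \<in> borel_measurable M" using sg by (rule borel_measurable_simple_function)
    have "g x = g x * indicator A x + g x * indicator B x" for x
      using le[of x] disj by (auto split: split_indicator)
    then have "integral\<^sup>S M g = (\<integral>\<^sup>+x. g x * indicator A x + g x * indicator B x \<partial>M)"
      using sg by (simp add: nn_integral_eq_simple_integral)
    also have "\<dots> = (\<integral>\<^sup>+x. g x * indicator A x \<partial>M) + (\<integral>\<^sup>+x. g x * indicator B x \<partial>M)"
      by (rule nn_integral_add) measurable
    also have "\<dots> \<le> (\<integral>\<^sup>+x. f x * indicator A x \<partial>M) + (\<integral>\<^sup>+x. f x * indicator B x \<partial>M)"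
    proof (intro add_mono nn_integral_mono)
      show "g x * indicator A x \<le> f x * indicator A x" "g x * indicator B x \<le> f x * indicator B x" for x
        using le[of x] by (auto split: split_indicator)
    qed
    finally show "integral\<^sup>S M g \<le> \<dots>" .
  qed
  have "integral\<^sup>S M g + integral\<^sup>S M h \<le> (\<integral>\<^sup>+x. f x * indicator (A \<union> B) x \<partial>M)"
    if g: "g \<in> ?S (\<lambda>x. f x * indicator A x)" and h: "h \<in> ?S (\<lambda>x. f x * indicator B x)" for g h
  proof -
    have sg: "simple_function M g" and gle: "\<And>x. g x \<le> f x * indicator A x" using g by (auto simp: le_fun_def)
    have sh: "simple_function M h" and hle: "\<And>x. h x \<le> f x * indicator B x" using h by (auto simp: le_fun_def)
    have "integral\<^sup>S M g + integral\<^sup>S M h = (\<integral>\<^sup>+x. g x + h x \<partial>M)"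
      using sg sh by (simp add: nn_integral_eq_simple_integral[symmetric] nn_integral_add borel_measurable_simple_function)
    also have "\<dots> \<le> (\<integral>\<^sup>+x. f x * indicator (A \<union> B) x \<partial>M)"
    proof (rule nn_integral_mono)
      show "g x + h x \<le> f x * indicator (A \<union> B) x" for x
        using gle[of x] hle[of x] disj by (cases "x \<in> A"; cases "x \<in> B") auto
    qed
    finally show ?thesis .
  qed
  then have "integral\<^sup>N M (\<lambda>x. f x * indicator A x) + integral\<^sup>S M h \<le> (\<integral>\<^sup>+x. f x * indicator (A \<union> B) x \<partial>M)"
    if h: "h \<in> ?S (\<lambda>x. f x * indicator B x)" for h
    unfolding nn_integral_def[of M "\<lambda>x. f x * indicator A x"] using h
    by (subst ennreal_SUP_add_left[symmetric]) (auto intro!: SUP_least exI[of _ "\<lambda>_. 0"] simp: le_fun_def)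
  then show "(\<integral>\<^sup>+x. f x * indicator A x \<partial>M) + (\<integral>\<^sup>+x. f x * indicator B x \<partial>M) \<le> (\<integral>\<^sup>+x. f x * indicator (A \<union> B) x \<partial>M)"
    unfolding nn_integral_def[of M "\<lambda>x. f x * indicator B x"]
    by (subst ennreal_SUP_add_right) (auto intro!: SUP_least exI[of _ "\<lambda>_. 0"] simp: le_fun_def)
qed

lemma nn_integral_lebesgue_on_split:
  fixes f :: "real \<Rightarrow> ennreal"
  assumes "a \<le> b" "b \<le> c"
  shows "(\<integral>\<^sup>+x. f x \<partial>lebesgue_on {a..c}) = (\<integral>\<^sup>+x. f x \<partial>lebesgue_on {a..b}) + (\<integral>\<^sup>+x. f x \<partial>lebesgue_on {b..c})"
proof -
  have "AE x in lebesgue. x \<noteq> b"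
    by (rule AE_completion) (simp add: AE_lborel_singleton)
  then have "(\<integral>\<^sup>+x. f x * indicator {b..c} x \<partial>lebesgue) = (\<integral>\<^sup>+x. f x * indicator {b<..c} x \<partial>lebesgue)"
    by (intro nn_integral_cong_AE) (auto elim!: eventually_mono split: split_indicator)
  moreover have "{a..c} = {a..b} \<union> {b<..c}" "{a..b} \<inter> {b<..c} = {}" using assms by auto
  ultimately show ?thesis
    using nn_integral_disjoint_Un[of "{a..b}" lebesgue "{b<..c}" f]
    by (simp add: nn_integral_restrict_space)
qed

lemma emeasure_lebesgue_on_Icc:
  fixes a b :: real
  shows "emeasure (lebesgue_on {a..b}) {a..b} = ennreal (b - a)"
  by (subst emeasure_restrict_space) (auto simp: emeasure_lborel_Icc_eq ennreal_neg)

text \<open>Monotonicity needs no measurability of \<open>f\<close> or \<open>g\<close>, so the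
  integrand of an action may be compared with known functions almost everywhere.\<close>

lemma ereal_integral_mono_AE:
  assumes "AE t in lebesgue_on {a..b}. f t \<le> g t"
  shows "ereal_integral a b f \<le> ereal_integral a b g"
proof -
  have "(\<integral>\<^sup>+ t. e2ennreal (f t) \<partial>lebesgue_on {a..b}) \<le> (\<integral>\<^sup>+ t. e2ennreal (g t) \<partial>lebesgue_on {a..b})"
    using assms by (intro nn_integral_mono_AE) (auto elim!: eventually_mono intro: e2ennreal_mono)
  moreover have "(\<integral>\<^sup>+ t. e2ennreal (- g t) \<partial>lebesgue_on {a..b}) \<le> (\<integral>\<^sup>+ t. e2ennreal (- f t) \<partial>lebesgue_on {a..b})"
    using assms by (intro nn_integral_mono_AE) (auto elim!: eventually_mono intro: e2ennreal_mono)
  ultimately show ?thesis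
    unfolding ereal_integral_def by (intro ereal_minus_mono) (auto simp: less_eq_ennreal.rep_eq)
qed

lemma ereal_integral_cong_AE:
  assumes "AE t in lebesgue_on {a..b}. f t = g t"
  shows "ereal_integral a b f = ereal_integral a b g"
  using assms by (intro antisym ereal_integral_mono_AE) (auto elim!: eventually_mono)

lemma ereal_integral_real:
  fixes g :: "real \<Rightarrow> real"
  assumes g: "g absolutely_integrable_on {a..b}"
  shows "ereal_integral a b (\<lambda>t. ereal (g t)) = ereal (integral {a..b} g)"
proof -
  have int: "integrable (lebesgue_on {a..b}) g"
    using g by (simp add: set_integrable_def integrable_restrict_space)
  have nn: "(\<integral>\<^sup>+ t. ennreal (h t) \<partial>lebesgue_on {a..b}) = ennreal (\<integral>t. max 0 (h t) \<partial>lebesgue_on {a..b})"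
    if "integrable (lebesgue_on {a..b}) h" for h :: "real \<Rightarrow> real"
  proof -
    have "(\<integral>\<^sup>+ t. ennreal (h t) \<partial>lebesgue_on {a..b}) = (\<integral>\<^sup>+ t. ennreal (max 0 (h t)) \<partial>lebesgue_on {a..b})"
      by (intro nn_integral_cong) (simp add: max_def ennreal_neg)
    also have "\<dots> = ennreal (\<integral>t. max 0 (h t) \<partial>lebesgue_on {a..b})"
      using that by (intro nn_integral_eq_integral) auto
    finally show ?thesis .
  qed
  have "ereal_integral a b (\<lambda>t. ereal (g t)) =
     enn2ereal (ennreal (\<integral>t. max 0 (g t) \<partial>lebesgue_on {a..b})) - enn2ereal (ennreal (\<integral>t. max 0 (- g t) \<partial>lebesgue_on {a..b}))"
    unfolding ereal_integral_def using int by (simp add: nn)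
  also have "\<dots> = ereal ((\<integral>t. max 0 (g t) \<partial>lebesgue_on {a..b}) - (\<integral>t. max 0 (- g t) \<partial>lebesgue_on {a..b}))"
    by (simp add: enn2ereal_ennreal integral_nonneg_AE)
  also have "\<dots> = ereal (\<integral>t. max 0 (g t) - max 0 (- g t) \<partial>lebesgue_on {a..b})"
    using int by (subst Bochner_Integration.integral_diff) auto
  also have "(\<integral>t. max 0 (g t) - max 0 (- g t) \<partial>lebesgue_on {a..b}) = (\<integral>t. g t \<partial>lebesgue_on {a..b})"
    by (intro Bochner_Integration.integral_cong) auto
  also have "\<dots> = integral {a..b} g"
    using int by (intro lebesgue_integral_eq_integral) auto
  finally show ?thesis .
qed

lemma ereal_integral_const: "a \<le> b \<Longrightarrow> ereal_integral a b (\<lambda>_. ereal k) = ereal (k * (b - a))"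
  by (subst ereal_integral_real) (auto simp: absolutely_integrable_on_const)

lemma nn_integral_negative_part_finite:
  fixes f :: "real \<Rightarrow> ereal"
  assumes "\<And>t. t \<in> {a..b} \<Longrightarrow> f t \<ge> ereal (- B)"
  shows "(\<integral>\<^sup>+ t. e2ennreal (- f t) \<partial>lebesgue_on {a..b}) < \<infinity>"
proof -
  have "(\<integral>\<^sup>+ t. e2ennreal (- f t) \<partial>lebesgue_on {a..b}) \<le> (\<integral>\<^sup>+ t. ennreal B \<partial>lebesgue_on {a..b})"
  proof (rule nn_integral_mono)
    fix t assume "t \<in> space (lebesgue_on {a..b})"
    then have "- f t \<le> ereal B" using assms[of t] by (simp add: space_restrict_space ereal_uminus_le_reorder)
    then show "e2ennreal (- f t) \<le> ennreal B" using e2ennreal_mono by fastforce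
  qed
  also have "\<dots> < \<infinity>"
    by (simp add: space_restrict_space ennreal_mult_less_top emeasure_lebesgue_on_Icc)
  finally show ?thesis .
qed

text \<open>The lower bound on \<open>f\<close> makes the negative parts finite, so positive and
  negative parts can be added separately without meeting \<infinity> - \<infinity>.\<close>

lemma ereal_integral_split:
  assumes "a \<le> b" "b \<le> c" and B: "\<And>t. t \<in> {a..c} \<Longrightarrow> f t \<ge> ereal (- B)"
  shows "ereal_integral a c f = ereal_integral a b f + ereal_integral b c f"
proof -
  let ?P = "\<lambda>a b. \<integral>\<^sup>+ t. e2ennreal (f t) \<partial>lebesgue_on {a..b}"
  let ?N = "\<lambda>a b. \<integral>\<^sup>+ t. e2ennreal (- f t) \<partial>lebesgue_on {a..b}"
  have fin: "?N a b < \<infinity>" "?N b c < \<infinity>"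
    using assms(1,2) by (auto intro!: nn_integral_negative_part_finite[where B = B] B simp del: infinity_ennreal_def)
  obtain n m where nm: "?N a b = ennreal n" "?N b c = ennreal m" "n \<ge> 0" "m \<ge> 0"
    using fin by (metis ennreal_cases infinity_ennreal_def less_irrefl)
  have P: "?P a c = ?P a b + ?P b c" and N: "?N a c = ?N a b + ?N b c"
    using assms by (auto intro: nn_integral_lebesgue_on_split)
  have "enn2ereal (?P a c) - enn2ereal (?N a c) = enn2ereal (?P a b) + enn2ereal (?P b c) - ereal (n + m)"
    unfolding P N nm using nm(3,4) by (simp add: plus_ennreal.rep_eq flip: ennreal_plus)
  also have "\<dots> = (enn2ereal (?P a b) - ereal n) + (enn2ereal (?P b c) - ereal m)"
    by (cases "enn2ereal (?P a b)"; cases "enn2ereal (?P b c)") auto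
  finally show ?thesis unfolding ereal_integral_def nm using nm(3,4) by simp
qed

text \<open>Meant for curves that leave the network: an interval on which the integrand is infinite
  outweighs the finite negative part.\<close>

lemma ereal_integral_infinite:
  assumes uv: "a \<le> u" "u < v" "v \<le> b" and B: "\<And>t. t \<in> {a..b} \<Longrightarrow> f t \<ge> ereal (- B)"
    and inf: "\<And>t. t \<in> {u..v} \<Longrightarrow> f t = \<infinity>"
  shows "ereal_integral a b f = \<infinity>"
proof -
  have "\<infinity> = (\<integral>\<^sup>+ t. \<infinity> \<partial>lebesgue_on {u..v})"
    using uv by (simp add: space_restrict_space emeasure_lebesgue_on_Icc ennreal_top_mult)
  also have "\<dots> = (\<integral>\<^sup>+ t. e2ennreal (f t) \<partial>lebesgue_on {u..v})"
    using inf by (intro nn_integral_cong) (simp add: space_restrict_space)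
  also have "\<dots> \<le> (\<integral>\<^sup>+ t. e2ennreal (f t) \<partial>lebesgue_on {a..b})"
    using nn_integral_lebesgue_on_split[of a u b "\<lambda>t. e2ennreal (f t)"]
      nn_integral_lebesgue_on_split[of u v b "\<lambda>t. e2ennreal (f t)"] uv by (simp add: add_increasing add_increasing2)
  finally have "(\<integral>\<^sup>+ t. e2ennreal (f t) \<partial>lebesgue_on {a..b}) = \<infinity>" by (simp add: top_unique)
  moreover have "(\<integral>\<^sup>+ t. e2ennreal (- f t) \<partial>lebesgue_on {a..b}) < \<infinity>"
    using B by (rule nn_integral_negative_part_finite)
  ultimately show ?thesis
    unfolding ereal_integral_def by (cases "\<integral>\<^sup>+ t. e2ennreal (- f t) \<partial>lebesgue_on {a..b}") auto
qed

section \<open>Geometry of networks\<close>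

lemma segment_unit_interval:
  fixes s s' u :: real
  assumes "s \<in> {0..1}" "s' \<in> {0..1}" "u \<in> {0..1}"
  shows "s' + u * (s - s') \<in> {0..1}"
proof -
  have "s' + u * (s - s') = (1 - u) * s' + u * s" by (simp add: algebra_simps)
  moreover have "0 \<le> (1 - u) * s' + u * s" using assms by simp
  moreover have "(1 - u) * s' + u * s \<le> 1" using assms by (intro convex_bound_le) auto
  ultimately show ?thesis by simp
qed

context network
begin

lemma arc_inj: "\<gamma> \<in> E \<Longrightarrow> s \<in> {0..1} \<Longrightarrow> s' \<in> {0..1} \<Longrightarrow> \<gamma> s = \<gamma> s' \<Longrightarrow> s = s'"
  using simple_arcs[of \<gamma>] no_loops[of \<gamma>] unfolding simple_path_def loop_free_def
  by (metis)

lemma inverse_arc_apply [simp]: "s \<in> {0..1} \<Longrightarrow> inverse_arc \<gamma> s = \<gamma> (1 - s)"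
  by (simp add: inverse_arc_def reversepath_def)

lemma inverse_arc_inverse [simp]: "\<gamma> \<in> E \<Longrightarrow> inverse_arc (inverse_arc \<gamma>) = \<gamma>"
  using extensional_arcs by (auto simp: inverse_arc_def reversepath_def fun_eq_iff extensional_def restrict_def)

lemma inverse_arc_neq: "\<gamma> \<in> E \<Longrightarrow> inverse_arc \<gamma> \<noteq> \<gamma>"
  using no_loops[of \<gamma>] inverse_arc_apply[of 0 \<gamma>] by force

lemma continuous_arc: "\<gamma> \<in> E \<Longrightarrow> continuous_on {0..1} \<gamma>"
  using simple_arcs by (auto simp: simple_path_def path_def)

lemma velocity_inverse_arc:
  assumes "\<gamma> \<in> E" "s \<in> {0..1}"
  shows "velocity (inverse_arc \<gamma>) s = - velocity \<gamma> (1 - s)"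
proof -
  have "((\<lambda>s. 1 - s) has_vector_derivative - 1) (at s within {0..1})"
    by (auto intro!: derivative_eq_intros)
  moreover have "(\<lambda>s::real. 1 - s) ` {0..1} = {0..1}" by force
  moreover have "(\<gamma> has_vector_derivative velocity \<gamma> (1 - s)) (at (1 - s) within {0..1})"
    using assms by (intro differentiable_arcs) auto
  ultimately have *: "(\<gamma> \<circ> (\<lambda>s. 1 - s) has_vector_derivative - 1 *\<^sub>R velocity \<gamma> (1 - s)) (at s within {0..1})"
    by (intro vector_diff_chain_within) auto
  have "(inverse_arc \<gamma> has_vector_derivative - 1 *\<^sub>R velocity \<gamma> (1 - s)) (at s within {0..1})"
    by (rule has_vector_derivative_transform[OF assms(2) _ *]) simp
  then have **: "(inverse_arc \<gamma> has_vector_derivative - velocity \<gamma> (1 - s)) (at s within {0..1})" by simp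
  show ?thesis
    unfolding velocity_def[of "inverse_arc \<gamma>"]
    by (rule vector_derivative_within_closed_interval[OF zero_less_one assms(2) **])
qed

text \<open>Every ambiguity of coordinates on the network is of one of these kinds. The disjointness
  axiom speaks of one open arc and another closed one; it is used twice, with the roles exchanged,
  to put both parameters at ends.\<close>

lemma arc_eq_cases:
  assumes "\<gamma> \<in> E" "\<gamma>' \<in> E" "s \<in> {0..1}" "s' \<in> {0..1}" "\<gamma> s = \<gamma>' s'"
  obtains "\<gamma>' = \<gamma>" "s' = s" | "\<gamma>' = inverse_arc \<gamma>" "s' = 1 - s" | "s \<in> {0, 1}" "s' \<in> {0, 1}"
proof -
  note rules = that
  have inv: thesis if "\<gamma> = inverse_arc \<gamma>'"
  proof -
    have "\<gamma> s = \<gamma> (1 - s')" using assms that inverse_arc_apply[of "1 - s'" \<gamma>'] by auto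
    then have "s = 1 - s'" using assms arc_inj[of \<gamma> s "1 - s'"] by auto
    then show thesis using assms(2) \<open>\<gamma> = inverse_arc \<gamma>'\<close> by (intro rules(2)) auto
  qed
  have same: thesis if "\<gamma> = \<gamma>'"
    using arc_inj[of \<gamma> s s'] assms \<open>\<gamma> = \<gamma>'\<close> by (intro rules(1)) auto
  show thesis
  proof (cases "\<gamma> = \<gamma>' \<or> \<gamma> = inverse_arc \<gamma>'")
    case True
    then show thesis using inv same by metis
  next
    case False
    then have "s \<notin> {0<..<1}" using disjoint_arcs[OF assms(1,2)] assms(4,5) by blast
    moreover have "\<gamma>' \<noteq> \<gamma>" "\<gamma>' \<noteq> inverse_arc \<gamma>" using False assms inverse_arc_inverse by auto
    then have "s' \<notin> {0<..<1}" using disjoint_arcs[OF assms(2,1)] assms(3,5) by force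
    ultimately show thesis using assms by (intro rules(3)) auto
  qed
qed

lemma vertex_iff: "\<gamma> \<in> E \<Longrightarrow> s \<in> {0..1} \<Longrightarrow> \<gamma> s \<in> vertices E \<longleftrightarrow> s \<in> {0, 1}"
proof
  assume s: "\<gamma> \<in> E" "s \<in> {0..1}" "\<gamma> s \<in> vertices E"
  then obtain \<gamma>' s' where *: "\<gamma>' \<in> E" "s' \<in> {0, 1}" "\<gamma> s = \<gamma>' s'" by (auto simp: vertices_def)
  then have "s' \<in> {0..1}" by auto
  show "s \<in> {0, 1}"
    by (rule arc_eq_cases[OF s(1) *(1) s(2) \<open>s' \<in> {0..1}\<close> *(3)]) (use *(2) in auto)
qed (auto simp: vertices_def)

lemma finite_vertices: "finite (vertices E)"
  using finite_arcs by (simp add: vertices_def)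

lemma vertices_subset: "vertices E \<subseteq> network_set E"
  by (force simp: vertices_def network_set_def)

lemma compact_arc: "\<gamma> \<in> E \<Longrightarrow> compact (\<gamma> ` {0..1})"
  using continuous_arc compact_continuous_image by blast

lemma compact_network: "compact (network_set E)"
  unfolding network_set_def using finite_arcs compact_arc by blast

lemma velocity_bounded: obtains \<Lambda> where "\<Lambda> > 0" "\<And>\<gamma> s. \<gamma> \<in> E \<Longrightarrow> s \<in> {0..1} \<Longrightarrow> norm (velocity \<gamma> s) \<le> \<Lambda>"
proof -
  have "bounded (\<Union>\<gamma>\<in>E. velocity \<gamma> ` {0..1})"
    using finite_arcs continuous_velocity
    by (intro bounded_UN ballI compact_imp_bounded compact_continuous_image) auto
  then obtain \<Lambda> where "\<Lambda> > 0" and \<Lambda>: "\<forall>x\<in>(\<Union>\<gamma>\<in>E. velocity \<gamma> ` {0..1}). norm x \<le> \<Lambda>"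
    using bounded_pos by metis
  have "norm (velocity \<gamma> s) \<le> \<Lambda>" if "\<gamma> \<in> E" "s \<in> {0..1}" for \<gamma> s
    using \<Lambda> that by auto
  with \<open>\<Lambda> > 0\<close> show thesis by (rule that)
qed

text \<open>Writing the increment as \<open>s - s'\<close> times an averaged velocity gives a
  difference quotient that is continuous up to the diagonal.\<close>

lemma arc_difference:
  assumes "\<gamma> \<in> E" "s \<in> {0..1}" "s' \<in> {0..1}"
  shows "\<gamma> s - \<gamma> s' = (s - s') *\<^sub>R integral (cbox 0 1) (\<lambda>u. velocity \<gamma> (s' + u * (s - s')))"
proof -
  have range: "s' + u * (s - s') \<in> {0..1}" if "u \<in> {0..1}" for u
    using segment_unit_interval that assms(2,3) by blast
  have "((\<lambda>u. \<gamma> (s' + u * (s - s'))) has_vector_derivative (s - s') *\<^sub>R velocity \<gamma> (s' + u * (s - s'))) (at u within {0..1})"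
    if u: "u \<in> {0..1}" for u
  proof -
    have "((\<lambda>u. s' + u * (s - s')) has_vector_derivative (s - s')) (at u within {0..1})"
      by (auto intro!: derivative_eq_intros)
    moreover have "(\<gamma> has_vector_derivative velocity \<gamma> (s' + u * (s - s'))) (at (s' + u * (s - s')) within (\<lambda>u. s' + u * (s - s')) ` {0..1})"
      by (rule has_vector_derivative_within_subset[OF differentiable_arcs[OF assms(1) range[OF u]]]) (use range in auto)
    ultimately show ?thesis
      using vector_diff_chain_within[of "\<lambda>u. s' + u * (s - s')" "s - s'" u "{0..1}" \<gamma>] by (simp add: o_def)
  qed
  then have "((\<lambda>u. (s - s') *\<^sub>R velocity \<gamma> (s' + u * (s - s'))) has_integral (\<gamma> (s' + 1 * (s - s')) - \<gamma> (s' + 0 * (s - s')))) {0..1}"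
    by (intro fundamental_theorem_of_calculus) auto
  then have "integral {0..1} (\<lambda>u. (s - s') *\<^sub>R velocity \<gamma> (s' + u * (s - s'))) = \<gamma> s - \<gamma> s'"
    by (rule integral_unique[THEN trans]) simp
  then show ?thesis by (simp only: integral_cmul cbox_interval)
qed

text \<open>The averaged velocity \<open>Q\<close> is continuous on the compact square. It has no
  zero: off the diagonal by injectivity of the arc, on the diagonal because velocities do not
  vanish. Its minimal norm is the constant of the arc, and finiteness of the network gives a common
  one.\<close>

lemma bilipschitz:
  obtains \<kappa> where "\<kappa> > 0"
    "\<And>\<gamma> s s'. \<gamma> \<in> E \<Longrightarrow> s \<in> {0..1} \<Longrightarrow> s' \<in> {0..1} \<Longrightarrow> \<kappa> * \<bar>s - s'\<bar> \<le> norm (\<gamma> s - \<gamma> s')"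
proof -
  have "\<exists>\<kappa>>0. \<forall>s\<in>{0..1}. \<forall>s'\<in>{0..1}. \<kappa> * \<bar>s - s'\<bar> \<le> norm (\<gamma> s - \<gamma> s')" if \<gamma>: "\<gamma> \<in> E" for \<gamma>
  proof -
    define Q where "Q p = integral (cbox 0 1) (\<lambda>u. velocity \<gamma> (snd p + u * (fst p - snd p)))" for p
    define f where "f = (\<lambda>(p, u). snd p + u * (fst p - snd p) :: real)"
    have range: "f ` (({0..1} \<times> {0..1}) \<times> cbox 0 1) \<subseteq> {0..1}"
      using segment_unit_interval by (fastforce simp: f_def)
    have "continuous_on (({0..1} \<times> {0..1}) \<times> cbox 0 1) f"
      unfolding f_def case_prod_unfold by (intro continuous_intros)
    then have "continuous_on (({0..1} \<times> {0..1}) \<times> cbox 0 1) (\<lambda>x. velocity \<gamma> (f x))"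
      using continuous_on_compose2[OF continuous_velocity[OF \<gamma>] _ range] by blast
    then have "continuous_on ({0..1} \<times> {0..1}) Q"
      unfolding Q_def by (intro integral_continuous_on_param) (simp add: f_def case_prod_unfold)
    then have "continuous_on ({0..1} \<times> {0..1}) (\<lambda>p. norm (Q p))" by (intro continuous_on_norm)
    then obtain p where p: "p \<in> {0..1} \<times> {0..1}" "\<And>q. q \<in> {0..1} \<times> {0..1} \<Longrightarrow> norm (Q p) \<le> norm (Q q)"
      using continuous_attains_inf[of "{0..1} \<times> {0..1}" "\<lambda>p. norm (Q p)"] by (metis compact_Icc compact_Times Times_empty atLeastatMost_empty_iff zero_le_one not_one_le_zero)
    have "Q p \<noteq> 0"
    proof (cases "fst p = snd p")
      case True
      then show ?thesis using velocity_nonzero[OF \<gamma>, of "snd p"] p(1) by (auto simp: Q_def)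
    next
      case False
      then have "\<gamma> (fst p) - \<gamma> (snd p) \<noteq> 0" using arc_inj[OF \<gamma>, of "fst p" "snd p"] p(1) by auto
      then show ?thesis using arc_difference[OF \<gamma>, of "fst p" "snd p"] p(1) by (auto simp: Q_def)
    qed
    moreover have "norm (Q p) * \<bar>s - s'\<bar> \<le> norm (\<gamma> s - \<gamma> s')" if "s \<in> {0..1}" "s' \<in> {0..1}" for s s'
      using p(2)[of "(s, s')"] that arc_difference[OF \<gamma> that] by (simp add: Q_def mult.commute mult_left_mono)
    ultimately show ?thesis by (intro exI[of _ "norm (Q p)"]) auto
  qed
  then have "\<forall>\<gamma>\<in>E. \<exists>\<kappa>. \<kappa> > 0 \<and> (\<forall>s\<in>{0..1}. \<forall>s'\<in>{0..1}. \<kappa> * \<bar>s - s'\<bar> \<le> norm (\<gamma> s - \<gamma> s'))" ..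
  from bchoice[OF this] obtain k
    where k: "\<And>\<gamma>. \<gamma> \<in> E \<Longrightarrow> k \<gamma> > 0 \<and> (\<forall>s\<in>{0..1}. \<forall>s'\<in>{0..1}. k \<gamma> * \<bar>s - s'\<bar> \<le> norm (\<gamma> s - \<gamma> s'))"
    by blast
  define \<kappa> where "\<kappa> = Min (insert 1 (k ` E))"
  have "\<kappa> > 0" using finite_arcs k by (simp add: \<kappa>_def)
  moreover have "\<kappa> \<le> k \<gamma>" if "\<gamma> \<in> E" for \<gamma> using finite_arcs that by (auto simp: \<kappa>_def)
  ultimately have "\<kappa> * \<bar>s - s'\<bar> \<le> norm (\<gamma> s - \<gamma> s')" if "\<gamma> \<in> E" "s \<in> {0..1}" "s' \<in> {0..1}" for \<gamma> s s'
    using k[OF that(1)] that mult_right_mono[of \<kappa> "k \<gamma>" "\<bar>s - s'\<bar>"] by fastforce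
  with \<open>\<kappa> > 0\<close> show thesis by (rule that)
qed

text \<open>The complement of an open arc consists of the other closed arcs and the two end points.
  Hence an open arc is relatively open in the network, and a continuous curve inside it stays there
  for a while.\<close>

lemma closed_off_arc:
  assumes \<gamma>: "\<gamma> \<in> E"
  shows "closed (network_set E - \<gamma> ` {0<..<1})"
proof -
  have "network_set E - \<gamma> ` {0<..<1} = (\<Union>\<gamma>'\<in>E - {\<gamma>, inverse_arc \<gamma>}. \<gamma>' ` {0..1}) \<union> {\<gamma> 0, \<gamma> 1}"
  proof (intro equalityI subsetI)
    fix x assume x: "x \<in> network_set E - \<gamma> ` {0<..<1}"
    then obtain \<gamma>' s where s: "\<gamma>' \<in> E" "s \<in> {0..1}" "x = \<gamma>' s" by (auto simp: network_set_def)
    have "x \<in> {\<gamma> 0, \<gamma> 1}" if "x \<in> \<gamma> ` {0..1}"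
    proof -
      have "{0..1::real} = {0<..<1} \<union> {0, 1}" by auto
      then show ?thesis using that x by auto
    qed
    moreover have "x \<in> \<gamma> ` {0..1}" if "\<gamma>' = inverse_arc \<gamma>" using that s by auto
    moreover have "x \<in> \<gamma> ` {0..1}" if "\<gamma>' = \<gamma>" using that s by auto
    ultimately have "x \<in> {\<gamma> 0, \<gamma> 1}" if "\<not> \<gamma>' \<in> E - {\<gamma>, inverse_arc \<gamma>}" using that s(1) by blast
    moreover have "x \<in> (\<Union>\<gamma>'\<in>E - {\<gamma>, inverse_arc \<gamma>}. \<gamma>' ` {0..1})" if "\<gamma>' \<in> E - {\<gamma>, inverse_arc \<gamma>}"
      using that s by (intro UN_I[of \<gamma>']) auto
    ultimately show "x \<in> (\<Union>\<gamma>'\<in>E - {\<gamma>, inverse_arc \<gamma>}. \<gamma>' ` {0..1}) \<union> {\<gamma> 0, \<gamma> 1}" by blast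
  next
    fix x assume "x \<in> (\<Union>\<gamma>'\<in>E - {\<gamma>, inverse_arc \<gamma>}. \<gamma>' ` {0..1}) \<union> {\<gamma> 0, \<gamma> 1}"
    then show "x \<in> network_set E - \<gamma> ` {0<..<1}"
    proof
      assume "x \<in> (\<Union>\<gamma>'\<in>E - {\<gamma>, inverse_arc \<gamma>}. \<gamma>' ` {0..1})"
      then obtain \<gamma>' s where 1: "\<gamma>' \<in> E" "\<gamma>' \<noteq> \<gamma>" "\<gamma>' \<noteq> inverse_arc \<gamma>" "s \<in> {0..1}" "x = \<gamma>' s"
        by blast
      have "x \<notin> \<gamma> ` {0<..<1}"
      proof
        assume "x \<in> \<gamma> ` {0<..<1}"
        then obtain s' where s': "s' \<in> {0<..<1}" "x = \<gamma> s'" by auto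
        then have "\<gamma> s' = \<gamma>' s" "s' \<in> {0..1}" using 1(5) by auto
        then show False using arc_eq_cases[OF \<gamma> 1(1) _ 1(4)] 1(2,3) s'(1) by (metis empty_iff greaterThanLessThan_iff insert_iff less_irrefl)
      qed
      then show ?thesis using 1(1,4) unfolding 1(5) network_set_def by blast
    next
      assume "x \<in> {\<gamma> 0, \<gamma> 1}"
      then obtain s where 2: "s \<in> {0, 1}" "x = \<gamma> s" by auto
      have "x \<notin> \<gamma> ` {0<..<1}"
      proof
        assume "x \<in> \<gamma> ` {0<..<1}"
        then obtain s' where "s' \<in> {0<..<1}" "x = \<gamma> s'" by auto
        then show False using 2 \<gamma> arc_inj[of \<gamma> s s'] by auto
      qed
      then show ?thesis using 2 \<gamma> by (force simp: network_set_def)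
    qed
  qed
  also have "closed \<dots>"
    using finite_arcs compact_arc by (intro closed_Un closed_UN ballI compact_imp_closed) auto
  finally show ?thesis .
qed

lemma network_cases:
  assumes "x \<in> network_set E"
  obtains "x \<in> vertices E" | \<gamma> s where "\<gamma> \<in> E" "s \<in> {0<..<1}" "x = \<gamma> s"
proof -
  obtain \<gamma> s where s: "\<gamma> \<in> E" "s \<in> {0..1}" "x = \<gamma> s" using assms by (auto simp: network_set_def)
  show thesis
  proof (cases "s \<in> {0, 1}")
    case True
    then have "x \<in> vertices E" using vertex_iff[OF s(1,2)] s(3) by simp
    then show thesis by (rule that(1))
  next
    case False
    then have "s \<in> {0<..<1}" using s(2) by auto
    then show thesis using s(1,3) by (rule_tac that(2))
  qed
qed

text \<open>Leaving an arc requires passing one of its ends. Otherwise the times spent on the closed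
  arc and those spent off the open arc would be disjoint closed sets separating
  \<open>{u..v}\<close>.\<close>

lemma vertex_between:
  fixes \<zeta> :: "real \<Rightarrow> 'a"
  assumes cont: "continuous_on {u..v} \<zeta>" and net: "\<zeta> ` {u..v} \<subseteq> network_set E"
    and \<gamma>: "\<gamma> \<in> E" and t: "t \<in> {u..v}" "\<zeta> t \<in> \<gamma> ` {0..1}" and r: "r \<in> {u..v}" "\<zeta> r \<notin> \<gamma> ` {0<..<1}"
  obtains w where "w \<in> {u..v}" "\<zeta> w \<in> vertices E" "\<zeta> w \<in> \<gamma> ` {0..1}"
proof -
  have "\<exists>w\<in>{u..v}. \<zeta> w \<in> vertices E \<and> \<zeta> w \<in> \<gamma> ` {0..1}"
  proof (rule ccontr)
    assume neg: "\<not> ?thesis"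
    have in_open: "\<zeta> w \<in> \<gamma> ` {0<..<1}" if w: "w \<in> {u..v}" "\<zeta> w \<in> \<gamma> ` {0..1}" for w
    proof -
      obtain s where s: "s \<in> {0..1}" "\<zeta> w = \<gamma> s" using w by auto
      then have "s \<notin> {0, 1}" using neg w vertex_iff[OF \<gamma> s(1)] by metis
      then show ?thesis using s by auto
    qed
    have "closed ({u..v} \<inter> \<zeta> -` (\<gamma> ` {0..1}))" "closed ({u..v} \<inter> \<zeta> -` (network_set E - \<gamma> ` {0<..<1}))"
      using cont closed_off_arc[OF \<gamma>] compact_imp_closed[OF compact_arc[OF \<gamma>]] by (auto intro: continuous_closed_preimage)
    moreover have "connected {u..v}" by simp
    moreover have "({u..v} \<inter> \<zeta> -` (\<gamma> ` {0..1})) \<inter> ({u..v} \<inter> \<zeta> -` (network_set E - \<gamma> ` {0<..<1})) \<inter> {u..v} = {}"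
      using in_open by blast
    moreover have "{u..v} \<subseteq> ({u..v} \<inter> \<zeta> -` (\<gamma> ` {0..1})) \<union> ({u..v} \<inter> \<zeta> -` (network_set E - \<gamma> ` {0<..<1}))"
    proof -
      have "\<gamma> ` {0<..<1} \<subseteq> \<gamma> ` {0..1}" by (intro image_mono) auto
      then show ?thesis using net by blast
    qed
    ultimately have "({u..v} \<inter> \<zeta> -` (\<gamma> ` {0..1})) \<inter> {u..v} = {} \<or> ({u..v} \<inter> \<zeta> -` (network_set E - \<gamma> ` {0<..<1})) \<inter> {u..v} = {}"
      by (intro connected_closedD)
    then show False using t r net by blast
  qed
  then obtain w where "w \<in> {u..v}" "\<zeta> w \<in> vertices E" "\<zeta> w \<in> \<gamma> ` {0..1}" by blast
  then show thesis by (rule that)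
qed

lemma velocity_at:
  assumes "\<gamma> \<in> E" "s \<in> {0<..<1}"
  shows "(\<gamma> has_vector_derivative velocity \<gamma> s) (at s)"
  using differentiable_arcs[OF assms(1), of s] assms(2) at_within_Icc_at[of 0 s 1] by auto

text \<open>The coordinate \<sigma> inherits differentiability from \<zeta>: after projection on the
  velocity \<open>v\<close> at \<open>s0\<close>, the difference quotient of \<zeta> is that of the
  arc, evaluated at \<sigma>, times that of \<sigma>. The middle one tends to
  \<open>v \<bullet> v\<close>, which is nonzero, so one may divide.\<close>

lemma arc_coordinate_derivative:
  fixes \<zeta> :: "real \<Rightarrow> 'a"
  assumes \<gamma>: "\<gamma> \<in> E" and S: "open S" "t \<in> S" "\<zeta> ` S \<subseteq> network_set E"
    and t: "\<zeta> t = \<gamma> s0" "s0 \<in> {0<..<1}" and D: "(\<zeta> has_vector_derivative D) (at t)"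
  obtains \<sigma> l \<delta> where "\<delta> > 0" "\<sigma> t = s0"
    "\<And>u. \<bar>u - t\<bar> < \<delta> \<Longrightarrow> \<sigma> u \<in> {0<..<1} \<and> \<zeta> u = \<gamma> (\<sigma> u)"
    "(\<sigma> has_real_derivative l) (at t)" "D = l *\<^sub>R velocity \<gamma> s0"
proof -
  have cont: "isCont \<zeta> t" using D has_vector_derivative_continuous by blast
  define \<sigma> where "\<sigma> u = inv_into {0..1} \<gamma> (\<zeta> u)" for u
  have "open (- (network_set E - \<gamma> ` {0<..<1}))" by (rule open_Compl[OF closed_off_arc[OF \<gamma>]])
  moreover have "\<zeta> t \<in> - (network_set E - \<gamma> ` {0<..<1})" using t by auto
  ultimately have "\<forall>\<^sub>F u in nhds t. \<zeta> u \<in> - (network_set E - \<gamma> ` {0<..<1})"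
    using cont unfolding isCont_def tendsto_at_iff_tendsto_nhds by (rule_tac topological_tendstoD)
  moreover have "\<forall>\<^sub>F u in nhds t. u \<in> S" using S by (simp add: eventually_nhds_in_open)
  ultimately have "\<forall>\<^sub>F u in nhds t. \<zeta> u \<in> \<gamma> ` {0<..<1}"
    by eventually_elim (use S(3) in auto)
  then obtain \<delta> where \<delta>: "\<delta> > 0" "\<And>u. \<bar>u - t\<bar> < \<delta> \<Longrightarrow> \<zeta> u \<in> \<gamma> ` {0<..<1}"
    unfolding eventually_nhds_metric dist_real_def by blast
  have inj: "inj_on \<gamma> {0..1}" using arc_inj[OF \<gamma>] by (auto intro: inj_onI)
  have \<sigma>: "\<sigma> u \<in> {0<..<1} \<and> \<zeta> u = \<gamma> (\<sigma> u)" if u: "\<bar>u - t\<bar> < \<delta>" for u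
  proof -
    obtain s where s: "s \<in> {0<..<1}" "\<zeta> u = \<gamma> s" using \<delta>(2)[OF u] by auto
    then have "\<sigma> u = s" unfolding \<sigma>_def s(2) by (intro inv_into_f_f[OF inj]) auto
    then show ?thesis using s by simp
  qed
  have \<sigma>t: "\<sigma> t = s0" unfolding \<sigma>_def t(1) using t(2) by (intro inv_into_f_f[OF inj]) auto
  obtain \<kappa> where "\<kappa> > 0" and "\<And>\<gamma> s s'. \<gamma> \<in> E \<Longrightarrow> s \<in> {0..1} \<Longrightarrow> s' \<in> {0..1} \<Longrightarrow> \<kappa> * \<bar>s - s'\<bar> \<le> norm (\<gamma> s - \<gamma> s')"
    using bilipschitz by blast
  note \<kappa> = this(1) this(2)[OF \<gamma>]
  have ev: "\<forall>\<^sub>F u in at t. \<bar>u - t\<bar> < \<delta>"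
    unfolding eventually_at using \<delta>(1) by (auto simp: dist_real_def)
  \<comment> \<open>Continuity of the coordinate comes from the lower Lipschitz bound on the
    arc.\<close>
  have \<sigma>_lim: "(\<sigma> \<longlongrightarrow> s0) (at t)"
  proof (rule Lim_transform_bound[where f = "\<lambda>u. \<sigma> u - s0" and g = "\<lambda>u. (\<zeta> u - \<zeta> t) /\<^sub>R \<kappa>", THEN LIM_zero_cancel])
    show "\<forall>\<^sub>F u in at t. norm (\<sigma> u - s0) \<le> norm ((\<zeta> u - \<zeta> t) /\<^sub>R \<kappa>)"
      using ev
    proof eventually_elim
      case (elim u)
      then have "\<kappa> * \<bar>\<sigma> u - s0\<bar> \<le> norm (\<zeta> u - \<zeta> t)" using \<kappa>(2)[of "\<sigma> u" s0] \<sigma>[OF elim] t by auto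
      then have "\<bar>\<sigma> u - s0\<bar> \<le> inverse \<kappa> * norm (\<zeta> u - \<zeta> t)"
        using \<kappa>(1) by (simp add: field_simps)
      then show ?case using \<kappa>(1) by simp
    qed
    have "((\<lambda>u. \<zeta> u - \<zeta> t) \<longlongrightarrow> 0) (at t)" using cont by (simp add: isCont_def LIM_zero)
    then show "((\<lambda>u. (\<zeta> u - \<zeta> t) /\<^sub>R \<kappa>) \<longlongrightarrow> 0) (at t)" by (metis tendsto_scaleR[OF tendsto_const] scaleR_zero_right)
  qed
  define v where "v = velocity \<gamma> s0"
  have v: "v \<noteq> 0" using velocity_nonzero[OF \<gamma>, of s0] t(2) by (auto simp: v_def)
  \<comment> \<open>The value at \<open>s0\<close> makes \<open>k\<close> continuous there and keeps
    the factorization valid when \<sigma> returns to \<open>s0\<close> at times other than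
    \<open>t\<close>.\<close>
  define k where "k s = (if s = s0 then v \<bullet> v else ((\<gamma> s - \<gamma> s0) \<bullet> v) / (s - s0))" for s
  have k: "(\<gamma> s - \<gamma> s0) \<bullet> v = k s * (s - s0)" for s by (simp add: k_def)
  have "((\<lambda>s. \<gamma> s \<bullet> v) has_real_derivative v \<bullet> v) (at s0)"
    using velocity_at[OF \<gamma> t(2)] unfolding has_real_derivative_iff_has_vector_derivative v_def
    by (rule bounded_linear.has_vector_derivative[OF bounded_linear_inner_left])
  then have "((\<lambda>s. (\<gamma> s \<bullet> v - \<gamma> s0 \<bullet> v) / (s - s0)) \<longlongrightarrow> v \<bullet> v) (at s0)"
    by (simp add: has_field_derivative_iff)
  then have "(k \<longlongrightarrow> v \<bullet> v) (at s0)"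
    by (rule Lim_transform_eventually) (auto simp: k_def inner_diff_left eventually_at_filter)
  then have "isCont k s0" by (simp add: isCont_def k_def)
  then have k_lim: "((\<lambda>u. k (\<sigma> u)) \<longlongrightarrow> v \<bullet> v) (at t)"
    using isCont_tendsto_compose[OF _ \<sigma>_lim] by (fastforce simp: k_def)
  define l where "l = (D \<bullet> v) / (v \<bullet> v)"
  have "((\<lambda>u. \<zeta> u \<bullet> v) has_real_derivative D \<bullet> v) (at t)"
    using D unfolding has_real_derivative_iff_has_vector_derivative
    by (rule bounded_linear.has_vector_derivative[OF bounded_linear_inner_left])
  then have "((\<lambda>u. (\<zeta> u \<bullet> v - \<zeta> t \<bullet> v) / (u - t)) \<longlongrightarrow> D \<bullet> v) (at t)"
    by (simp add: has_field_derivative_iff)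
  then have "((\<lambda>u. ((\<zeta> u \<bullet> v - \<zeta> t \<bullet> v) / (u - t)) / k (\<sigma> u)) \<longlongrightarrow> l) (at t)"
    unfolding l_def using k_lim v by (intro tendsto_divide) auto
  moreover have "\<forall>\<^sub>F u in at t. k (\<sigma> u) \<noteq> 0"
    using k_lim v by (intro tendsto_imp_eventually_ne) auto
  then have "\<forall>\<^sub>F u in at t. ((\<zeta> u \<bullet> v - \<zeta> t \<bullet> v) / (u - t)) / k (\<sigma> u) = (\<sigma> u - \<sigma> t) / (u - t)"
    using ev
  proof eventually_elim
    case (elim u)
    have "\<zeta> u \<bullet> v - \<zeta> t \<bullet> v = k (\<sigma> u) * (\<sigma> u - s0)"
      using k[of "\<sigma> u"] \<sigma>[OF elim(2)] t(1) by (simp add: inner_diff_left)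
    then show ?case using elim(1) \<sigma>t by simp
  qed
  ultimately have "((\<lambda>u. (\<sigma> u - \<sigma> t) / (u - t)) \<longlongrightarrow> l) (at t)" by (rule Lim_transform_eventually)
  then have d\<sigma>: "(\<sigma> has_real_derivative l) (at t)" by (simp add: has_field_derivative_iff)
  have "(\<gamma> \<circ> \<sigma> has_vector_derivative l *\<^sub>R v) (at t)"
    using d\<sigma> velocity_at[OF \<gamma> t(2)] \<sigma>t
    by (intro vector_diff_chain_at) (auto simp: v_def has_real_derivative_iff_has_vector_derivative)
  then have "(\<zeta> has_vector_derivative l *\<^sub>R v) (at t)"
    by (rule has_vector_derivative_transform_within_open[of _ _ _ "ball t \<delta>"]) (use \<delta>(1) \<sigma> in \<open>auto simp: dist_real_def abs_minus_commute\<close>)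
  then have "D = l *\<^sub>R velocity \<gamma> s0" using D vector_derivative_unique_at v_def by blast
  then show thesis using that[OF \<delta>(1) \<sigma>t \<sigma> d\<sigma>] by blast
qed

end

section \<open>The overall Lagrangian along curves\<close>

text \<open>Each isolated point is the only point of \<open>Z\<close> in some interval with rational
  ends. This is what makes visits to a vertex with nonzero derivative negligible.\<close>

lemma countable_isolated_points:
  fixes Z :: "real set"
  shows "countable {x \<in> Z. \<exists>\<delta>>0. \<forall>y\<in>Z. \<bar>y - x\<bar> < \<delta> \<longrightarrow> y = x}" (is "countable ?A")
proof -
  have "?A \<subseteq> (\<Union>p\<in>\<rat>. \<Union>q\<in>\<rat>. {x. {p<..<q} \<inter> Z = {x}})"
  proof
    fix x assume "x \<in> ?A"
    then obtain \<delta> where \<delta>: "\<delta> > 0" "\<And>y. y \<in> Z \<Longrightarrow> \<bar>y - x\<bar> < \<delta> \<Longrightarrow> y = x" "x \<in> Z" by blast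
    obtain p where p: "p \<in> \<rat>" "x - \<delta> < p" "p < x" using Rats_dense_in_real[of "x - \<delta>" x] \<delta>(1) by auto
    obtain q where q: "q \<in> \<rat>" "x < q" "q < x + \<delta>" using Rats_dense_in_real[of x "x + \<delta>"] \<delta>(1) by auto
    have "{p<..<q} \<inter> Z = {x}" using p q \<delta>(2,3) by force
    then show "x \<in> (\<Union>p\<in>\<rat>. \<Union>q\<in>\<rat>. {x. {p<..<q} \<inter> Z = {x}})" using p(1) q(1) by blast
  qed
  moreover have "countable {x. {p<..<q} \<inter> Z = {x}}" for p q :: real
  proof -
    have "{x. {p<..<q} \<inter> Z = {x}} \<subseteq> {THE x. {p<..<q} \<inter> Z = {x}}" by auto
    then show ?thesis by (rule countable_subset) simp
  qed
  then have "countable (\<Union>p\<in>\<rat>. \<Union>q\<in>\<rat>. {x. {p<..<q} \<inter> Z = {x}})"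
    by (intro countable_UN countable_rat) auto
  ultimately show ?thesis by (rule countable_subset)
qed

locale network_lagrangian = network_hamiltonian E H
  for E :: "'a::euclidean_space curve set" and H +
  fixes c :: "'a \<Rightarrow> real"
  assumes flux_limiter: "flux_limiter E H c"
begin

abbreviation "lagrangian \<equiv> arc_lagrangian H"

abbreviation integrand :: "real \<Rightarrow> (real \<Rightarrow> 'a) \<Rightarrow> real \<Rightarrow> ereal" where
  "integrand T \<zeta> t \<equiv> overall_lagrangian E H c (\<zeta> t) (vector_derivative \<zeta> (at t within {0..T}))"

section \<open>Uniform bounds on Hamiltonians and Lagrangians of the arcs\<close>

lemma H_bounded:
  obtains B where "B \<ge> 0" "\<And>\<gamma> s \<mu>. \<gamma> \<in> E \<Longrightarrow> s \<in> {0..1} \<Longrightarrow> \<bar>\<mu>\<bar> \<le> M \<Longrightarrow> \<bar>H \<gamma> s \<mu>\<bar> \<le> B"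
proof -
  have "bounded (\<Union>\<gamma>\<in>E. (\<lambda>(s, \<mu>). H \<gamma> s \<mu>) ` ({0..1} \<times> {-M..M}))"
    using finite_arcs
    by (intro bounded_UN ballI compact_imp_bounded compact_continuous_image compact_Times continuous_on_subset[OF H_continuous]) auto
  then obtain B where B: "B > 0" "\<forall>x\<in>(\<Union>\<gamma>\<in>E. (\<lambda>(s, \<mu>). H \<gamma> s \<mu>) ` ({0..1} \<times> {-M..M})). norm x \<le> B"
    using bounded_pos by metis
  have "\<bar>H \<gamma> s \<mu>\<bar> \<le> B" if "\<gamma> \<in> E" "s \<in> {0..1}" "\<bar>\<mu>\<bar> \<le> M" for \<gamma> s \<mu>
  proof -
    have "H \<gamma> s \<mu> \<in> (\<lambda>(s, \<mu>). H \<gamma> s \<mu>) ` ({0..1} \<times> {-M..M})"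
      using that by (intro image_eqI[of _ _ "(s, \<mu>)"]) auto
    then show ?thesis using B(2) that(1) by fastforce
  qed
  moreover have "B \<ge> 0" using B(1) by simp
  ultimately show thesis by (rule_tac that)
qed

lemma H_continuous_s: "\<gamma> \<in> E \<Longrightarrow> continuous_on {0..1} (\<lambda>s. H \<gamma> s \<mu>)"
  by (rule continuous_on_compose2[OF H_continuous, of \<gamma> "{0..1}" "\<lambda>s. (s, \<mu>)", simplified])
     (auto intro!: continuous_intros)

lemma H_coercive:
  assumes \<gamma>: "\<gamma> \<in> E"
  obtains R where "\<And>s \<mu>. s \<in> {0..1} \<Longrightarrow> \<bar>\<mu>\<bar> \<ge> R \<Longrightarrow> \<Lambda> * \<bar>\<mu>\<bar> \<le> H \<gamma> s \<mu>"
proof -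
  have "\<forall>\<^sub>F \<mu> in at_infinity. \<Lambda> \<le> (INF s\<in>{0..1}. H \<gamma> s \<mu> / \<bar>\<mu>\<bar>)"
    using H_superlinear[OF \<gamma>] by (simp add: filterlim_at_top)
  then obtain R where R: "\<And>\<mu>. R \<le> \<bar>\<mu>\<bar> \<Longrightarrow> \<Lambda> \<le> (INF s\<in>{0..1}. H \<gamma> s \<mu> / \<bar>\<mu>\<bar>)"
    unfolding eventually_at_infinity by auto
  have "\<Lambda> * \<bar>\<mu>\<bar> \<le> H \<gamma> s \<mu>" if s: "s \<in> {0..1}" and \<mu>: "max R 1 \<le> \<bar>\<mu>\<bar>" for s \<mu>
  proof -
    \<comment> \<open>A real \<open>INF\<close> bounds its members only if they are bounded below,
      which continuity in \<open>s\<close> provides. The maximum with 1 keeps \<mu> away from zero,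
      so that the quotient is continuous and can be multiplied out.\<close>
    have "continuous_on {0..1} (\<lambda>s. H \<gamma> s \<mu> / \<bar>\<mu>\<bar>)"
      using H_continuous_s[OF \<gamma>] \<mu> by (intro continuous_on_divide) auto
    then have "bdd_below ((\<lambda>s. H \<gamma> s \<mu> / \<bar>\<mu>\<bar>) ` {0..1})"
      by (intro bounded_imp_bdd_below compact_imp_bounded compact_continuous_image) auto
    then have "(INF s\<in>{0..1}. H \<gamma> s \<mu> / \<bar>\<mu>\<bar>) \<le> H \<gamma> s \<mu> / \<bar>\<mu>\<bar>" using s by (rule cINF_lower)
    then have "\<Lambda> \<le> H \<gamma> s \<mu> / \<bar>\<mu>\<bar>" using R[of \<mu>] \<mu> by simp
    then show ?thesis using \<mu> by (simp add: field_simps)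
  qed
  then show thesis by (rule that)
qed

text \<open>For large |\<mu>| superlinearity lets \<open>H\<close> absorb the linear term of slope
  \<Lambda>; the remaining \<mu> form a compact set. One constant serves all arcs, so the suprema
  defining the Lagrangians are finite and locally bounded.\<close>

lemma conjugate_bounded:
  obtains C where "\<And>\<gamma> s l \<mu>. \<gamma> \<in> E \<Longrightarrow> s \<in> {0..1} \<Longrightarrow> \<bar>l\<bar> \<le> \<Lambda> \<Longrightarrow> l * \<mu> - H \<gamma> s \<mu> \<le> C"
proof -
  have "\<exists>C. \<forall>s\<in>{0..1}. \<forall>l \<mu>. \<bar>l\<bar> \<le> \<Lambda> \<longrightarrow> l * \<mu> - H \<gamma> s \<mu> \<le> C" if \<gamma>: "\<gamma> \<in> E" for \<gamma>
  proof -
    obtain R where R: "\<And>s \<mu>. s \<in> {0..1} \<Longrightarrow> \<bar>\<mu>\<bar> \<ge> R \<Longrightarrow> \<Lambda> * \<bar>\<mu>\<bar> \<le> H \<gamma> s \<mu>"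
      using H_coercive[OF \<gamma>] by blast
    obtain B where B: "B \<ge> 0" "\<And>\<gamma> s \<mu>. \<gamma> \<in> E \<Longrightarrow> s \<in> {0..1} \<Longrightarrow> \<bar>\<mu>\<bar> \<le> R \<Longrightarrow> \<bar>H \<gamma> s \<mu>\<bar> \<le> B"
      using H_bounded[of R] by blast
    have "l * \<mu> - H \<gamma> s \<mu> \<le> \<bar>\<Lambda>\<bar> * \<bar>R\<bar> + B" if "s \<in> {0..1}" "\<bar>l\<bar> \<le> \<Lambda>" for s l \<mu>
    proof -
      have le: "l * \<mu> \<le> \<Lambda> * \<bar>\<mu>\<bar>"
        using mult_right_mono[OF that(2), of "\<bar>\<mu>\<bar>"] abs_le_D1[of "l * \<mu>"] by (simp add: abs_mult)
      show ?thesis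
      proof (cases "\<bar>\<mu>\<bar> \<ge> R")
        case True
        then show ?thesis using le R[OF that(1) True] B(1) abs_ge_zero[of "\<Lambda> * R"] unfolding abs_mult by linarith
      next
        case False
        have "\<Lambda> * \<bar>\<mu>\<bar> \<le> \<bar>\<Lambda>\<bar> * \<bar>R\<bar>" using False by (intro mult_mono) auto
        moreover have "\<bar>H \<gamma> s \<mu>\<bar> \<le> B" using B(2)[OF \<gamma> that(1), of \<mu>] False by simp
        ultimately show ?thesis using le by linarith
      qed
    qed
    then show ?thesis by blast
  qed
  then have "\<forall>\<gamma>\<in>E. \<exists>C. \<forall>s\<in>{0..1}. \<forall>l \<mu>. \<bar>l\<bar> \<le> \<Lambda> \<longrightarrow> l * \<mu> - H \<gamma> s \<mu> \<le> C" ..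
  from bchoice[OF this] obtain C where C: "\<And>\<gamma> s l \<mu>. \<gamma> \<in> E \<Longrightarrow> s \<in> {0..1} \<Longrightarrow> \<bar>l\<bar> \<le> \<Lambda> \<Longrightarrow> l * \<mu> - H \<gamma> s \<mu> \<le> C \<gamma>"
    by blast
  have "l * \<mu> - H \<gamma> s \<mu> \<le> Max (insert 0 (C ` E))" if "\<gamma> \<in> E" "s \<in> {0..1}" "\<bar>l\<bar> \<le> \<Lambda>" for \<gamma> s l \<mu>
    using C[OF that, of \<mu>] that(1) finite_arcs by (auto simp: le_max_iff_disj Max_ge_iff)
  then show thesis by (rule that)
qed

lemma conjugate_bdd_above:
  assumes "\<gamma> \<in> E" "s \<in> {0..1}"
  shows "bdd_above (range (\<lambda>\<mu>. l * \<mu> - H \<gamma> s \<mu>))"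
proof -
  obtain C where "\<And>\<gamma> s l' \<mu>. \<gamma> \<in> E \<Longrightarrow> s \<in> {0..1} \<Longrightarrow> \<bar>l'\<bar> \<le> \<bar>l\<bar> \<Longrightarrow> l' * \<mu> - H \<gamma> s \<mu> \<le> C"
    using conjugate_bounded[of "\<bar>l\<bar>"] by blast
  then have "l * \<mu> - H \<gamma> s \<mu> \<le> C" for \<mu> using assms by simp
  then show ?thesis by (intro bdd_aboveI2)
qed

lemma lagrangian_ge: "\<gamma> \<in> E \<Longrightarrow> s \<in> {0..1} \<Longrightarrow> l * \<mu> - H \<gamma> s \<mu> \<le> lagrangian \<gamma> s l"
  unfolding arc_lagrangian_def by (intro cSUP_upper conjugate_bdd_above) auto

lemma lagrangian_approx:
  assumes "\<gamma> \<in> E" "s \<in> {0..1}" "\<epsilon> > 0"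
  obtains \<mu> where "lagrangian \<gamma> s l < l * \<mu> - H \<gamma> s \<mu> + \<epsilon>"
proof -
  have "lagrangian \<gamma> s l - \<epsilon> < (SUP \<mu>. l * \<mu> - H \<gamma> s \<mu>)" using assms(3) by (simp add: arc_lagrangian_def)
  then obtain \<mu> where "lagrangian \<gamma> s l - \<epsilon> < l * \<mu> - H \<gamma> s \<mu>"
    using less_cSUP_iff[OF UNIV_not_empty conjugate_bdd_above[OF assms(1,2), of l]] by auto
  then show thesis by (intro that[of \<mu>]) simp
qed

lemma lagrangian_bounded:
  obtains C where "\<And>\<gamma> s l. \<gamma> \<in> E \<Longrightarrow> s \<in> {0..1} \<Longrightarrow> \<bar>l\<bar> \<le> \<Lambda> \<Longrightarrow> lagrangian \<gamma> s l \<le> C"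
proof -
  obtain C where C: "\<And>\<gamma> s l \<mu>. \<gamma> \<in> E \<Longrightarrow> s \<in> {0..1} \<Longrightarrow> \<bar>l\<bar> \<le> \<Lambda> \<Longrightarrow> l * \<mu> - H \<gamma> s \<mu> \<le> C"
    using conjugate_bounded[of \<Lambda>] by blast
  have "lagrangian \<gamma> s l \<le> C" if "\<gamma> \<in> E" "s \<in> {0..1}" "\<bar>l\<bar> \<le> \<Lambda>" for \<gamma> s l
    unfolding arc_lagrangian_def using C[OF that] by (intro cSUP_least) auto
  then show thesis by (rule that)
qed

text \<open>The supremum is tested with \<mu> = \<open>a\<close> or \<mu> = \<open>- a\<close>,
  according to the sign of \<open>l\<close>. As \<open>a\<close> is arbitrary, the Lagrangians grow
  superlinearly, uniformly in \<open>s\<close> and in the arc.\<close>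

lemma lagrangian_growth:
  obtains C where "\<And>\<gamma> s l. \<gamma> \<in> E \<Longrightarrow> s \<in> {0..1} \<Longrightarrow> a * \<bar>l\<bar> - C \<le> lagrangian \<gamma> s l"
proof -
  obtain B where B: "B \<ge> 0" "\<And>\<gamma> s \<mu>. \<gamma> \<in> E \<Longrightarrow> s \<in> {0..1} \<Longrightarrow> \<bar>\<mu>\<bar> \<le> \<bar>a\<bar> \<Longrightarrow> \<bar>H \<gamma> s \<mu>\<bar> \<le> B"
    using H_bounded[of "\<bar>a\<bar>"] by blast
  have "a * \<bar>l\<bar> - B \<le> lagrangian \<gamma> s l" if "\<gamma> \<in> E" "s \<in> {0..1}" for \<gamma> s l
  proof -
    define \<mu> where "\<mu> = (if l \<ge> 0 then a else - a)"
    have "l * \<mu> = a * \<bar>l\<bar>" "\<bar>\<mu>\<bar> \<le> \<bar>a\<bar>" by (auto simp: \<mu>_def)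
    then show ?thesis using lagrangian_ge[OF that, of l \<mu>] B(2)[OF that, of \<mu>] by simp
  qed
  then show thesis by (rule that)
qed

lemma lagrangian_inverse_arc:
  assumes "\<gamma> \<in> E" "s \<in> {0..1}"
  shows "lagrangian (inverse_arc \<gamma>) s l = lagrangian \<gamma> (1 - s) (- l)"
proof -
  have "range (\<lambda>\<mu>. l * \<mu> - H (inverse_arc \<gamma>) s \<mu>) = range (\<lambda>\<mu>. - l * \<mu> - H \<gamma> (1 - s) \<mu>)"
  proof (intro equalityI subsetI)
    fix x assume "x \<in> range (\<lambda>\<mu>. l * \<mu> - H (inverse_arc \<gamma>) s \<mu>)"
    then obtain \<mu> where "x = l * \<mu> - H (inverse_arc \<gamma>) s \<mu>" by auto
    then show "x \<in> range (\<lambda>\<mu>. - l * \<mu> - H \<gamma> (1 - s) \<mu>)"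
      using H_inverse_arc[OF assms] by (intro range_eqI[of _ _ "- \<mu>"]) simp
  next
    fix x assume "x \<in> range (\<lambda>\<mu>. - l * \<mu> - H \<gamma> (1 - s) \<mu>)"
    then obtain \<mu> where "x = - l * \<mu> - H \<gamma> (1 - s) \<mu>" by auto
    then show "x \<in> range (\<lambda>\<mu>. l * \<mu> - H (inverse_arc \<gamma>) s \<mu>)"
      using H_inverse_arc[OF assms] by (intro range_eqI[of _ _ "- \<mu>"]) simp
  qed
  then show ?thesis unfolding arc_lagrangian_def by simp
qed

text \<open>\<open>arc_flux\<close> is minus the largest minimum of \<open>H\<close> along the arc,
  so the flux limiter controls that minimum at every \<open>s\<close>, not only at the vertex. This
  is what makes travelling near \<open>v\<close> at least as costly as resting there. The slack
  \<epsilon> replaces attainment of the minimum.\<close>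

lemma flux_limiter_subsolution:
  assumes \<gamma>: "\<gamma> \<in> E" "\<gamma> 1 = v" and s: "s \<in> {0..1}" and "\<epsilon> > 0"
  obtains \<mu> where "H \<gamma> s \<mu> < - c v + \<epsilon>"
proof -
  obtain C where C: "\<And>\<gamma> s l \<mu>. \<gamma> \<in> E \<Longrightarrow> s \<in> {0..1} \<Longrightarrow> \<bar>l\<bar> \<le> 0 \<Longrightarrow> l * \<mu> - H \<gamma> s \<mu> \<le> C"
    using conjugate_bounded[of 0] by blast
  obtain B where B: "B \<ge> 0" "\<And>\<gamma> s \<mu>. \<gamma> \<in> E \<Longrightarrow> s \<in> {0..1} \<Longrightarrow> \<bar>\<mu>\<bar> \<le> 0 \<Longrightarrow> \<bar>H \<gamma> s \<mu>\<bar> \<le> B"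
    using H_bounded[of 0] by blast
  have bdd: "bdd_below (range (H \<gamma> s))" if "s \<in> {0..1}" for s
    using C[OF \<gamma>(1) that, of 0] by (intro bdd_belowI2[of _ "- C"]) (simp add: minus_le_iff)
  have "(INF \<mu>. H \<gamma> s \<mu>) \<le> B" if "s \<in> {0..1}" for s
    using B(2)[OF \<gamma>(1) that, of 0] by (intro cINF_lower2[OF bdd[OF that], of 0]) auto
  then have "bdd_above ((\<lambda>s. INF \<mu>. H \<gamma> s \<mu>) ` {0..1})" by (rule bdd_aboveI2)
  then have "(INF \<mu>. H \<gamma> s \<mu>) \<le> - arc_flux H \<gamma>"
    unfolding arc_flux_def using s by (auto intro: cSUP_upper)
  moreover have "c v \<le> arc_flux H \<gamma>"
  proof -
    have "v \<in> vertices E" using \<gamma> by (auto simp: vertices_def)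
    then have "c v \<le> Min (arc_flux H ` arcs_into E v)" using flux_limiter by (simp add: flux_limiter_def)
    also have "\<dots> \<le> arc_flux H \<gamma>" using \<gamma> finite_arcs by (intro Min_le) (auto simp: arcs_into_def)
    finally show ?thesis .
  qed
  ultimately have "(INF \<mu>. H \<gamma> s \<mu>) < - c v + \<epsilon>" using \<open>\<epsilon> > 0\<close> by simp
  then obtain \<mu> where "H \<gamma> s \<mu> < - c v + \<epsilon>"
    using cINF_less_iff[OF UNIV_not_empty bdd[OF s]] by auto
  then show thesis by (rule that)
qed

section \<open>Values of the overall Lagrangian\<close>

lemma tangent_bundleI: "\<gamma> \<in> E \<Longrightarrow> s \<in> {0..1} \<Longrightarrow> (\<gamma> s, l *\<^sub>R velocity \<gamma> s) \<in> tangent_bundle E"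
  unfolding tangent_bundle_def by blast

lemma lagrangian_along_velocity:
  assumes "\<gamma> \<in> E" "s \<in> {0..1}"
  shows "lagrangian_along H \<gamma> s (l *\<^sub>R velocity \<gamma> s) = lagrangian \<gamma> s l"
  using velocity_nonzero[OF assms] by (simp add: lagrangian_along_def dot_square_norm)

lemma overall_lagrangian_arc:
  assumes \<gamma>: "\<gamma> \<in> E" and s: "s \<in> {0<..<1}"
  shows "overall_lagrangian E H c (\<gamma> s) (l *\<^sub>R velocity \<gamma> s) = ereal (lagrangian \<gamma> s l)"
proof -
  have s': "s \<in> {0..1}" using s by auto
  \<comment> \<open>The choice in the definition may return the given arc or its inverse; in the
    second case velocity and Lagrangian are both reflected and the value is unchanged.\<close>
  define \<gamma>' where "\<gamma>' = (SOME \<gamma>'. \<gamma>' \<in> E \<and> \<gamma> s \<in> \<gamma>' ` {0<..<1})"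
  have "\<gamma> \<in> E \<and> \<gamma> s \<in> \<gamma> ` {0<..<1}" using \<gamma> s by blast
  then have \<gamma>': "\<gamma>' \<in> E \<and> \<gamma> s \<in> \<gamma>' ` {0<..<1}" unfolding \<gamma>'_def by (rule someI[where P = "\<lambda>\<gamma>'. \<gamma>' \<in> E \<and> \<gamma> s \<in> \<gamma>' ` {0<..<1}"])
  then obtain r where r: "r \<in> {0<..<1}" "\<gamma> s = \<gamma>' r" by auto
  have "inj_on \<gamma>' {0..1}" using arc_inj \<gamma>' by (auto intro: inj_onI)
  then have inv: "inv_into {0..1} \<gamma>' (\<gamma> s) = r" unfolding r(2) using r(1) by (intro inv_into_f_f) auto
  have "r \<in> {0..1}" using r by auto
  have "lagrangian_along H \<gamma>' r (l *\<^sub>R velocity \<gamma> s) = lagrangian \<gamma> s l"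
  proof (rule arc_eq_cases[of \<gamma> \<gamma>' s r])
    show "\<gamma> \<in> E" "\<gamma>' \<in> E" "s \<in> {0..1}" "r \<in> {0..1}" "\<gamma> s = \<gamma>' r"
      using \<gamma> \<gamma>' s' \<open>r \<in> {0..1}\<close> r(2) by auto
  next
    assume "\<gamma>' = \<gamma>" "r = s" then show ?thesis using lagrangian_along_velocity[OF \<gamma> s'] by simp
  next
    assume *: "\<gamma>' = inverse_arc \<gamma>" "r = 1 - s"
    then have "velocity \<gamma>' r = - velocity \<gamma> s" using velocity_inverse_arc[OF \<gamma> \<open>r \<in> {0..1}\<close>] by simp
    then have "lagrangian_along H \<gamma>' r (l *\<^sub>R velocity \<gamma> s) = lagrangian_along H \<gamma>' r ((- l) *\<^sub>R velocity \<gamma>' r)" by simp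
    also have "\<dots> = lagrangian \<gamma>' r (- l)" using \<gamma>' \<open>r \<in> {0..1}\<close> by (intro lagrangian_along_velocity) auto
    also have "\<dots> = lagrangian \<gamma> s l" using * lagrangian_inverse_arc[OF \<gamma> \<open>r \<in> {0..1}\<close>] by simp
    finally show ?thesis .
  next
    assume "s \<in> {0, 1}" then show ?thesis using s by auto
  qed
  moreover have "\<gamma> s \<notin> vertices E" using vertex_iff[OF \<gamma> s'] s by auto
  ultimately show ?thesis
    using tangent_bundleI[OF \<gamma> s'] inv by (simp add: overall_lagrangian_def \<gamma>'_def)
qed

lemma overall_lagrangian_vertex:
  assumes "v \<in> vertices E"
  shows "overall_lagrangian E H c v 0 = ereal (c v)"
proof -
  obtain \<gamma> s where "\<gamma> \<in> E" "s \<in> {0, 1}" "v = \<gamma> s" using assms by (auto simp: vertices_def)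
  then have "(v, 0) \<in> tangent_bundle E" using tangent_bundleI[of \<gamma> s 0] by auto
  then show ?thesis using assms by (simp add: overall_lagrangian_def)
qed

lemma overall_lagrangian_off_network: "x \<notin> network_set E \<Longrightarrow> overall_lagrangian E H c x q = \<infinity>"
  by (auto simp: overall_lagrangian_def tangent_bundle_def network_set_def)

lemma overall_lagrangian_bounded_below:
  obtains B where "B \<ge> 0" "\<And>x q. overall_lagrangian E H c x q \<ge> ereal (- B)"
proof -
  obtain C where C: "\<And>\<gamma> s l. \<gamma> \<in> E \<Longrightarrow> s \<in> {0..1} \<Longrightarrow> 0 * \<bar>l\<bar> - C \<le> lagrangian \<gamma> s l"
    using lagrangian_growth[of 0] by blast
  define B where "B = Max (insert 0 (insert C ((\<lambda>v. - c v) ` vertices E)))"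
  have "finite (insert 0 (insert C ((\<lambda>v. - c v) ` vertices E)))" using finite_vertices by simp
  then have B: "0 \<le> B" "C \<le> B" "\<And>v. v \<in> vertices E \<Longrightarrow> - c v \<le> B"
    unfolding B_def by (rule Max_ge, simp)+
  have along: "- B \<le> lagrangian_along H \<gamma> s q" if "\<gamma> \<in> E" "s \<in> {0..1}" for \<gamma> s q
    using C[OF that, of "(q \<bullet> velocity \<gamma> s) / (norm (velocity \<gamma> s))\<^sup>2"] B(2) by (simp add: lagrangian_along_def)
  have "overall_lagrangian E H c x q \<ge> ereal (- B)" for x q
  proof (cases "(x, q) \<in> tangent_bundle E")
    case True
    then obtain \<gamma> s l where x: "\<gamma> \<in> E" "s \<in> {0..1}" "x = \<gamma> s" "q = l *\<^sub>R velocity \<gamma> s"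
      unfolding tangent_bundle_def by blast
    consider "x \<notin> vertices E" | "x \<in> vertices E" "q = 0" | "x \<in> vertices E" "q \<noteq> 0" by blast
    then show ?thesis
    proof cases
      case 1
      then have "s \<in> {0<..<1}" using x vertex_iff[of \<gamma> s] by auto
      then show ?thesis
        unfolding x(3,4) using overall_lagrangian_arc[OF x(1)] C[OF x(1,2), of l] B(2) by simp
    next
      case 2
      then show ?thesis using overall_lagrangian_vertex B(3)[of x] by (simp add: minus_le_iff)
    next
      case 3
      let ?A = "{\<gamma> \<in> arcs_into E x. \<exists>k. velocity \<gamma> 1 = k *\<^sub>R q}"
      have l: "l \<noteq> 0" using 3 x by auto
      have "s \<in> {0, 1}" using x vertex_iff[of \<gamma> s] 3 by auto
      \<comment> \<open>Nothing would be known about \<open>Min\<close> of an empty set. Tangency of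
        \<open>q\<close> provides a member: the arc itself if \<open>x\<close> is its end, the
        inverse arc if \<open>x\<close> is its start.\<close>
      then have "?A \<noteq> {}"
      proof
        assume "s \<in> {1}"
        then have "\<gamma> \<in> ?A" using x l by (auto simp: arcs_into_def intro!: exI[of _ "inverse l"])
        then show ?thesis by blast
      next
        assume "s = 0"
        then have "velocity (inverse_arc \<gamma>) 1 = (- inverse l) *\<^sub>R q"
          using velocity_inverse_arc[OF x(1), of 1] x l by simp
        then have "\<exists>k. velocity (inverse_arc \<gamma>) 1 = k *\<^sub>R q" ..
        moreover have "inverse_arc \<gamma> \<in> arcs_into E x" using x(3) \<open>s = 0\<close> inverse_arcs[OF x(1)] by (simp add: arcs_into_def)
        ultimately have "inverse_arc \<gamma> \<in> ?A" by simp
        then show ?thesis by blast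
      qed
      moreover have "finite ?A" using finite_arcs by (simp add: arcs_into_def)
      ultimately have "- B \<le> Min ((\<lambda>\<gamma>. lagrangian_along H \<gamma> 1 q) ` ?A)"
        using along by (subst Min_ge_iff) (auto simp: arcs_into_def)
      then show ?thesis using 3 True by (simp add: overall_lagrangian_def)
    qed
  qed (simp add: overall_lagrangian_def)
  with B(1) show thesis by (rule that)
qed

text \<open>The times at which the value of the integrand is known explicitly, and finite. The
  derivative \<open>q\<close> is a parameter so that it can be identified with a density whose
  integrals are the increments of the curve.\<close>

definition regular_time :: "real \<Rightarrow> (real \<Rightarrow> 'a) \<Rightarrow> 'a \<Rightarrow> real \<Rightarrow> bool" where
  "regular_time T \<zeta> q t \<longleftrightarrow> (\<zeta> has_vector_derivative q) (at t) \<and>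
     (if \<zeta> t \<in> vertices E then q = 0 \<and> integrand T \<zeta> t = ereal (c (\<zeta> t))
      else \<exists>\<gamma> \<sigma> l \<delta>. \<gamma> \<in> E \<and> \<delta> > 0 \<and>
       (\<forall>u. \<bar>u - t\<bar> < \<delta> \<longrightarrow> \<sigma> u \<in> {0<..<1} \<and> \<zeta> u = \<gamma> (\<sigma> u)) \<and> (\<sigma> has_real_derivative l) (at t) \<and>
       q = l *\<^sub>R velocity \<gamma> (\<sigma> t) \<and> integrand T \<zeta> t = ereal (lagrangian \<gamma> (\<sigma> t) l))"

lemma regular_time_vertex:
  "regular_time T \<zeta> q t \<Longrightarrow> \<zeta> t \<in> vertices E \<Longrightarrow>
     (\<zeta> has_vector_derivative 0) (at t) \<and> q = 0 \<and> integrand T \<zeta> t = ereal (c (\<zeta> t))"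
  by (auto simp: regular_time_def)

lemma regular_time_arc:
  assumes "regular_time T \<zeta> q t" "\<zeta> t \<notin> vertices E"
  shows "\<exists>\<gamma> \<sigma> l \<delta>. \<gamma> \<in> E \<and> \<delta> > 0 \<and>
       (\<forall>u. \<bar>u - t\<bar> < \<delta> \<longrightarrow> \<sigma> u \<in> {0<..<1} \<and> \<zeta> u = \<gamma> (\<sigma> u)) \<and> (\<sigma> has_real_derivative l) (at t) \<and>
       q = l *\<^sub>R velocity \<gamma> (\<sigma> t) \<and> integrand T \<zeta> t = ereal (lagrangian \<gamma> (\<sigma> t) l)"
  using assms unfolding regular_time_def by simp

text \<open>Two kinds of times are discarded: a null set on which the derivative may fail to exist
  or to agree with \<rho>, and the isolated visits to a vertex, which are countable.\<close>

lemma curve_integrand_AE: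
  fixes \<zeta> :: "real \<Rightarrow> 'a"
  assumes \<zeta>: "abs_continuous_on 0 T \<zeta>" "\<zeta> ` {0..T} \<subseteq> network_set E" and T: "T > 0"
  shows "\<exists>\<rho> N. integrable lborel \<rho> \<and> negligible N \<and>
    (\<forall>a b. 0 \<le> a \<longrightarrow> a \<le> b \<longrightarrow> b \<le> T \<longrightarrow> (\<rho> has_integral (\<zeta> b - \<zeta> a)) {a..b}) \<and>
    (\<forall>t\<in>{0<..<T} - N. regular_time T \<zeta> (\<rho> t) t)"
proof -
  obtain \<rho> N0 where \<rho>: "integrable lborel \<rho>" "negligible N0"
    and ftc: "\<And>a b. 0 \<le> a \<Longrightarrow> a \<le> b \<Longrightarrow> b \<le> T \<Longrightarrow> (\<rho> has_integral (\<zeta> b - \<zeta> a)) {a..b}"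
    and der: "\<And>t. t \<in> {0<..<T} - N0 \<Longrightarrow> (\<zeta> has_vector_derivative \<rho> t) (at t)"
    using abs_continuous_on_derivative[OF \<zeta>(1) T] by blast
  define Z where "Z v = {t \<in> {0<..<T}. \<zeta> t = v}" for v
  define N where "N = N0 \<union> (\<Union>v\<in>vertices E. {x \<in> Z v. \<exists>\<delta>>0. \<forall>y\<in>Z v. \<bar>y - x\<bar> < \<delta> \<longrightarrow> y = x})"
  have "countable (\<Union>v\<in>vertices E. {x \<in> Z v. \<exists>\<delta>>0. \<forall>y\<in>Z v. \<bar>y - x\<bar> < \<delta> \<longrightarrow> y = x})"
    using finite_vertices by (intro countable_UN countable_isolated_points) (rule countable_finite)
  then have "negligible N" unfolding N_def
    using \<rho>(2) by (intro negligible_Un) (simp_all add: countable_imp_null_set_lborel negligible_iff_null_sets null_sets_completionI)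
  have vd: "vector_derivative \<zeta> (at t within {0..T}) = \<rho> t" if "t \<in> {0<..<T} - N" for t
  proof -
    have "(\<zeta> has_vector_derivative \<rho> t) (at t within {0..T})"
      using der[of t] that by (auto simp: N_def intro: has_vector_derivative_at_within)
    then show ?thesis using vector_derivative_within_closed_interval[OF T, of t] that by auto
  qed
  \<comment> \<open>A nonzero derivative keeps the curve away from \<open>\<zeta> t\<close> at
    nearby times, so \<open>t\<close> would be an isolated visit and thus belong to
    \<open>N\<close>.\<close>
  have vert: "\<rho> t = 0" if t: "t \<in> {0<..<T} - N" and v: "\<zeta> t \<in> vertices E" for t
  proof (rule ccontr)
    assume "\<rho> t \<noteq> 0"
    have "(\<zeta> has_derivative (\<lambda>h. h *\<^sub>R \<rho> t)) (at t)"
      using der[of t] t by (auto simp: N_def has_vector_derivative_def)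
    then obtain \<delta> where \<delta>: "\<delta> > 0" "\<And>y. \<bar>y - t\<bar> < \<delta> \<Longrightarrow> norm (\<zeta> y - \<zeta> t - (y - t) *\<^sub>R \<rho> t) \<le> (norm (\<rho> t) / 2) * \<bar>y - t\<bar>"
      using \<open>\<rho> t \<noteq> 0\<close> unfolding has_derivative_within_alt
      by (elim conjE allE[of _ "norm (\<rho> t) / 2"]) auto
    have "y = t" if "y \<in> Z (\<zeta> t)" "\<bar>y - t\<bar> < \<delta>" for y
    proof -
      have "\<bar>y - t\<bar> * norm (\<rho> t) \<le> (norm (\<rho> t) / 2) * \<bar>y - t\<bar>"
        using \<delta>(2)[OF that(2)] that(1) by (simp add: Z_def)
      then have "\<bar>y - t\<bar> * norm (\<rho> t) \<le> 0" by (simp add: mult.commute)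
      then show ?thesis using \<open>\<rho> t \<noteq> 0\<close> by (simp add: mult_le_0_iff)
    qed
    then have "t \<in> N" using t v \<delta>(1) by (auto simp: N_def Z_def)
    then show False using t by simp
  qed
  show ?thesis
  proof (intro exI conjI ballI allI impI)
    show "integrable lborel \<rho>" "negligible N" by fact+
    show "(\<rho> has_integral (\<zeta> b - \<zeta> a)) {a..b}" if "0 \<le> a" "a \<le> b" "b \<le> T" for a b
      using ftc that by blast
  next
    fix t assume t: "t \<in> {0<..<T} - N"
    have der_t: "(\<zeta> has_vector_derivative \<rho> t) (at t)" using der[of t] t by (auto simp: N_def)
    have "\<exists>\<gamma> \<sigma> l \<delta>. \<gamma> \<in> E \<and> \<delta> > 0 \<and>
       (\<forall>u. \<bar>u - t\<bar> < \<delta> \<longrightarrow> \<sigma> u \<in> {0<..<1} \<and> \<zeta> u = \<gamma> (\<sigma> u)) \<and> (\<sigma> has_real_derivative l) (at t) \<and>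
       \<rho> t = l *\<^sub>R velocity \<gamma> (\<sigma> t) \<and> integrand T \<zeta> t = ereal (lagrangian \<gamma> (\<sigma> t) l)"
      if nv: "\<zeta> t \<notin> vertices E"
    proof -
      have "\<zeta> t \<in> network_set E" using \<zeta>(2) t by auto
      then obtain \<gamma> s where s: "\<gamma> \<in> E" "s \<in> {0<..<1}" "\<zeta> t = \<gamma> s" using nv network_cases by blast
      have "t \<in> {0<..<T}" "\<zeta> ` {0<..<T} \<subseteq> network_set E" "(\<zeta> has_vector_derivative \<rho> t) (at t)"
        using t \<zeta>(2) der[of t] by (auto simp: N_def)
      then show ?thesis
      proof (rule arc_coordinate_derivative[of \<gamma> "{0<..<T}" t \<zeta> s "\<rho> t", OF s(1) open_greaterThanLessThan _ _ s(3,2)])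
        fix \<sigma> l \<delta>
        assume \<sigma>: "\<delta> > 0" "\<sigma> t = s" "\<And>u. \<bar>u - t\<bar> < \<delta> \<Longrightarrow> \<sigma> u \<in> {0<..<1} \<and> \<zeta> u = \<gamma> (\<sigma> u)"
          "(\<sigma> has_real_derivative l) (at t)" "\<rho> t = l *\<^sub>R velocity \<gamma> s"
        have "integrand T \<zeta> t = ereal (lagrangian \<gamma> (\<sigma> t) l)"
          using vd[OF t] overall_lagrangian_arc[OF s(1,2), of l] s(3) \<sigma>(2,5) by simp
        then show ?thesis using s(1) \<sigma> by (intro exI[of _ \<gamma>] exI[of _ \<sigma>] exI[of _ l] exI[of _ \<delta>]) simp
      qed
    qed
    then show "regular_time T \<zeta> (\<rho> t) t"
      using der_t vert[OF t] vd[OF t] overall_lagrangian_vertex[of "\<zeta> t"] unfolding regular_time_def by simp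
  qed
qed

end

section \<open>Subsolutions and lower bounds for the action\<close>

text \<open>On the compact set where \<open>f\<close> is nonnegative, \<open>d\<close> has no zero,
  so \<open>f / d\<close> is bounded there; elsewhere \<open>f\<close> is negative. The strict sign
  of \<open>f\<close> on the zeros of \<open>d\<close> is essential: it keeps the quotient from
  blowing up near them.\<close>

lemma dominated_by_distance:
  fixes f d :: "'b::metric_space \<Rightarrow> real"
  assumes S: "compact S" and f: "continuous_on S f" and d: "continuous_on S d"
    and nonneg: "\<And>s. s \<in> S \<Longrightarrow> d s \<ge> 0" and neg: "\<And>s. s \<in> S \<Longrightarrow> d s = 0 \<Longrightarrow> f s < 0"
  shows "\<exists>K. K \<ge> 0 \<and> (\<forall>s\<in>S. f s \<le> K * d s)"
proof -
  define A where "A = S \<inter> f -` {0..}"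
  have "closedin (top_of_set S) A"
    unfolding A_def using f by (rule continuous_closedin_preimage) simp
  then have "compact A" using S closedin_compact by blast
  have pos: "d s > 0" if "s \<in> A" for s
    using nonneg[of s] neg[of s] that by (fastforce simp: A_def less_eq_real_def)
  have "continuous_on A (\<lambda>s. f s / d s)"
  proof (rule continuous_on_divide)
    show "continuous_on A f" "continuous_on A d"
      using continuous_on_subset[OF f, of A] continuous_on_subset[OF d, of A] by (auto simp: A_def)
    show "\<forall>s\<in>A. d s \<noteq> 0" using pos by force
  qed
  then have "bounded ((\<lambda>s. f s / d s) ` A)"
    using \<open>compact A\<close> by (intro compact_imp_bounded compact_continuous_image)
  then obtain K where K: "K > 0" "\<forall>x\<in>(\<lambda>s. f s / d s) ` A. norm x \<le> K" using bounded_pos by metis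
  have "f s \<le> K * d s" if s: "s \<in> S" for s
  proof (cases "s \<in> A")
    case True
    then have "norm (f s / d s) \<le> K" using K(2) by blast
    then have "f s / d s \<le> K" using abs_ge_self[of "f s / d s"] unfolding real_norm_def by linarith
    then show ?thesis using pos[OF True] by (simp add: field_simps)
  next
    case False
    then have "f s < 0" using s by (auto simp: A_def)
    then show ?thesis using mult_nonneg_nonneg[of K "d s"] K(1) nonneg[OF s] by linarith
  qed
  then show ?thesis using K(1) by (intro exI[of _ K]) auto
qed

lemma integrable_lborel_imp_absolutely_integrable:
  fixes g :: "real \<Rightarrow> 'b::euclidean_space"
  assumes "integrable lborel g"
  shows "g absolutely_integrable_on {a..b}"
proof -
  have "integrable lebesgue g" using assms by (simp add: integrable_completion)
  then show ?thesis unfolding set_integrable_def by (intro integrable_mult_indicator) auto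
qed

text \<open>A full period of the cosine is an explicit profile of mean zero with the prescribed
  value \<mu> at \<open>s0\<close>.\<close>

lemma integral_cos_period: "integral {0..1} (\<lambda>s. \<mu> * cos (2 * pi * (s - s0))) = 0"
proof -
  have "((\<lambda>s. \<mu> * cos (2 * pi * (s - s0))) has_integral
     (\<mu> * sin (2 * pi * (1 - s0)) / (2 * pi) - \<mu> * sin (2 * pi * (0 - s0)) / (2 * pi))) {0..1}"
    by (intro fundamental_theorem_of_calculus)
       (auto intro!: derivative_eq_intros simp flip: has_real_derivative_iff_has_vector_derivative)
  moreover have "sin (2 * pi * (1 - s0)) = sin (2 * pi * (0 - s0))"
    using sin_periodic[of "2 * pi * (0 - s0)"] by (simp add: algebra_simps)
  ultimately have "((\<lambda>s. \<mu> * cos (2 * pi * (s - s0))) has_integral 0) {0..1}" by simp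
  then show ?thesis by (rule integral_unique)
qed

context network_lagrangian
begin

text \<open>\<open>p \<gamma>\<close> is the derivative along \<open>\<gamma>\<close> of the potential. The mean value zero makes the potential
  vanish at every vertex, so that its values on different arcs fit together.\<close>

definition momentum_field :: "('a curve \<Rightarrow> real \<Rightarrow> real) \<Rightarrow> bool" where
  "momentum_field p \<longleftrightarrow> (\<forall>\<gamma>\<in>E. continuous_on {0..1} (p \<gamma>) \<and> integral {0..1} (p \<gamma>) = 0 \<and>
     (\<forall>s\<in>{0..1}. p (inverse_arc \<gamma>) s = - p \<gamma> (1 - s)))"

text \<open>A point has several coordinates, on an arc and its inverse or on all arcs at a vertex.
  The choice among them is immaterial for a momentum field, by \<open>potential_arc\<close>.\<close>

definition potential :: "('a curve \<Rightarrow> real \<Rightarrow> real) \<Rightarrow> 'a \<Rightarrow> real" where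
  "potential p x = (SOME y. \<exists>\<gamma>\<in>E. \<exists>s\<in>{0..1}. x = \<gamma> s \<and> y = integral {0..s} (p \<gamma>))"

definition subsolution :: "('a curve \<Rightarrow> real \<Rightarrow> real) \<Rightarrow> ('a \<Rightarrow> real) \<Rightarrow> bool" where
  "subsolution p G \<longleftrightarrow> momentum_field p \<and> continuous_on UNIV G \<and>
     (\<forall>\<gamma>\<in>E. \<forall>s\<in>{0..1}. H \<gamma> s (p \<gamma> s) \<le> G (\<gamma> s)) \<and> (\<forall>v\<in>vertices E. - c v \<le> G v)"

lemma momentum_fieldD:
  assumes "momentum_field p" "\<gamma> \<in> E"
  shows "continuous_on {0..1} (p \<gamma>)" "integral {0..1} (p \<gamma>) = 0"
    "s \<in> {0..1} \<Longrightarrow> p (inverse_arc \<gamma>) s = - p \<gamma> (1 - s)"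
    "\<lbrakk>u \<in> {0..1}; v \<in> {0..1}\<rbrakk> \<Longrightarrow> p \<gamma> integrable_on {u..v}"
  using assms unfolding momentum_field_def
  by (auto intro!: integrable_continuous_interval intro: continuous_on_subset)

text \<open>Integrating along the inverse arc from its own start gives minus the integral over
  \<open>{s..1}\<close>, which mean zero turns into the integral over \<open>{0..s}\<close>. At the
  ends of different arcs both integrals vanish.\<close>

lemma potential_arc:
  assumes p: "momentum_field p" and \<gamma>: "\<gamma> \<in> E" "s \<in> {0..1}"
  shows "potential p (\<gamma> s) = integral {0..s} (p \<gamma>)"
proof -
  have uniq: "integral {0..s'} (p \<gamma>') = integral {0..s} (p \<gamma>)"
    if \<gamma>': "\<gamma>' \<in> E" "s' \<in> {0..1}" "\<gamma> s = \<gamma>' s'" for \<gamma>' s'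
  proof (rule arc_eq_cases[of \<gamma> \<gamma>' s s'])
    assume *: "\<gamma>' = inverse_arc \<gamma>" "s' = 1 - s"
    have "integral {0..s'} (p \<gamma>') = integral {0..1 - s} (\<lambda>u. - p \<gamma> (1 - u))"
      unfolding * using momentum_fieldD(3)[OF p \<gamma>(1)] \<gamma>(2) by (intro integral_cong) auto
    also have "\<dots> = - integral {0..1 - s} (\<lambda>u. p \<gamma> (1 - u))" by simp
    also have "integral {0..1 - s} (\<lambda>u. p \<gamma> (1 - u)) = integral {s..1} (p \<gamma>)"
    proof -
      have "(p \<gamma> has_integral integral {s..1} (p \<gamma>)) (cbox s 1)"
        using momentum_fieldD(4)[OF p \<gamma>(1), of s 1] \<gamma>(2) by (simp add: integrable_integral)
      from has_integral_affinity[OF this, of "- 1" 1]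
      have "((\<lambda>u. p \<gamma> (1 - u)) has_integral integral {s..1} (p \<gamma>)) ((\<lambda>x. - x + 1) ` {s..1})"
        by (simp add: algebra_simps)
      moreover have "(\<lambda>x. - x + 1) ` {s..1} = {0..1 - s}"
        by (auto simp: image_iff intro!: bexI[of _ "1 - x" for x])
      ultimately show ?thesis by (simp add: integral_unique)
    qed
    also have "- integral {s..1} (p \<gamma>) = integral {0..s} (p \<gamma>)"
      using Henstock_Kurzweil_Integration.integral_combine[of 0 s 1 "p \<gamma>"] momentum_fieldD[OF p \<gamma>(1)] \<gamma>(2)
      by (simp add: integrable_continuous_interval)
    finally show ?thesis .
  next
    assume "s \<in> {0, 1}" "s' \<in> {0, 1}"
    then show ?thesis using momentum_fieldD(2)[OF p \<gamma>(1)] momentum_fieldD(2)[OF p \<gamma>'(1)] by auto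
  qed (use \<gamma> \<gamma>' in auto)
  have "\<exists>y. \<exists>\<gamma>'\<in>E. \<exists>s'\<in>{0..1}. \<gamma> s = \<gamma>' s' \<and> y = integral {0..s'} (p \<gamma>')"
    using \<gamma> by blast
  from someI_ex[OF this] show ?thesis
    unfolding potential_def[symmetric] using uniq by auto
qed

lemma potential_vertex: "momentum_field p \<Longrightarrow> v \<in> vertices E \<Longrightarrow> potential p v = 0"
  using potential_arc[of p _ 0] potential_arc[of p _ 1] momentum_fieldD(2)
  by (auto simp: vertices_def)

lemma potential_lipschitz:
  assumes p: "momentum_field p"
  obtains C where "C \<ge> 0"
    "\<And>\<gamma> s s'. \<gamma> \<in> E \<Longrightarrow> s \<in> {0..1} \<Longrightarrow> s' \<in> {0..1} \<Longrightarrow> \<bar>potential p (\<gamma> s) - potential p (\<gamma> s')\<bar> \<le> C * norm (\<gamma> s - \<gamma> s')"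
proof -
  have "bounded (\<Union>\<gamma>\<in>E. p \<gamma> ` {0..1})"
    using finite_arcs momentum_fieldD(1)[OF p]
    by (intro bounded_UN ballI compact_imp_bounded compact_continuous_image) auto
  then obtain M where M: "M > 0" "\<forall>x\<in>(\<Union>\<gamma>\<in>E. p \<gamma> ` {0..1}). norm x \<le> M" using bounded_pos by metis
  obtain \<kappa> where \<kappa>: "\<kappa> > 0" "\<And>\<gamma> s s'. \<gamma> \<in> E \<Longrightarrow> s \<in> {0..1} \<Longrightarrow> s' \<in> {0..1} \<Longrightarrow> \<kappa> * \<bar>s - s'\<bar> \<le> norm (\<gamma> s - \<gamma> s')"
    using bilipschitz by blast
  have le: "\<bar>potential p (\<gamma> s') - potential p (\<gamma> s)\<bar> \<le> M * (s' - s)"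
    if \<gamma>: "\<gamma> \<in> E" and s: "0 \<le> s" "s \<le> s'" "s' \<le> 1" for \<gamma> s s'
  proof -
    have "potential p (\<gamma> s') - potential p (\<gamma> s) = integral {s..s'} (p \<gamma>)"
      using Henstock_Kurzweil_Integration.integral_combine[of 0 s s' "p \<gamma>"] momentum_fieldD(4)[OF p \<gamma>, of 0 s'] s
      by (simp add: potential_arc[OF p \<gamma>])
    moreover have "norm (integral (cbox s s') (p \<gamma>)) \<le> M * measure lborel (cbox s s')"
      using M \<gamma> s by (intro integrable_bound momentum_fieldD(4)[OF p \<gamma>, unfolded cbox_interval[symmetric]]) auto
    ultimately show ?thesis using s by simp
  qed
  have "\<bar>potential p (\<gamma> s) - potential p (\<gamma> s')\<bar> \<le> M / \<kappa> * norm (\<gamma> s - \<gamma> s')"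
    if \<gamma>: "\<gamma> \<in> E" and s: "s \<in> {0..1}" "s' \<in> {0..1}" for \<gamma> s s'
  proof -
    have "\<bar>potential p (\<gamma> s) - potential p (\<gamma> s')\<bar> \<le> M * \<bar>s - s'\<bar>"
      using le[OF \<gamma>, of s s'] le[OF \<gamma>, of s' s] s by (cases "s \<le> s'") (auto simp: abs_minus_commute)
    also have "\<dots> \<le> M * (norm (\<gamma> s - \<gamma> s') / \<kappa>)"
      using \<kappa>(2)[OF \<gamma> s] \<kappa>(1) M(1) by (intro mult_left_mono) (auto simp: field_simps)
    finally show ?thesis by simp
  qed
  moreover have "M / \<kappa> \<ge> 0" using M(1) \<kappa>(1) by simp
  ultimately show thesis by (rule_tac that)
qed

text \<open>On an arc through \<open>v\<close> the potential is Lipschitz and vanishes at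
  \<open>v\<close>; on any other arc the distance to \<open>v\<close> is bounded away from zero and
  the potential is bounded. In this form the estimate holds across all arcs at once.\<close>

lemma potential_near_vertex:
  assumes p: "momentum_field p"
  obtains C where "C \<ge> 0" "\<And>x v. x \<in> network_set E \<Longrightarrow> v \<in> vertices E \<Longrightarrow> \<bar>potential p x\<bar> \<le> C * norm (x - v)"
proof -
  obtain C0 where C0: "C0 \<ge> 0"
    "\<And>\<gamma> s s'. \<gamma> \<in> E \<Longrightarrow> s \<in> {0..1} \<Longrightarrow> s' \<in> {0..1} \<Longrightarrow> \<bar>potential p (\<gamma> s) - potential p (\<gamma> s')\<bar> \<le> C0 * norm (\<gamma> s - \<gamma> s')"
    using potential_lipschitz[OF p] by blast
  have "\<exists>C. C \<ge> 0 \<and> (\<forall>s\<in>{0..1}. \<bar>potential p (\<gamma> s)\<bar> \<le> C * norm (\<gamma> s - v))" if \<gamma>: "\<gamma> \<in> E" and v: "v \<in> vertices E" for \<gamma> v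
  proof (cases "v \<in> \<gamma> ` {0..1}")
    case True
    then obtain s' where "s' \<in> {0..1}" "v = \<gamma> s'" by auto
    then show ?thesis using C0(2)[OF \<gamma> _ \<open>s' \<in> {0..1}\<close>] potential_vertex[OF p v] C0(1) by auto
  next
    case False
    have "continuous_on {0..1} (\<lambda>s. integral {0..s} (p \<gamma>))"
      using momentum_fieldD(4)[OF p \<gamma>, of 0 1] by (intro indefinite_integral_continuous_1) simp
    then have "continuous_on {0..1} (\<lambda>s. potential p (\<gamma> s))"
      by (rule continuous_on_eq) (simp add: potential_arc[OF p \<gamma>])
    then have "continuous_on {0..1} (\<lambda>s. \<bar>potential p (\<gamma> s)\<bar>)" by (intro continuous_on_rabs)
    moreover have "continuous_on {0..1} (\<lambda>s. norm (\<gamma> s - v))"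
      using continuous_arc[OF \<gamma>] by (intro continuous_intros)
    moreover have "\<gamma> s \<noteq> v" if "s \<in> {0..1}" for s using False that by blast
    ultimately show ?thesis by (intro dominated_by_distance) auto
  qed
  then have "\<forall>z\<in>E \<times> vertices E. \<exists>C. C \<ge> 0 \<and> (\<forall>s\<in>{0..1}. \<bar>potential p (fst z s)\<bar> \<le> C * norm (fst z s - snd z))"
    by auto
  from bchoice[OF this] obtain C where C: "\<And>z s. z \<in> E \<times> vertices E \<Longrightarrow> s \<in> {0..1} \<Longrightarrow> \<bar>potential p (fst z s)\<bar> \<le> C z * norm (fst z s - snd z)"
    by blast
  let ?A = "insert 0 (C ` (E \<times> vertices E))"
  have fin: "finite ?A" using finite_arcs finite_vertices by simp
  have "\<bar>potential p x\<bar> \<le> Max ?A * norm (x - v)" if x: "x \<in> network_set E" and v: "v \<in> vertices E" for x v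
  proof -
    obtain \<gamma> s where \<gamma>: "\<gamma> \<in> E" "s \<in> {0..1}" "x = \<gamma> s" using x by (auto simp: network_set_def)
    have "\<bar>potential p x\<bar> \<le> C (\<gamma>, v) * norm (x - v)" using C[of "(\<gamma>, v)" s] \<gamma> v by simp
    also have "\<dots> \<le> Max ?A * norm (x - v)" using fin \<gamma>(1) v by (intro mult_right_mono Max_ge) auto
    finally show ?thesis .
  qed
  moreover have "Max ?A \<ge> 0" using fin by (intro Max_ge) auto
  ultimately show thesis by (rule_tac that)
qed

text \<open>The potential need not be Lipschitz in the Euclidean distance, since two arcs may be tangent at a
  vertex; the detour through the time \<open>w\<close> of a visit to a vertex makes up for this.\<close>

lemma potential_along_curve:
  assumes p: "momentum_field p"
  obtains C where "C > 0" "\<And>\<zeta> (u::real) v. u \<le> v \<Longrightarrow> continuous_on {u..v} \<zeta> \<Longrightarrow> \<zeta> ` {u..v} \<subseteq> network_set E \<Longrightarrow>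
     \<exists>w\<in>{u..v}. \<bar>potential p (\<zeta> v) - potential p (\<zeta> u)\<bar> \<le> C * (norm (\<zeta> w - \<zeta> u) + norm (\<zeta> v - \<zeta> w))"
proof -
  obtain C1 where C1: "C1 \<ge> 0"
    "\<And>\<gamma> s s'. \<gamma> \<in> E \<Longrightarrow> s \<in> {0..1} \<Longrightarrow> s' \<in> {0..1} \<Longrightarrow> \<bar>potential p (\<gamma> s) - potential p (\<gamma> s')\<bar> \<le> C1 * norm (\<gamma> s - \<gamma> s')"
    using potential_lipschitz[OF p] by blast
  obtain C2 where C2: "C2 \<ge> 0" "\<And>x v. x \<in> network_set E \<Longrightarrow> v \<in> vertices E \<Longrightarrow> \<bar>potential p x\<bar> \<le> C2 * norm (x - v)"
    using potential_near_vertex[OF p] by blast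
  define C where "C = C1 + C2 + 1"
  have mono: "C1 * x \<le> C * x" "C2 * x \<le> C * x" if "x \<ge> 0" for x
    using that C1(1) C2(1) by (auto simp: C_def intro!: mult_right_mono)
  have "\<exists>w\<in>{u..v}. \<bar>potential p (\<zeta> v) - potential p (\<zeta> u)\<bar> \<le> C * (norm (\<zeta> w - \<zeta> u) + norm (\<zeta> v - \<zeta> w))"
    if uv: "u \<le> v" and \<zeta>: "continuous_on {u..v} \<zeta>" "\<zeta> ` {u..v} \<subseteq> network_set E" for \<zeta> and u v :: real
  proof (cases "\<exists>w\<in>{u..v}. \<zeta> w \<in> vertices E")
    case True
    then obtain w where w: "w \<in> {u..v}" "\<zeta> w \<in> vertices E" by blast
    have "\<bar>potential p (\<zeta> v)\<bar> \<le> C * norm (\<zeta> v - \<zeta> w)" "\<bar>potential p (\<zeta> u)\<bar> \<le> C * norm (\<zeta> w - \<zeta> u)"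
      using C2(2)[OF _ w(2), of "\<zeta> v"] C2(2)[OF _ w(2), of "\<zeta> u"] \<zeta>(2) uv mono(2)[OF norm_ge_zero]
      by (auto simp: norm_minus_commute image_subset_iff intro: order_trans)
    then show ?thesis using w(1) by (intro bexI[of _ w]) (auto simp: distrib_left)
  next
    case False
    obtain \<gamma> s where \<gamma>: "\<gamma> \<in> E" "s \<in> {0..1}" "\<zeta> u = \<gamma> s" using \<zeta>(2) uv by (force simp: network_set_def)
    have "\<zeta> v \<in> \<gamma> ` {0<..<1}"
    proof (rule ccontr)
      assume "\<zeta> v \<notin> \<gamma> ` {0<..<1}"
      then show False
        using vertex_between[OF \<zeta> \<gamma>(1), of u v] \<gamma>(2,3) uv False by (metis atLeastAtMost_iff imageI order_refl)
    qed
    then obtain s' where "s' \<in> {0<..<1}" and v: "\<zeta> v = \<gamma> s'" by blast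
    then have "s' \<in> {0..1}" by auto
    with v have "\<bar>potential p (\<zeta> v) - potential p (\<zeta> u)\<bar> \<le> C * norm (\<zeta> v - \<zeta> u)"
      using C1(2)[OF \<gamma>(1) \<open>s' \<in> {0..1}\<close> \<gamma>(2)] \<gamma>(3) mono(1)[of "norm (\<zeta> v - \<zeta> u)"] by simp
    then show ?thesis using uv by (intro bexI[of _ u]) auto
  qed
  moreover have "C > 0" using C1(1) C2(1) by (simp add: C_def)
  ultimately show thesis by (rule_tac that)
qed

text \<open>Each interval is cut at the time given by \<open>potential_along_curve\<close>. The left
  and the right parts form two families, each no longer than the original; hence the bound
  \<epsilon> / (2 C) for \<zeta> on either of them.\<close>

lemma abs_continuous_on_potential:
  assumes p: "momentum_field p" and \<zeta>: "abs_continuous_on a b \<zeta>" "\<zeta> ` {a..b} \<subseteq> network_set E"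
  shows "abs_continuous_on a b (\<lambda>t. potential p (\<zeta> t))"
proof (rule abs_continuous_onI)
  fix \<epsilon> :: real assume "\<epsilon> > 0"
  obtain C where C: "C > 0" "\<And>\<zeta> (u::real) v. u \<le> v \<Longrightarrow> continuous_on {u..v} \<zeta> \<Longrightarrow> \<zeta> ` {u..v} \<subseteq> network_set E \<Longrightarrow>
     \<exists>w\<in>{u..v}. \<bar>potential p (\<zeta> v) - potential p (\<zeta> u)\<bar> \<le> C * (norm (\<zeta> w - \<zeta> u) + norm (\<zeta> v - \<zeta> w))"
    using potential_along_curve[OF p] by blast
  have "\<epsilon> / (2 * C) > 0" using C(1) \<open>\<epsilon> > 0\<close> by simp
  then obtain \<delta> where \<delta>: "\<delta> > 0" "\<And>(J :: real set set) c d. interval_family a b J c d \<Longrightarrow> (\<Sum>j\<in>J. d j - c j) < \<delta> \<Longrightarrow>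
        (\<Sum>j\<in>J. norm (\<zeta> (d j) - \<zeta> (c j))) < \<epsilon> / (2 * C)"
    using abs_continuous_onD[OF \<zeta>(1), where 'i = "real set"] by blast
  have cont: "continuous_on {a..b} \<zeta>" using \<zeta>(1) by (rule abs_continuous_on_imp_continuous_on)
  show "\<exists>\<delta>>0. \<forall>J c d. interval_family a b (J :: real set set) c d \<longrightarrow> (\<Sum>j\<in>J. d j - c j) < \<delta> \<longrightarrow>
        (\<Sum>j\<in>J. norm (potential p (\<zeta> (d j)) - potential p (\<zeta> (c j)))) < \<epsilon>"
  proof (intro exI conjI allI impI)
    fix J :: "real set set" and l r
    assume J: "interval_family a b J l r" "(\<Sum>j\<in>J. r j - l j) < \<delta>"
    have le: "a \<le> l j \<and> l j \<le> r j \<and> r j \<le> b" if "j \<in> J" for j using J(1) that by (auto simp: interval_family_def)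
    have "\<exists>w\<in>{l j..r j}. \<bar>potential p (\<zeta> (r j)) - potential p (\<zeta> (l j))\<bar> \<le> C * (norm (\<zeta> w - \<zeta> (l j)) + norm (\<zeta> (r j) - \<zeta> w))"
      if "j \<in> J" for j
    proof -
      have "{l j..r j} \<subseteq> {a..b}" using le[OF that] by auto
      then show ?thesis
        using le[OF that] \<zeta>(2) by (intro C(2) continuous_on_subset[OF cont]) auto
    qed
    then have "\<forall>j\<in>J. \<exists>w. w \<in> {l j..r j} \<and> \<bar>potential p (\<zeta> (r j)) - potential p (\<zeta> (l j))\<bar> \<le> C * (norm (\<zeta> w - \<zeta> (l j)) + norm (\<zeta> (r j) - \<zeta> w))"
      by blast
    from bchoice[OF this] obtain w where w: "\<And>j. j \<in> J \<Longrightarrow> w j \<in> {l j..r j}"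
      "\<And>j. j \<in> J \<Longrightarrow> \<bar>potential p (\<zeta> (r j)) - potential p (\<zeta> (l j))\<bar> \<le> C * (norm (\<zeta> (w j) - \<zeta> (l j)) + norm (\<zeta> (r j) - \<zeta> (w j)))"
      by blast
    have "(\<Sum>j\<in>J. w j - l j) \<le> (\<Sum>j\<in>J. r j - l j)" "(\<Sum>j\<in>J. r j - w j) \<le> (\<Sum>j\<in>J. r j - l j)"
      using w(1) by (auto intro!: sum_mono)
    moreover have "interval_family a b J l w" "interval_family a b J w r"
      using w(1) by (auto intro!: interval_family_shrink[OF J(1)])
    ultimately have "(\<Sum>j\<in>J. norm (\<zeta> (w j) - \<zeta> (l j))) < \<epsilon> / (2 * C)" "(\<Sum>j\<in>J. norm (\<zeta> (r j) - \<zeta> (w j))) < \<epsilon> / (2 * C)"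
      using J(2) by (auto intro!: \<delta>(2))
    then have "(\<Sum>j\<in>J. norm (\<zeta> (w j) - \<zeta> (l j))) + (\<Sum>j\<in>J. norm (\<zeta> (r j) - \<zeta> (w j))) < \<epsilon> / C"
      by (simp add: field_simps)
    then have "C * ((\<Sum>j\<in>J. norm (\<zeta> (w j) - \<zeta> (l j))) + (\<Sum>j\<in>J. norm (\<zeta> (r j) - \<zeta> (w j)))) < \<epsilon>"
      using C(1) by (simp add: field_simps)
    moreover have "(\<Sum>j\<in>J. norm (potential p (\<zeta> (r j)) - potential p (\<zeta> (l j)))) \<le>
       (\<Sum>j\<in>J. C * (norm (\<zeta> (w j) - \<zeta> (l j)) + norm (\<zeta> (r j) - \<zeta> (w j))))"
      using w(2) by (intro sum_mono) simp
    ultimately show "(\<Sum>j\<in>J. norm (potential p (\<zeta> (r j)) - potential p (\<zeta> (l j)))) < \<epsilon>"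
      unfolding sum_distrib_left[symmetric] sum.distrib by linarith
  qed (rule \<delta>(1))
qed

text \<open>The potential is at most a constant times the distance to the vertex, and that distance
  is o(|u - t|), whichever arcs the curve visits near time \<open>t\<close>.\<close>

lemma potential_derivative_vertex:
  fixes \<zeta> :: "real \<Rightarrow> 'a"
  assumes p: "momentum_field p" and S: "open S" "t \<in> S" "\<zeta> ` S \<subseteq> network_set E"
    and v: "\<zeta> t \<in> vertices E" "(\<zeta> has_vector_derivative 0) (at t)"
  shows "((\<lambda>t. potential p (\<zeta> t)) has_real_derivative 0) (at t)"
proof -
  obtain C where C: "C \<ge> 0" "\<And>x v. x \<in> network_set E \<Longrightarrow> v \<in> vertices E \<Longrightarrow> \<bar>potential p x\<bar> \<le> C * norm (x - v)"
    using potential_near_vertex[OF p] by blast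
  have "((\<lambda>u. (\<zeta> u - \<zeta> t) /\<^sub>R \<bar>u - t\<bar>) \<longlongrightarrow> 0) (at t)"
    using v(2) by (simp add: has_vector_derivative_def has_derivative_at_within)
  then have "((\<lambda>u. C * norm ((\<zeta> u - \<zeta> t) /\<^sub>R \<bar>u - t\<bar>)) \<longlongrightarrow> 0) (at t)"
    by (intro tendsto_mult_right_zero tendsto_norm_zero)
  moreover have "\<forall>\<^sub>F u in at t. norm ((potential p (\<zeta> u) - potential p (\<zeta> t)) / (u - t)) \<le> C * norm ((\<zeta> u - \<zeta> t) /\<^sub>R \<bar>u - t\<bar>)"
  proof -
    have "\<forall>\<^sub>F u in at t. u \<in> S" using S by (simp add: eventually_at_topological) blast
    then show ?thesis
    proof eventually_elim
      case (elim u)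
      then have "\<bar>potential p (\<zeta> u)\<bar> \<le> C * norm (\<zeta> u - \<zeta> t)" using C(2)[OF _ v(1)] S(3) by auto
      then have "\<bar>potential p (\<zeta> u)\<bar> * inverse \<bar>u - t\<bar> \<le> C * norm (\<zeta> u - \<zeta> t) * inverse \<bar>u - t\<bar>"
        by (intro mult_right_mono) auto
      then show ?case using potential_vertex[OF p v(1)] by (simp add: divide_inverse abs_mult ac_simps)
    qed
  qed
  ultimately have "((\<lambda>u. (potential p (\<zeta> u) - potential p (\<zeta> t)) / (u - t)) \<longlongrightarrow> 0) (at t)"
    by (rule Lim_null_comparison[rotated])
  then show ?thesis by (simp add: has_field_derivative_iff)
qed

lemma potential_derivative_arc:
  assumes p: "momentum_field p" and \<gamma>: "\<gamma> \<in> E" and "\<delta> > 0"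
    and \<sigma>: "\<And>u. \<bar>u - t\<bar> < \<delta> \<Longrightarrow> \<sigma> u \<in> {0<..<1} \<and> \<zeta> u = \<gamma> (\<sigma> u)" "(\<sigma> has_real_derivative l) (at t)"
  shows "((\<lambda>t. potential p (\<zeta> t)) has_real_derivative p \<gamma> (\<sigma> t) * l) (at t)"
proof -
  have st: "\<sigma> t \<in> {0<..<1}" using \<sigma>(1)[of t] \<open>\<delta> > 0\<close> by simp
  have "((\<lambda>s. integral {0..s} (p \<gamma>)) has_real_derivative p \<gamma> (\<sigma> t)) (at (\<sigma> t) within {0..1})"
    using momentum_fieldD(1)[OF p \<gamma>] st by (intro integral_has_real_derivative) auto
  then have "((\<lambda>s. integral {0..s} (p \<gamma>)) has_real_derivative p \<gamma> (\<sigma> t)) (at (\<sigma> t))"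
    using st at_within_Icc_at[of 0 "\<sigma> t" 1] by auto
  then have "((\<lambda>u. integral {0..\<sigma> u} (p \<gamma>)) has_real_derivative p \<gamma> (\<sigma> t) * l) (at t)"
    using \<sigma>(2) by (rule DERIV_chain2)
  moreover have ev: "\<forall>\<^sub>F u in nhds t. integral {0..\<sigma> u} (p \<gamma>) = potential p (\<zeta> u)"
    unfolding eventually_nhds_metric dist_real_def
  proof (intro exI[of _ \<delta>] conjI allI impI)
    fix u assume "\<bar>u - t\<bar> < \<delta>"
    then have "\<sigma> u \<in> {0..1}" "\<zeta> u = \<gamma> (\<sigma> u)" using \<sigma>(1)[of u] by auto
    then show "integral {0..\<sigma> u} (p \<gamma>) = potential p (\<zeta> u)" using potential_arc[OF p \<gamma>] by simp
  qed (rule \<open>\<delta> > 0\<close>)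
  ultimately show ?thesis using DERIV_cong_ev[OF refl ev refl] by simp
qed

text \<open>At almost every time on an arc the derivative of the potential is momentum times speed,
  and Fenchel's inequality bounds it by Lagrangian plus Hamiltonian, hence by integrand plus
  \<open>G\<close>. At a vertex it is zero and \<open>- G \<le> c\<close> is enough. Integration
  gives the bound.\<close>

lemma action_ge_subsolution:
  fixes \<zeta> :: "real \<Rightarrow> 'a"
  assumes pG: "subsolution p G" and \<zeta>: "abs_continuous_on 0 T \<zeta>" "\<zeta> ` {0..T} \<subseteq> network_set E"
    and T: "T > 0" and ab: "0 \<le> a" "a \<le> b" "b \<le> T"
  shows "ereal (potential p (\<zeta> b) - potential p (\<zeta> a) - integral {a..b} (\<lambda>t. G (\<zeta> t))) \<le> ereal_integral a b (integrand T \<zeta>)"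
proof -
  have p: "momentum_field p" and G: "continuous_on UNIV G" "\<And>\<gamma> s. \<gamma> \<in> E \<Longrightarrow> s \<in> {0..1} \<Longrightarrow> H \<gamma> s (p \<gamma> s) \<le> G (\<gamma> s)"
    "\<And>v. v \<in> vertices E \<Longrightarrow> - c v \<le> G v"
    using pG unfolding subsolution_def by auto
  obtain \<rho> N where N: "negligible N" "\<forall>t\<in>{0<..<T} - N. regular_time T \<zeta> (\<rho> t) t"
    using curve_integrand_AE[OF \<zeta> T] by (elim exE conjE)
  have "abs_continuous_on 0 T (\<lambda>t. potential p (\<zeta> t))" by (rule abs_continuous_on_potential[OF p \<zeta>])
  then obtain g N' where g: "integrable lborel g" "negligible N'"
    "\<And>a b. 0 \<le> a \<Longrightarrow> a \<le> b \<Longrightarrow> b \<le> T \<Longrightarrow> (g has_integral (potential p (\<zeta> b) - potential p (\<zeta> a))) {a..b}"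
    "\<And>t. t \<in> {0<..<T} - N' \<Longrightarrow> ((\<lambda>t. potential p (\<zeta> t)) has_real_derivative g t) (at t)"
    using abs_continuous_on_derivative_real[OF _ T] by blast
  have le: "ereal (g t - G (\<zeta> t)) \<le> integrand T \<zeta> t" if t: "t \<in> {0<..<T} - (N \<union> N' \<union> {0, T})" for t
  proof (cases "\<zeta> t \<in> vertices E")
    case True
    have "((\<lambda>t. potential p (\<zeta> t)) has_real_derivative 0) (at t)"
      using t \<zeta>(2) True regular_time_vertex[OF N(2)[rule_format, of t] True]
      by (intro potential_derivative_vertex[OF p, of "{0<..<T}"]) auto
    moreover have "((\<lambda>t. potential p (\<zeta> t)) has_real_derivative g t) (at t)" using g(4) t by simp
    ultimately have "g t = 0" by (rule DERIV_unique[symmetric])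
    then show ?thesis using regular_time_vertex[OF N(2)[rule_format, of t] True] t G(3)[OF True] by simp
  next
    case False
    have "regular_time T \<zeta> (\<rho> t) t" using N(2) t by simp
    from regular_time_arc[OF this False]
    obtain \<gamma> \<sigma> l \<delta> where *: "\<gamma> \<in> E" "\<delta> > 0" "\<forall>u. \<bar>u - t\<bar> < \<delta> \<longrightarrow> \<sigma> u \<in> {0<..<1} \<and> \<zeta> u = \<gamma> (\<sigma> u)"
      "(\<sigma> has_real_derivative l) (at t)" "integrand T \<zeta> t = ereal (lagrangian \<gamma> (\<sigma> t) l)"
      by (elim exE conjE)
    note * = *(1,2) *(3)[rule_format] *(4,5)
    have "((\<lambda>t. potential p (\<zeta> t)) has_real_derivative p \<gamma> (\<sigma> t) * l) (at t)"
      by (rule potential_derivative_arc[OF p *(1-4)])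
    moreover have "((\<lambda>t. potential p (\<zeta> t)) has_real_derivative g t) (at t)" using g(4) t by simp
    ultimately have gt: "p \<gamma> (\<sigma> t) * l = g t" by (rule DERIV_unique)
    have st: "\<sigma> t \<in> {0..1}" "\<zeta> t = \<gamma> (\<sigma> t)" using *(3)[of t] *(2) by auto
    then have "g t - G (\<zeta> t) \<le> lagrangian \<gamma> (\<sigma> t) l"
      using lagrangian_ge[OF *(1) st(1), of l "p \<gamma> (\<sigma> t)"] G(2)[OF *(1) st(1)] gt by (simp add: mult.commute)
    then show ?thesis using *(5) by simp
  qed
  have int_g: "g absolutely_integrable_on {a..b}"
    using g(1) by (rule integrable_lborel_imp_absolutely_integrable)
  have "continuous_on {a..b} (\<lambda>t. G (\<zeta> t))"
    using continuous_on_subset[OF abs_continuous_on_imp_continuous_on[OF \<zeta>(1)], of "{a..b}"] ab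
    by (intro continuous_on_compose2[OF G(1)]) auto
  then have int_G: "(\<lambda>t. G (\<zeta> t)) absolutely_integrable_on {a..b}"
    by (rule absolutely_integrable_continuous_real)
  have "AE t in lebesgue_on {a..b}. ereal (g t - G (\<zeta> t)) \<le> integrand T \<zeta> t"
  proof -
    have "negligible (N \<union> N' \<union> {0, T})" using N(1) g(2) by simp
    then have "N \<union> N' \<union> {0, T} \<in> null_sets lebesgue" by (simp add: negligible_iff_null_sets)
    then have "AE t in lebesgue. t \<notin> N \<union> N' \<union> {0, T}" by (rule AE_not_in)
    then have "AE t in lebesgue. t \<in> {a..b} \<longrightarrow> ereal (g t - G (\<zeta> t)) \<le> integrand T \<zeta> t"
      by (rule eventually_mono) (use le ab in auto)
    then show ?thesis by (simp add: AE_restrict_space_iff)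
  qed
  then have "ereal_integral a b (\<lambda>t. ereal (g t - G (\<zeta> t))) \<le> ereal_integral a b (integrand T \<zeta>)"
    by (rule ereal_integral_mono_AE)
  also have "ereal_integral a b (\<lambda>t. ereal (g t - G (\<zeta> t))) = ereal (integral {a..b} (\<lambda>t. g t - G (\<zeta> t)))"
    using int_g int_G by (intro ereal_integral_real set_integral_diff)
  also have "integral {a..b} (\<lambda>t. g t - G (\<zeta> t)) = potential p (\<zeta> b) - potential p (\<zeta> a) - integral {a..b} (\<lambda>t. G (\<zeta> t))"
    using g(3)[OF ab] int_G
    by (subst Henstock_Kurzweil_Integration.integral_diff) (auto simp: integral_unique set_lebesgue_integral_eq_integral)
  finally show ?thesis .
qed

text \<open>\<open>F\<close> contains one member of each inverse pair that can meet
  \<open>R\<close>; \<open>q\<close> is reflected to the inverses and replaced by zero on all other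
  arcs. The inequalities are strict on \<open>R\<close>, so by \<open>dominated_by_distance\<close>
  any excess over \<open>g0\<close> is at most a multiple of the distance to \<open>R\<close>, and
  this multiple is added to \<open>G\<close>.\<close>

lemma subsolution_exists:
  assumes R: "compact R" "R \<noteq> {}" and F: "F \<subseteq> E" "\<And>\<gamma>. \<gamma> \<in> F \<Longrightarrow> inverse_arc \<gamma> \<notin> F"
    and q: "\<And>\<gamma>. \<gamma> \<in> F \<Longrightarrow> continuous_on {0..1} (q \<gamma>)" "\<And>\<gamma>. \<gamma> \<in> F \<Longrightarrow> integral {0..1} (q \<gamma>) = 0"
    and H: "\<And>\<gamma> s. \<gamma> \<in> F \<Longrightarrow> s \<in> {0..1} \<Longrightarrow> \<gamma> s \<in> R \<Longrightarrow> H \<gamma> s (q \<gamma> s) < g0"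
    and off: "\<And>\<gamma> s. \<gamma> \<in> E \<Longrightarrow> \<gamma> \<notin> F \<Longrightarrow> inverse_arc \<gamma> \<notin> F \<Longrightarrow> s \<in> {0..1} \<Longrightarrow> \<gamma> s \<notin> R"
    and vert: "\<And>v. v \<in> vertices E \<Longrightarrow> v \<in> R \<Longrightarrow> - c v < g0"
  obtains p G where "subsolution p G" "\<And>\<gamma>. \<gamma> \<in> F \<Longrightarrow> p \<gamma> = q \<gamma>" "\<And>x. x \<in> R \<Longrightarrow> G x = g0"
proof -
  define p where "p \<gamma> = (if \<gamma> \<in> F then q \<gamma> else if inverse_arc \<gamma> \<in> F then (\<lambda>s. - q (inverse_arc \<gamma>) (1 - s)) else (\<lambda>s. 0))" for \<gamma>
  have q_rev: "continuous_on {0..1} (\<lambda>s. q \<gamma> (1 - s))" "integral {0..1} (\<lambda>s. q \<gamma> (1 - s)) = 0" if "\<gamma> \<in> F" for \<gamma>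
  proof -
    show "continuous_on {0..1} (\<lambda>s. q \<gamma> (1 - s))"
      by (rule continuous_on_compose2[OF q(1)[OF that]]) (auto intro!: continuous_intros)
    have "(q \<gamma> has_integral 0) (cbox 0 1)"
      using q(2)[OF that] integrable_continuous_interval[OF q(1)[OF that]] by (simp add: has_integral_iff)
    from has_integral_affinity[OF this, of "- 1" 1]
    have "((\<lambda>u. q \<gamma> (1 - u)) has_integral 0) ((\<lambda>x. - x + 1) ` {0..1})"
      by (simp add: algebra_simps)
    moreover have "(\<lambda>x::real. - x + 1) ` {0..1} = {0..1}"
      by (auto simp: image_iff intro!: bexI[of _ "1 - x" for x])
    ultimately show "integral {0..1} (\<lambda>s. q \<gamma> (1 - s)) = 0" by (simp add: integral_unique)
  qed
  have p: "momentum_field p"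
    unfolding momentum_field_def
  proof (intro ballI conjI)
    fix \<gamma> assume \<gamma>: "\<gamma> \<in> E"
    show "continuous_on {0..1} (p \<gamma>)" using q(1) q_rev(1) by (auto simp: p_def intro: continuous_on_minus)
    show "integral {0..1} (p \<gamma>) = 0" using q(2) q_rev(2) by (auto simp: p_def)
    show "p (inverse_arc \<gamma>) s = - p \<gamma> (1 - s)" for s
      using F(2)[of \<gamma>] F(2)[of "inverse_arc \<gamma>"] \<gamma> by (auto simp: p_def)
  qed
  have Hp: "H \<gamma> s (p \<gamma> s) < g0" if \<gamma>: "\<gamma> \<in> E" "s \<in> {0..1}" "\<gamma> s \<in> R" for \<gamma> s
  proof -
    consider "\<gamma> \<in> F" | "\<gamma> \<notin> F" "inverse_arc \<gamma> \<in> F" using off[OF \<gamma>(1) _ _ \<gamma>(2)] \<gamma>(3) by blast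
    then show ?thesis
    proof cases
      case 1 then show ?thesis using H[OF 1 \<gamma>(2,3)] by (simp add: p_def)
    next
      case 2
      have "1 - s \<in> {0..1}" using \<gamma>(2) by auto
      moreover from this have "inverse_arc \<gamma> (1 - s) = \<gamma> s" by simp
      ultimately show ?thesis
        using H[OF 2(2), of "1 - s"] H_inverse_arc[OF \<gamma>(1), of "1 - s" "q (inverse_arc \<gamma>) (1 - s)"] \<gamma>(3) 2
        by (simp add: p_def)
    qed
  qed
  have cont_d: "continuous_on S (\<lambda>x. infdist x R)" for S by (intro continuous_intros)
  have R0: "infdist x R = 0 \<longleftrightarrow> x \<in> R" for x
    using in_closed_iff_infdist_zero[OF compact_imp_closed[OF R(1)] R(2)] by simp
  have "\<exists>K. K \<ge> 0 \<and> (\<forall>s\<in>{0..1}. H \<gamma> s (p \<gamma> s) - g0 \<le> K * infdist (\<gamma> s) R)" if \<gamma>: "\<gamma> \<in> E" for \<gamma>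
  proof -
    have "continuous_on {0..1} (\<lambda>s. H \<gamma> s (p \<gamma> s))"
      using momentum_fieldD(1)[OF p \<gamma>]
      by (intro continuous_on_compose2[OF H_continuous[OF \<gamma>], of _ "\<lambda>s. (s, p \<gamma> s)", simplified]) (auto intro!: continuous_intros)
    then have "continuous_on {0..1} (\<lambda>s. H \<gamma> s (p \<gamma> s) - g0)" by (intro continuous_intros)
    moreover have "continuous_on {0..1} (\<lambda>s. infdist (\<gamma> s) R)" using continuous_arc[OF \<gamma>] by (intro continuous_intros)
    moreover have "H \<gamma> s (p \<gamma> s) - g0 < 0" if "s \<in> {0..1}" "infdist (\<gamma> s) R = 0" for s
      using Hp[OF \<gamma> that(1)] that(2) R0 by simp
    ultimately show ?thesis by (intro dominated_by_distance) (auto simp: infdist_nonneg)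
  qed
  then have "\<forall>\<gamma>\<in>E. \<exists>K. K \<ge> 0 \<and> (\<forall>s\<in>{0..1}. H \<gamma> s (p \<gamma> s) - g0 \<le> K * infdist (\<gamma> s) R)" ..
  from bchoice[OF this] obtain K where K: "\<And>\<gamma> s. \<gamma> \<in> E \<Longrightarrow> s \<in> {0..1} \<Longrightarrow> H \<gamma> s (p \<gamma> s) - g0 \<le> K \<gamma> * infdist (\<gamma> s) R"
    by blast
  \<comment> \<open>The vertices form a finite, hence compact, set, on which every function is
    continuous; the same domination lemma applies to them.\<close>
  have "\<exists>K'. K' \<ge> 0 \<and> (\<forall>v\<in>vertices E. - c v - g0 \<le> K' * infdist v R)"
  proof (rule dominated_by_distance)
    show "- c v - g0 < 0" if "v \<in> vertices E" "infdist v R = 0" for v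
      using vert[OF that(1)] that(2) R0 by simp
  qed (use cont_d finite_vertices in \<open>auto simp: infdist_nonneg intro: finite_imp_compact continuous_on_finite\<close>)
  then obtain K' where K': "K' \<ge> 0" "\<And>v. v \<in> vertices E \<Longrightarrow> - c v - g0 \<le> K' * infdist v R" by blast
  define M where "M = Max (insert K' (K ` E))"
  have M: "K' \<le> M" "\<And>\<gamma>. \<gamma> \<in> E \<Longrightarrow> K \<gamma> \<le> M" unfolding M_def using finite_arcs by (auto intro: Max_ge)
  define G where "G x = g0 + M * infdist x R" for x
  have "subsolution p G"
    unfolding subsolution_def
  proof (intro conjI ballI p)
    show "continuous_on UNIV G" unfolding G_def by (intro continuous_intros)
    show "H \<gamma> s (p \<gamma> s) \<le> G (\<gamma> s)" if "\<gamma> \<in> E" "s \<in> {0..1}" for \<gamma> s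
      using K[OF that] mult_right_mono[OF M(2)[OF that(1)] infdist_nonneg[of "\<gamma> s" R]] by (simp add: G_def)
    show "- c v \<le> G v" if "v \<in> vertices E" for v
      using K'(2)[OF that] mult_right_mono[OF M(1) infdist_nonneg[of v R]] by (simp add: G_def)
  qed
  moreover have "p \<gamma> = q \<gamma>" if "\<gamma> \<in> F" for \<gamma> using that by (simp add: p_def)
  moreover have "G x = g0" if "x \<in> R" for x using that R0[of x] by (simp add: G_def)
  ultimately show thesis by (rule_tac that)
qed

text \<open>Only the arc and its inverse pass through the point, so the momentum there may be
  prescribed freely; the cosine profile is centred at \<open>s\<close>.\<close>

lemma subsolution_interior:
  assumes \<gamma>: "\<gamma> \<in> E" and s: "s \<in> {0<..<1}" and g0: "H \<gamma> s \<mu> < g0"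
  obtains p G where "subsolution p G" "p \<gamma> s = \<mu>" "G (\<gamma> s) = g0"
proof -
  note result = that
  have s': "s \<in> {0..1}" using s by auto
  have other: "\<gamma>' = \<gamma> \<and> r = s \<or> \<gamma>' = inverse_arc \<gamma>" if "\<gamma>' \<in> E" "r \<in> {0..1}" "\<gamma>' r = \<gamma> s" for \<gamma>' r
    by (rule arc_eq_cases[of \<gamma> \<gamma>' s r]) (use \<gamma> s s' that in auto)
  show thesis
  proof (rule subsolution_exists[of "{\<gamma> s}" "{\<gamma>}" "\<lambda>_ r. \<mu> * cos (2 * pi * (r - s))" g0])
    show "inverse_arc \<gamma>' \<notin> {\<gamma>}" if "\<gamma>' \<in> {\<gamma>}" for \<gamma>' using that inverse_arc_neq[OF \<gamma>] by auto
    show "\<gamma>' r \<notin> {\<gamma> s}" if "\<gamma>' \<in> E" "\<gamma>' \<notin> {\<gamma>}" "inverse_arc \<gamma>' \<notin> {\<gamma>}" "r \<in> {0..1}" for \<gamma>' r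
      using other[OF that(1,4)] that inverse_arc_inverse[OF \<gamma>] by auto
    show "H \<gamma>' r (\<mu> * cos (2 * pi * (r - s))) < g0" if "\<gamma>' \<in> {\<gamma>}" "r \<in> {0..1}" "\<gamma>' r \<in> {\<gamma> s}" for \<gamma>' r
      using that arc_inj[OF \<gamma> _ s', of r] g0 by auto
    show "- c v < g0" if "v \<in> vertices E" "v \<in> {\<gamma> s}" for v
      using that vertex_iff[OF \<gamma> s'] s by auto
    show thesis if "subsolution p G" "\<And>\<gamma>'. \<gamma>' \<in> {\<gamma>} \<Longrightarrow> p \<gamma>' = (\<lambda>r. \<mu> * cos (2 * pi * (r - s)))" "\<And>x. x \<in> {\<gamma> s} \<Longrightarrow> G x = g0" for p G
    proof (rule result[OF that(1)])
      show "p \<gamma> s = \<mu>" using that(2)[of \<gamma>] by simp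
      show "G (\<gamma> s) = g0" by (rule that(3)) simp
    qed
  qed (use \<gamma> integral_cos_period in \<open>auto intro!: continuous_intros\<close>)
qed

text \<open>These are the conditions on \<open>F\<close> in \<open>subsolution_exists\<close> for
  sets \<open>R\<close> around a vertex: in the absence of loops, exactly one member of each inverse
  pair at \<open>v\<close> ends in \<open>v\<close>.\<close>

lemma arcs_into_properties:
  shows "arcs_into E v \<subseteq> E" "\<gamma> \<in> arcs_into E v \<Longrightarrow> inverse_arc \<gamma> \<notin> arcs_into E v"
    "\<gamma> \<in> E \<Longrightarrow> \<gamma> \<notin> arcs_into E v \<Longrightarrow> inverse_arc \<gamma> \<notin> arcs_into E v \<Longrightarrow> v \<in> vertices E \<Longrightarrow> s \<in> {0..1} \<Longrightarrow> \<gamma> s \<noteq> v"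
proof -
  show "arcs_into E v \<subseteq> E" by (auto simp: arcs_into_def)
  show "\<gamma> \<in> arcs_into E v \<Longrightarrow> inverse_arc \<gamma> \<notin> arcs_into E v"
    using no_loops[of \<gamma>] by (auto simp: arcs_into_def)
  assume *: "\<gamma> \<in> E" "\<gamma> \<notin> arcs_into E v" "inverse_arc \<gamma> \<notin> arcs_into E v" "v \<in> vertices E" "s \<in> {0..1}"
  then have "\<gamma> 1 \<noteq> v" "\<gamma> 0 \<noteq> v" using inverse_arcs[of \<gamma>] by (auto simp: arcs_into_def)
  then show "\<gamma> s \<noteq> v" using vertex_iff[of \<gamma> s] * by auto
qed

text \<open>Every arc into \<open>v\<close> gets its own momentum at its end, supplied by the flux
  limiter. No matching between the arcs is necessary, since the potential vanishes at
  \<open>v\<close> from every side.\<close>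

lemma subsolution_vertex:
  assumes v: "v \<in> vertices E" and g0: "- c v < g0"
  obtains p G where "subsolution p G" "G v = g0"
proof -
  note result = that
  have "\<exists>\<mu>. H \<gamma> 1 \<mu> < g0" if "\<gamma> \<in> arcs_into E v" for \<gamma>
    using flux_limiter_subsolution[of \<gamma> v 1 "g0 + c v"] that g0 by (auto simp: arcs_into_def)
  then have "\<forall>\<gamma>\<in>arcs_into E v. \<exists>\<mu>. H \<gamma> 1 \<mu> < g0" ..
  from bchoice[OF this] obtain \<mu> where \<mu>: "\<And>\<gamma>. \<gamma> \<in> arcs_into E v \<Longrightarrow> H \<gamma> 1 (\<mu> \<gamma>) < g0" by blast
  show thesis
  proof (rule subsolution_exists[of "{v}" "arcs_into E v" "\<lambda>\<gamma> r. \<mu> \<gamma> * cos (2 * pi * (r - 1))" g0])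
    show "H \<gamma> s (\<mu> \<gamma> * cos (2 * pi * (s - 1))) < g0" if "\<gamma> \<in> arcs_into E v" "s \<in> {0..1}" "\<gamma> s \<in> {v}" for \<gamma> s
    proof -
      have "\<gamma> \<in> E" "\<gamma> s = \<gamma> 1" using that by (auto simp: arcs_into_def)
      then have "s = 1" using arc_inj[of \<gamma> s 1] that by auto
      then show ?thesis using \<mu>[OF that(1)] by simp
    qed
    show thesis if "subsolution p G" "\<And>x. x \<in> {v} \<Longrightarrow> G x = g0" for p G
      by (rule result[OF that(1)]) (rule that(2), simp)
    show "compact {v}" "{v} \<noteq> {}" by auto
    show "arcs_into E v \<subseteq> E" by (rule arcs_into_properties(1))
    show "inverse_arc \<gamma> \<notin> arcs_into E v" if "\<gamma> \<in> arcs_into E v" for \<gamma>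
      using that by (rule arcs_into_properties(2))
    show "continuous_on {0..1} (\<lambda>r. \<mu> \<gamma> * cos (2 * pi * (r - 1)))" for \<gamma>
      by (intro continuous_intros)
    show "integral {0..1} (\<lambda>r. \<mu> \<gamma> * cos (2 * pi * (r - 1))) = 0" for \<gamma>
      by (rule integral_cos_period)
    show "\<gamma> s \<notin> {v}" if "\<gamma> \<in> E" "\<gamma> \<notin> arcs_into E v" "inverse_arc \<gamma> \<notin> arcs_into E v" "s \<in> {0..1}" for \<gamma> s
      using arcs_into_properties(3)[OF that(1-3) v that(4)] by simp
    show "- c w < g0" if "w \<in> vertices E" "w \<in> {v}" for w using that g0 by simp
  qed
qed

end

section \<open>Lower semicontinuity of the action\<close>

context network_lagrangian
begin

lemma continuous_on_potential:
  assumes p: "momentum_field p"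
  shows "continuous_on (network_set E) (potential p)"
  unfolding network_set_def
proof (rule continuous_on_closed_Union)
  show "finite E" by (rule finite_arcs)
  show "closed (\<gamma> ` {0..1})" if "\<gamma> \<in> E" for \<gamma> using compact_arc[OF that] by (rule compact_imp_closed)
  fix \<gamma> assume \<gamma>: "\<gamma> \<in> E"
  obtain C where C: "C \<ge> 0"
    "\<And>\<gamma> s s'. \<gamma> \<in> E \<Longrightarrow> s \<in> {0..1} \<Longrightarrow> s' \<in> {0..1} \<Longrightarrow> \<bar>potential p (\<gamma> s) - potential p (\<gamma> s')\<bar> \<le> C * norm (\<gamma> s - \<gamma> s')"
    using potential_lipschitz[OF p] by blast
  have "C-lipschitz_on (\<gamma> ` {0..1}) (potential p)"
    using C(1) C(2)[OF \<gamma>] by (intro lipschitz_onI) (auto simp: dist_norm)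
  then show "continuous_on (\<gamma> ` {0..1}) (potential p)" by (rule lipschitz_on_continuous_on)
qed

text \<open>The zero potential with a constant \<open>G\<close> serves as the default on cells where
  nothing better is wanted; its constant also makes the cellwise bounds nonnegative after a
  shift.\<close>

lemma trivial_subsolution:
  obtains B where "B \<ge> 0" "subsolution (\<lambda>_ _. 0) (\<lambda>_. B)"
proof -
  obtain B0 where B0: "B0 \<ge> 0" "\<And>\<gamma> s \<mu>. \<gamma> \<in> E \<Longrightarrow> s \<in> {0..1} \<Longrightarrow> \<bar>\<mu>\<bar> \<le> 0 \<Longrightarrow> \<bar>H \<gamma> s \<mu>\<bar> \<le> B0"
    using H_bounded[of 0] by blast
  define B where "B = Max (insert B0 ((\<lambda>v. - c v) ` vertices E))"
  have fin: "finite (insert B0 ((\<lambda>v. - c v) ` vertices E))" using finite_vertices by simp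
  have B: "B0 \<le> B" "\<And>v. v \<in> vertices E \<Longrightarrow> - c v \<le> B"
    unfolding B_def by (rule Max_ge[OF fin], simp)+
  have "H \<gamma> s 0 \<le> B" if "\<gamma> \<in> E" "s \<in> {0..1}" for \<gamma> s
    using B0(2)[OF that, of 0] B(1) by simp
  then have "subsolution (\<lambda>_ _. 0) (\<lambda>_. B)"
    using B(2) by (simp add: subsolution_def momentum_field_def)
  moreover have "B \<ge> 0" using B0(1) B(1) by simp
  ultimately show thesis by (rule_tac that)
qed

lemma potential_zero [simp]: "x \<in> network_set E \<Longrightarrow> potential (\<lambda>_ _. 0) x = 0"
  using potential_arc[of "\<lambda>_ _. 0"] by (auto simp: network_set_def momentum_field_def)

lemma integrand_bounded_below: "\<exists>B. B \<ge> 0 \<and> (\<forall>T \<zeta> t. integrand T \<zeta> t \<ge> ereal (- B))"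
proof (rule overall_lagrangian_bounded_below)
  fix B :: real assume "0 \<le> B" "\<And>x q. ereal (- B) \<le> overall_lagrangian E H c x q"
  then show ?thesis by (intro exI[of _ B]) simp
qed

text \<open>The network is closed, so a curve that leaves it stays outside for an interval of
  positive length, where the integrand is infinite. Competitors may thus be assumed to stay on the
  network.\<close>

lemma action_off_network:
  fixes \<zeta> :: "real \<Rightarrow> 'a"
  assumes \<zeta>: "abs_continuous_on 0 T \<zeta>" and T: "T > 0" and off: "\<not> \<zeta> ` {0..T} \<subseteq> network_set E"
  shows "action E H c T \<zeta> = \<infinity>"
proof -
  obtain t where t: "t \<in> {0..T}" "\<zeta> t \<notin> network_set E" using off by blast
  have "closed (network_set E)" using compact_network by (rule compact_imp_closed)
  then have "open (- network_set E)" by (rule open_Compl)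
  then have "openin (top_of_set {0..T}) ({0..T} \<inter> \<zeta> -` (- network_set E))"
    using abs_continuous_on_imp_continuous_on[OF \<zeta>] by (rule continuous_openin_preimage_gen[rotated])
  moreover have "t \<in> {0..T} \<inter> \<zeta> -` (- network_set E)" using t by simp
  ultimately obtain e where e: "e > 0" "ball t e \<inter> {0..T} \<subseteq> {0..T} \<inter> \<zeta> -` (- network_set E)"
    unfolding openin_contains_ball by blast
  define u where "u = max 0 (t - e / 2)"
  define v where "v = min T (t + e / 2)"
  have uv: "0 \<le> u" "u < v" "v \<le> T" using t(1) e(1) T by (auto simp: u_def v_def)
  have "s \<in> ball t e \<inter> {0..T}" if "s \<in> {u..v}" for s
    using that e(1) t(1) by (auto simp: u_def v_def dist_real_def abs_if)
  then have "\<zeta> s \<notin> network_set E" if "s \<in> {u..v}" for s using e(2) that by blast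
  then have inf: "integrand T \<zeta> s = \<infinity>" if "s \<in> {u..v}" for s
    using overall_lagrangian_off_network that by blast
  obtain B where B: "B \<ge> 0" "\<forall>T \<zeta> t. integrand T \<zeta> t \<ge> ereal (- B)"
    using integrand_bounded_below by (elim exE conjE)
  show ?thesis
    unfolding action_def by (rule ereal_integral_infinite[OF uv B(2)[rule_format] inf])
qed

lemma integrand_growth:
  assumes "a \<ge> 0"
  shows "\<exists>C. C \<ge> 0 \<and> (\<forall>T \<zeta> q t. regular_time T \<zeta> q t \<longrightarrow> ereal (a * norm q - C) \<le> integrand T \<zeta> t)"
proof -
  obtain \<Lambda> where \<Lambda>: "\<Lambda> > 0" "\<And>\<gamma> s. \<gamma> \<in> E \<Longrightarrow> s \<in> {0..1} \<Longrightarrow> norm (velocity \<gamma> s) \<le> \<Lambda>"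
    using velocity_bounded by blast
  obtain C0 where C0: "\<And>\<gamma> s l. \<gamma> \<in> E \<Longrightarrow> s \<in> {0..1} \<Longrightarrow> (a * \<Lambda>) * \<bar>l\<bar> - C0 \<le> lagrangian \<gamma> s l"
    using lagrangian_growth by blast
  obtain B where B: "B \<ge> 0" "\<forall>T \<zeta> t. integrand T \<zeta> t \<ge> ereal (- B)"
    using integrand_bounded_below by (elim exE conjE)
  define C where "C = max B C0"
  have "ereal (a * norm q - C) \<le> integrand T \<zeta> t" if reg: "regular_time T \<zeta> q t" for T \<zeta> q t
  proof (cases "\<zeta> t \<in> vertices E")
    case True
    then have "q = 0" using regular_time_vertex[OF reg] by simp
    then have "ereal (a * norm q - C) \<le> ereal (- B)" by (simp add: C_def)
    also have "\<dots> \<le> integrand T \<zeta> t" by (rule B(2)[rule_format])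
    finally show ?thesis .
  next
    case False
    obtain \<gamma> \<sigma> l \<delta> where *: "\<gamma> \<in> E" "\<delta> > 0" "\<forall>u. \<bar>u - t\<bar> < \<delta> \<longrightarrow> \<sigma> u \<in> {0<..<1} \<and> \<zeta> u = \<gamma> (\<sigma> u)"
      "q = l *\<^sub>R velocity \<gamma> (\<sigma> t)" "integrand T \<zeta> t = ereal (lagrangian \<gamma> (\<sigma> t) l)"
      using regular_time_arc[OF reg False] by (elim exE conjE)
    have st: "\<sigma> t \<in> {0..1}" using *(3)[rule_format, of t] *(2) by auto
    have "a * norm q \<le> (a * \<Lambda>) * \<bar>l\<bar>"
      using mult_left_mono[OF mult_right_mono[OF \<Lambda>(2)[OF *(1) st] abs_ge_zero[of l]] assms] *(4) by (simp add: mult_ac)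
    then show ?thesis using C0[OF *(1) st, of l] *(5) by (simp add: C_def)
  qed
  moreover have "C \<ge> 0" using B(1) by (simp add: C_def)
  ultimately show ?thesis by (intro exI[of _ C] conjI allI impI)
qed

lemma AE_regular:
  fixes a b :: real
  assumes N: "negligible N" and P: "\<And>t. t \<in> {0<..<T} - N \<Longrightarrow> P t" and ab: "0 \<le> a" "b \<le> T"
  shows "AE t in lebesgue_on {a..b}. P t"
proof -
  have "negligible (N \<union> {0, T})" using N by simp
  then have "N \<union> {0, T} \<in> null_sets lebesgue" by (simp add: negligible_iff_null_sets)
  then have "AE t in lebesgue. t \<notin> N \<union> {0, T}" by (rule AE_not_in)
  then have "AE t in lebesgue. t \<in> {a..b} \<longrightarrow> P t"
    by (rule eventually_mono) (use P ab in auto)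
  then show ?thesis by (simp add: AE_restrict_space_iff)
qed

text \<open>The criterion of de la Vallee-Poussin: integrating \<open>a * norm q - C\<close> over
  the family and \<open>- B\<close> elsewhere bounds \<open>a\<close> times the total increment by M
  + B T + C \<delta>. First a large \<open>a\<close> and then a small \<delta> make this less than
  \<open>a * \<epsilon>\<close>.\<close>

lemma uniformly_abs_continuous:
  assumes T: "T > 0" and "\<epsilon> > 0"
  shows "\<exists>\<delta>. \<delta> > 0 \<and> (\<forall>\<zeta> (J :: 'i set) l r. abs_continuous_on 0 T \<zeta> \<longrightarrow> \<zeta> ` {0..T} \<subseteq> network_set E \<longrightarrow>
       action E H c T \<zeta> \<le> ereal M \<longrightarrow> interval_family 0 T J l r \<longrightarrow> (\<Sum>j\<in>J. r j - l j) < \<delta> \<longrightarrow>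
       (\<Sum>j\<in>J. norm (\<zeta> (r j) - \<zeta> (l j))) < \<epsilon>)"
proof -
  obtain B where B: "B \<ge> 0" "\<forall>T \<zeta> t. integrand T \<zeta> t \<ge> ereal (- B)"
    using integrand_bounded_below by (elim exE conjE)
  \<comment> \<open>Chosen so that M + B T is less than half of \<open>a * \<epsilon>\<close>; the
    \<delta> below makes C \<delta> at most the other half.\<close>
  define a where "a = 2 * (\<bar>M\<bar> + B * T + 1) / \<epsilon>"
  have a: "a > 0" using B(1) T \<open>\<epsilon> > 0\<close> by (simp add: a_def add_nonneg_pos)
  obtain C where C: "C \<ge> 0" "\<forall>T \<zeta> q t. regular_time T \<zeta> q t \<longrightarrow> ereal (a * norm q - C) \<le> integrand T \<zeta> t"
    using integrand_growth[OF less_imp_le[OF a]] by (elim exE conjE)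
  define \<delta> where "\<delta> = a * \<epsilon> / (2 * (C + 1))"
  have "\<delta> > 0" using a \<open>\<epsilon> > 0\<close> C(1) by (simp add: \<delta>_def)
  moreover have "(\<Sum>j\<in>J. norm (\<zeta> (r j) - \<zeta> (l j))) < \<epsilon>"
    if \<zeta>: "abs_continuous_on 0 T \<zeta>" "\<zeta> ` {0..T} \<subseteq> network_set E" and M: "action E H c T \<zeta> \<le> ereal M"
      and J: "interval_family 0 T J l r" "(\<Sum>j\<in>J. r j - l j) < \<delta>" for \<zeta> and J :: "'i set" and l r
  proof -
    obtain \<rho> N where \<rho>: "integrable lborel \<rho>" "negligible N"
      "\<forall>a b. 0 \<le> a \<longrightarrow> a \<le> b \<longrightarrow> b \<le> T \<longrightarrow> (\<rho> has_integral (\<zeta> b - \<zeta> a)) {a..b}"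
      "\<forall>t\<in>{0<..<T} - N. regular_time T \<zeta> (\<rho> t) t"
      using curve_integrand_AE[OF \<zeta> T] by (elim exE conjE)
    have finJ: "finite J" and le: "\<And>j. j \<in> J \<Longrightarrow> 0 \<le> l j \<and> l j \<le> r j \<and> r j \<le> T"
      and disj: "\<And>i j. i \<in> J \<Longrightarrow> j \<in> J \<Longrightarrow> i \<noteq> j \<Longrightarrow> {l i<..<r i} \<inter> {l j<..<r j} = {}"
      using J(1) by (auto simp: interval_family_def pairwise_def)
    define f where "f t = a * norm (\<rho> t) - C" for t
    \<comment> \<open>A minorant of the integrand, integrable by construction: at least as small as
      \<open>- B\<close> off the family, and \<open>f - B\<close> inside. With the end points
      removed, a time lies in at most one interval, so the sum has at most one nonzero term.\<close>
    define h where "h t = - B + (\<Sum>j\<in>J. if t \<in> {l j..r j} then f t else 0)" for t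
    have \<rho>_abs: "\<rho> absolutely_integrable_on {u..v}" for u v by (rule integrable_lborel_imp_absolutely_integrable[OF \<rho>(1)])
    have f_abs: "f absolutely_integrable_on {u..v}" for u v
    proof -
      have "(\<lambda>t. norm (\<rho> t)) absolutely_integrable_on {u..v}"
        using absolutely_integrable_norm[OF \<rho>_abs[of u v]] by (simp add: o_def)
      then show ?thesis
        unfolding f_def by (intro set_integral_diff(1) set_integrable_mult_right) (auto simp: absolutely_integrable_on_const)
    qed
    have ind_abs: "(\<lambda>t. if t \<in> {l j..r j} then f t else 0) absolutely_integrable_on {0..T}" if "j \<in> J" for j
    proof -
      have "(\<lambda>t. if t \<in> {l j..r j} then f t else 0) absolutely_integrable_on UNIV"
        unfolding absolutely_integrable_restrict_UNIV by (rule f_abs)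
      then show ?thesis by (rule set_integrable_subset) auto
    qed
    have h_abs: "h absolutely_integrable_on {0..T}"
      unfolding h_def using ind_abs finJ
      by (intro set_integral_add(1) absolutely_integrable_sum) (auto simp: absolutely_integrable_on_const)
    have "AE t in lebesgue_on {0..T}. ereal (h t) \<le> integrand T \<zeta> t"
    proof (rule AE_regular)
      show "negligible (N \<union> l ` J \<union> r ` J)" using \<rho>(2) finJ by (simp add: negligible_finite)
      fix t assume t: "t \<in> {0<..<T} - (N \<union> l ` J \<union> r ` J)"
      have f_le: "ereal (f t) \<le> integrand T \<zeta> t" unfolding f_def using \<rho>(4) t by (intro C(2)[rule_format]) auto
      have h_le: "h t \<le> - B \<or> h t \<le> f t"
      proof (cases "\<exists>j\<in>J. t \<in> {l j..r j}")
        case True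
        then obtain j where j: "j \<in> J" "t \<in> {l j<..<r j}" using t by fastforce
        have "t \<notin> {l i..r i}" if i: "i \<in> J" "i \<noteq> j" for i
        proof
          assume "t \<in> {l i..r i}"
          then have "t \<in> {l i<..<r i}" using t i(1) by (auto simp: less_le)
          then show False using disj[OF i(1) j(1) i(2)] j(2) by auto
        qed
        then have "(\<Sum>i\<in>J. if t \<in> {l i..r i} then f t else 0) = (\<Sum>i\<in>J. if i = j then f t else 0)"
          using j by (intro sum.cong) auto
        then have "h t = - B + f t" using finJ j(1) by (simp add: h_def)
        then show ?thesis using B(1) by simp
      next
        case False
        then have "(\<Sum>i\<in>J. if t \<in> {l i..r i} then f t else 0) = 0" by (intro sum.neutral) auto
        then show ?thesis by (simp add: h_def)
      qed
      then show "ereal (h t) \<le> integrand T \<zeta> t"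
        using f_le B(2)[rule_format, of \<zeta> t T] by (auto intro: order_trans[rotated])
    qed auto
    then have "ereal_integral 0 T (\<lambda>t. ereal (h t)) \<le> action E H c T \<zeta>"
      unfolding action_def by (rule ereal_integral_mono_AE)
    also have "\<dots> \<le> ereal M" by (rule M)
    finally have hM: "integral {0..T} h \<le> M" using ereal_integral_real[OF h_abs] by simp
    have norm_int: "norm (\<zeta> (r j) - \<zeta> (l j)) \<le> integral {l j..r j} (\<lambda>t. norm (\<rho> t))" if "j \<in> J" for j
    proof -
      have "(\<rho> has_integral (\<zeta> (r j) - \<zeta> (l j))) {l j..r j}" using \<rho>(3) le[OF that] by blast
      then have "\<zeta> (r j) - \<zeta> (l j) = integral {l j..r j} \<rho>" by (simp add: integral_unique)
      moreover have "norm (integral {l j..r j} \<rho>) \<le> integral {l j..r j} (\<lambda>t. norm (\<rho> t))"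
        using \<rho>_abs[of "l j" "r j"]
        by (intro integral_norm_bound_integral) (auto simp: absolutely_integrable_on_def)
      ultimately show ?thesis by simp
    qed
    have int_f: "integral {l j..r j} f = a * integral {l j..r j} (\<lambda>t. norm (\<rho> t)) - C * (r j - l j)" if "j \<in> J" for j
    proof -
      have "(\<lambda>t. norm (\<rho> t)) integrable_on {l j..r j}" using \<rho>_abs[of "l j" "r j"] by (simp add: absolutely_integrable_on_def)
      then have "integral {l j..r j} (\<lambda>t. a * norm (\<rho> t) - C) = integral {l j..r j} (\<lambda>t. a * norm (\<rho> t)) - integral {l j..r j} (\<lambda>t. C)"
        by (intro Henstock_Kurzweil_Integration.integral_diff integrable_on_mult_right) auto
      then show ?thesis using le[OF that] by (simp add: f_def[abs_def])
    qed
    have "integral {0..T} h = integral {0..T} (\<lambda>t. - B) + integral {0..T} (\<lambda>t. \<Sum>j\<in>J. if t \<in> {l j..r j} then f t else 0)"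
      unfolding h_def using ind_abs finJ
      by (intro Henstock_Kurzweil_Integration.integral_add integrable_sum) (auto intro: set_lebesgue_integral_eq_integral(1))
    also have "integral {0..T} (\<lambda>t. \<Sum>j\<in>J. if t \<in> {l j..r j} then f t else 0) = (\<Sum>j\<in>J. integral {0..T} (\<lambda>t. if t \<in> {l j..r j} then f t else 0))"
      using ind_abs finJ by (intro Henstock_Kurzweil_Integration.integral_sum) (auto intro: set_lebesgue_integral_eq_integral(1))
    also have "\<dots> = (\<Sum>j\<in>J. integral {l j..r j} f)"
    proof (intro sum.cong refl)
      fix j assume "j \<in> J"
      then have "{l j..r j} \<subseteq> {0..T}" using le[of j] by auto
      then show "integral {0..T} (\<lambda>t. if t \<in> {l j..r j} then f t else 0) = integral {l j..r j} f"
        by (simp only: Henstock_Kurzweil_Integration.integral_restrict_Int Int_absorb2)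
    qed
    also have "\<dots> = a * (\<Sum>j\<in>J. integral {l j..r j} (\<lambda>t. norm (\<rho> t))) - C * (\<Sum>j\<in>J. r j - l j)"
      unfolding sum_distrib_left sum_subtractf[symmetric] by (intro sum.cong refl int_f)
    finally have "a * (\<Sum>j\<in>J. integral {l j..r j} (\<lambda>t. norm (\<rho> t))) \<le> M + B * T + C * (\<Sum>j\<in>J. r j - l j)"
      using hM T by (simp add: algebra_simps)
    moreover have "a * (\<Sum>j\<in>J. norm (\<zeta> (r j) - \<zeta> (l j))) \<le> a * (\<Sum>j\<in>J. integral {l j..r j} (\<lambda>t. norm (\<rho> t)))"
      using norm_int a by (intro mult_left_mono sum_mono) auto
    moreover have "C * (\<Sum>j\<in>J. r j - l j) \<le> C * \<delta>" using J(2) C(1) by (intro mult_left_mono) auto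
    moreover have "C * \<delta> \<le> (C + 1) * \<delta>" using \<open>\<delta> > 0\<close> by simp
    moreover have "(C + 1) * \<delta> = a * \<epsilon> / 2" using C(1) by (simp add: \<delta>_def field_simps)
    moreover have "M + B * T < a * \<epsilon> / 2"
      using \<open>\<epsilon> > 0\<close> by (simp add: a_def)
    ultimately have "a * (\<Sum>j\<in>J. norm (\<zeta> (r j) - \<zeta> (l j))) < a * \<epsilon>" by linarith
    then show ?thesis using a by simp
  qed
  ultimately show ?thesis by (intro exI[of _ \<delta>] conjI allI impI)
qed

text \<open>This is the duality that replaces convexity: pointwise, the integrand is approximated
  from below by rates \<open>d - G\<close> of subsolutions. On an arc, half of \<epsilon> pays for a
  nearly optimal \<mu> in the Legendre transform and half for the strict inequality that the
  construction demands; at a vertex only the latter is needed.\<close>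

lemma regular_time_subsolution:
  fixes \<zeta> :: "real \<Rightarrow> 'a"
  assumes \<zeta>: "\<zeta> ` {0..T} \<subseteq> network_set E" and t: "t \<in> {0<..<T}" and reg: "regular_time T \<zeta> q t" and "\<epsilon> > 0"
  shows "\<exists>p G d r. subsolution p G \<and> ((\<lambda>t. potential p (\<zeta> t)) has_real_derivative d) (at t) \<and>
    integrand T \<zeta> t = ereal r \<and> r - \<epsilon> < d - G (\<zeta> t)"
proof (cases "\<zeta> t \<in> vertices E")
  case True
  have "- c (\<zeta> t) < - c (\<zeta> t) + \<epsilon> / 2" using \<open>\<epsilon> > 0\<close> by simp
  then obtain p G where pG: "subsolution p G" "G (\<zeta> t) = - c (\<zeta> t) + \<epsilon> / 2" by (rule subsolution_vertex[OF True])
  have "((\<lambda>t. potential p (\<zeta> t)) has_real_derivative 0) (at t)"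
  proof (rule potential_derivative_vertex[of p "{0<..<T}"])
    show "momentum_field p" using pG(1) by (simp add: subsolution_def)
    show "(\<zeta> has_vector_derivative 0) (at t)" using regular_time_vertex[OF reg True] by simp
  qed (use t \<zeta> True in auto)
  then show ?thesis
    using pG regular_time_vertex[OF reg True] \<open>\<epsilon> > 0\<close>
    by (intro exI[of _ p] exI[of _ G] exI[of _ 0] exI[of _ "c (\<zeta> t)"]) simp
next
  case False
  obtain \<gamma> \<sigma> l \<delta> where *: "\<gamma> \<in> E" "\<delta> > 0" "\<forall>u. \<bar>u - t\<bar> < \<delta> \<longrightarrow> \<sigma> u \<in> {0<..<1} \<and> \<zeta> u = \<gamma> (\<sigma> u)"
    "(\<sigma> has_real_derivative l) (at t)" "integrand T \<zeta> t = ereal (lagrangian \<gamma> (\<sigma> t) l)"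
    using regular_time_arc[OF reg False] by (elim exE conjE)
  have st: "\<sigma> t \<in> {0<..<1}" "\<sigma> t \<in> {0..1}" "\<zeta> t = \<gamma> (\<sigma> t)" using *(3)[rule_format, of t] *(2) by auto
  have "\<epsilon> / 2 > 0" using \<open>\<epsilon> > 0\<close> by simp
  then obtain \<mu> where \<mu>: "lagrangian \<gamma> (\<sigma> t) l < l * \<mu> - H \<gamma> (\<sigma> t) \<mu> + \<epsilon> / 2"
    by (rule lagrangian_approx[OF *(1) st(2)])
  have "H \<gamma> (\<sigma> t) \<mu> < H \<gamma> (\<sigma> t) \<mu> + \<epsilon> / 2" using \<open>\<epsilon> > 0\<close> by simp
  then obtain p G where pG: "subsolution p G" "p \<gamma> (\<sigma> t) = \<mu>" "G (\<gamma> (\<sigma> t)) = H \<gamma> (\<sigma> t) \<mu> + \<epsilon> / 2"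
    by (rule subsolution_interior[OF *(1) st(1)])
  have "momentum_field p" using pG(1) by (simp add: subsolution_def)
  then have "((\<lambda>t. potential p (\<zeta> t)) has_real_derivative p \<gamma> (\<sigma> t) * l) (at t)"
    by (rule potential_derivative_arc[OF _ *(1,2) *(3)[rule_format] *(4)])
  then show ?thesis
    using pG * st \<mu>
    by (intro exI[of _ p] exI[of _ G] exI[of _ "p \<gamma> (\<sigma> t) * l"] exI[of _ "lagrangian \<gamma> (\<sigma> t) l"]) (simp add: mult.commute)
qed

text \<open>The lower bound of \<open>action_ge_subsolution\<close> on one interval. Unlike the
  action it involves no derivative of the curve, so it passes to limits.\<close>

definition gain :: "('a curve \<Rightarrow> real \<Rightarrow> real) \<Rightarrow> ('a \<Rightarrow> real) \<Rightarrow> (real \<Rightarrow> 'a) \<Rightarrow> real \<Rightarrow> real \<Rightarrow> real" where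
  "gain p G \<zeta> u v = potential p (\<zeta> v) - potential p (\<zeta> u) - integral {u..v} (\<lambda>t. G (\<zeta> t))"

lemma action_partition:
  assumes h: "h > 0"
  shows "(\<Sum>k<n. ereal_integral (real k * h) (real (Suc k) * h) (integrand T \<zeta>)) = ereal_integral 0 (real n * h) (integrand T \<zeta>)"
proof (induction n)
  case 0
  have "ereal_integral 0 0 (integrand T \<zeta>) = ereal_integral 0 0 (\<lambda>_. ereal 0)"
    by (intro ereal_integral_cong_AE AE_regular[where N = "{}" and T = 0]) auto
  then show ?case using ereal_integral_const[of 0 0 0] by simp
next
  case (Suc n)
  obtain B where B: "B \<ge> 0" "\<forall>T \<zeta> t. integrand T \<zeta> t \<ge> ereal (- B)"
    using integrand_bounded_below by (elim exE conjE)
  have "ereal_integral 0 (real (Suc n) * h) (integrand T \<zeta>) =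
      ereal_integral 0 (real n * h) (integrand T \<zeta>) + ereal_integral (real n * h) (real (Suc n) * h) (integrand T \<zeta>)"
    using h by (intro ereal_integral_split[where B = B] B(2)[rule_format]) (auto intro: mult_right_mono)
  then show ?case using Suc.IH by (simp del: of_nat_Suc)
qed

lemma gain_sum_le_action:
  assumes \<zeta>: "abs_continuous_on 0 T \<zeta>" "\<zeta> ` {0..T} \<subseteq> network_set E"
    and h: "h > 0" "real n * h = T" and n: "n > 0"
    and sub: "\<And>k. k < n \<Longrightarrow> subsolution (p k) (G k)"
  shows "ereal (\<Sum>k<n. gain (p k) (G k) \<zeta> (real k * h) (real (Suc k) * h)) \<le> action E H c T \<zeta>"
proof -
  have T: "T > 0" using h n by (metis mult_pos_pos of_nat_0_less_iff)
  have "ereal (gain (p k) (G k) \<zeta> (real k * h) (real (Suc k) * h)) \<le> ereal_integral (real k * h) (real (Suc k) * h) (integrand T \<zeta>)"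
    if "k < n" for k
  proof -
    have "real (Suc k) * h \<le> real n * h" using that h(1) by (intro mult_right_mono) auto
    then show ?thesis
      unfolding gain_def using h by (intro action_ge_subsolution[OF sub[OF that] \<zeta> T]) (auto intro: mult_right_mono)
  qed
  then have "(\<Sum>k<n. ereal (gain (p k) (G k) \<zeta> (real k * h) (real (Suc k) * h))) \<le>
      (\<Sum>k<n. ereal_integral (real k * h) (real (Suc k) * h) (integrand T \<zeta>))"
    by (intro sum_mono) auto
  then show ?thesis unfolding action_partition[OF h(1)] h(2) action_def by simp
qed

lemma gain_limit:
  assumes pG: "subsolution p G" and \<zeta>: "\<And>n. continuous_on {0..T} (\<zeta> n)" "\<And>n. \<zeta> n ` {0..T} \<subseteq> network_set E"
    and lim: "\<And>t. t \<in> {0..T} \<Longrightarrow> (\<lambda>n. \<zeta> n t) \<longlonglongrightarrow> \<xi> t" and \<xi>: "\<xi> ` {0..T} \<subseteq> network_set E"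
    and uv: "0 \<le> u" "u \<le> v" "v \<le> T"
  shows "(\<lambda>n. gain p G (\<zeta> n) u v) \<longlonglongrightarrow> gain p G \<xi> u v"
proof -
  have p: "momentum_field p" and G: "continuous_on UNIV G" using pG by (auto simp: subsolution_def)
  have pot: "(\<lambda>n. potential p (\<zeta> n t)) \<longlonglongrightarrow> potential p (\<xi> t)" if "t \<in> {0..T}" for t
    using \<zeta>(2) \<xi> that
    by (intro continuous_on_tendsto_compose[OF continuous_on_potential[OF p] lim[OF that]]) (auto simp: image_subset_iff)
  have "bounded (G ` network_set E)"
    using compact_network continuous_on_subset[OF G] by (intro compact_imp_bounded compact_continuous_image) auto
  then obtain M where M: "\<forall>x\<in>G ` network_set E. norm x \<le> M" by (auto simp: bounded_iff)
  have "(\<lambda>n. integral {u..v} (\<lambda>t. G (\<zeta> n t))) \<longlonglongrightarrow> integral {u..v} (\<lambda>t. G (\<xi> t))"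
  proof (rule dominated_convergence(2))
    fix n
    have "continuous_on {u..v} (\<zeta> n)" using continuous_on_subset[OF \<zeta>(1)] uv by auto
    then have "continuous_on {u..v} (\<lambda>t. G (\<zeta> n t))" by (intro continuous_on_compose2[OF G]) auto
    then show "(\<lambda>t. G (\<zeta> n t)) integrable_on {u..v}" by (rule integrable_continuous_interval)
    show "norm (G (\<zeta> n t)) \<le> M" if "t \<in> {u..v}" for t
      using M \<zeta>(2)[of n] that uv by (auto simp: image_subset_iff)
  next
    show "(\<lambda>n. G (\<zeta> n t)) \<longlonglongrightarrow> G (\<xi> t)" if "t \<in> {u..v}" for t
      using that uv by (intro continuous_on_tendsto_compose[OF G lim]) auto
  qed auto
  then show ?thesis unfolding gain_def using pot uv by (intro tendsto_diff) auto
qed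

text \<open>The rate at the single time \<open>t\<close> survives on short intervals around it. The
  thirds of \<open>e\<close> pay for the choice of the subsolution, the difference quotient of the
  potential and the oscillation of \<open>G\<close> along the curve.\<close>

lemma regular_time_gain:
  fixes \<xi> :: "real \<Rightarrow> 'a"
  assumes \<xi>: "continuous_on {0..T} \<xi>" "\<xi> ` {0..T} \<subseteq> network_set E"
    and t: "t \<in> {0<..<T}" and reg: "regular_time T \<xi> q t" and r: "integrand T \<xi> t = ereal r" and "e > 0"
  shows "\<exists>p G \<delta>. subsolution p G \<and> \<delta> > 0 \<and>
    (\<forall>u v. 0 \<le> u \<longrightarrow> u \<le> t \<longrightarrow> t \<le> v \<longrightarrow> v \<le> T \<longrightarrow> v - u < \<delta> \<longrightarrow> (r - e) * (v - u) \<le> gain p G \<xi> u v)"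
proof -
  have "e / 3 > 0" using \<open>e > 0\<close> by simp
  then obtain p G d r' where pG: "subsolution p G" "((\<lambda>t. potential p (\<xi> t)) has_real_derivative d) (at t)"
    "integrand T \<xi> t = ereal r'" "r' - e / 3 < d - G (\<xi> t)"
    using regular_time_subsolution[OF \<xi>(2) t reg \<open>e / 3 > 0\<close>] by (elim exE conjE)
  have r': "r' = r" using r pG(3) by simp
  obtain \<delta>1 where \<delta>1: "\<delta>1 > 0" "\<And>u v. u \<le> t \<Longrightarrow> t \<le> v \<Longrightarrow> v - u < \<delta>1 \<Longrightarrow>
      \<bar>potential p (\<xi> v) - potential p (\<xi> u) - d * (v - u)\<bar> \<le> e / 3 * (v - u)"
    using straddle_quotient[OF pG(2) \<open>e / 3 > 0\<close>] by blast
  have G: "continuous_on {0..T} (\<lambda>s. G (\<xi> s))"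
    using pG(1) by (intro continuous_on_compose2[OF _ \<xi>(1), of UNIV G]) (auto simp: subsolution_def)
  have "t \<in> {0..T}" using t by auto
  then obtain \<delta>2 where \<delta>2: "\<delta>2 > 0" "\<forall>s\<in>{0..T}. dist s t < \<delta>2 \<longrightarrow> dist (G (\<xi> s)) (G (\<xi> t)) < e / 3"
    using G \<open>e / 3 > 0\<close> unfolding continuous_on_iff by blast
  have "(r - e) * (v - u) \<le> gain p G \<xi> u v"
    if uv: "0 \<le> u" "u \<le> t" "t \<le> v" "v \<le> T" "v - u < min \<delta>1 \<delta>2" for u v
  proof -
    have "integral {u..v} (\<lambda>s. G (\<xi> s)) \<le> integral {u..v} (\<lambda>s. G (\<xi> t) + e / 3)"
    proof (rule integral_le)
      show "(\<lambda>s. G (\<xi> s)) integrable_on {u..v}"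
        using uv by (intro integrable_continuous_interval continuous_on_subset[OF G]) auto
      fix s assume s: "s \<in> {u..v}"
      then have "dist (G (\<xi> s)) (G (\<xi> t)) < e / 3" using \<delta>2(2) uv by (auto simp: dist_real_def)
      then show "G (\<xi> s) \<le> G (\<xi> t) + e / 3" unfolding dist_real_def by linarith
    qed auto
    then have 1: "integral {u..v} (\<lambda>s. G (\<xi> s)) \<le> (G (\<xi> t) + e / 3) * (v - u)" using uv by (simp add: mult.commute)
    have 2: "d * (v - u) - e / 3 * (v - u) \<le> potential p (\<xi> v) - potential p (\<xi> u)"
    proof -
      have "\<bar>potential p (\<xi> v) - potential p (\<xi> u) - d * (v - u)\<bar> \<le> e / 3 * (v - u)"
        by (rule \<delta>1(2)[OF uv(2,3)]) (use uv(5) in simp)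
      then show ?thesis unfolding abs_le_iff by linarith
    qed
    have "(r - e) * (v - u) \<le> (d - e / 3 - (G (\<xi> t) + e / 3)) * (v - u)"
      using pG(4) r' uv by (intro mult_right_mono) auto
    also have "\<dots> = (d * (v - u) - e / 3 * (v - u)) - (G (\<xi> t) + e / 3) * (v - u)" by (simp add: algebra_simps)
    finally show ?thesis using 1 2 unfolding gain_def by linarith
  qed
  moreover have "min \<delta>1 \<delta>2 > 0" using \<delta>1(1) \<delta>2(1) by simp
  ultimately show ?thesis using pG(1) by blast
qed

text \<open>The bounds \<open>m n\<close> are real so that limits can be taken outside the extended
  reals. The cellwise suprema of gains yield step functions with integrals bounded by
  \<open>M\<close>, up to a shift; their lower limit dominates the integrand almost
  everywhere.\<close>

theorem action_lower_semicontinuous: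
  fixes \<zeta> :: "nat \<Rightarrow> real \<Rightarrow> 'a"
  assumes T: "T > 0"
    and \<zeta>: "\<And>n. abs_continuous_on 0 T (\<zeta> n)" "\<And>n. \<zeta> n ` {0..T} \<subseteq> network_set E"
    and \<xi>: "abs_continuous_on 0 T \<xi>" "\<xi> ` {0..T} \<subseteq> network_set E"
    and lim: "\<And>t. t \<in> {0..T} \<Longrightarrow> (\<lambda>n. \<zeta> n t) \<longlonglongrightarrow> \<xi> t"
    and m: "\<And>n. action E H c T (\<zeta> n) \<le> ereal (m n)" "m \<longlonglongrightarrow> M"
  shows "action E H c T \<xi> \<le> ereal M"
proof -
  have cont: "continuous_on {0..T} (\<zeta> n)" "continuous_on {0..T} \<xi>" for n
    using \<zeta>(1) \<xi>(1) by (auto intro: abs_continuous_on_imp_continuous_on)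
  define h where "h n = T / real (Suc n)" for n
  have h: "h n > 0" "real (Suc n) * h n = T" for n using T by (auto simp: h_def)
  have node: "0 \<le> real k * h n" "real k * h n \<le> real (Suc k) * h n" "real (Suc k) * h n \<le> T" if "k < Suc n" for k n
  proof -
    show "0 \<le> real k * h n" "real k * h n \<le> real (Suc k) * h n" using h(1)[of n] by (auto intro: mult_right_mono)
    have "real (Suc k) * h n \<le> real (Suc n) * h n" using that h(1)[of n] by (intro mult_right_mono) auto
    then show "real (Suc k) * h n \<le> T" using h(2) by simp
  qed
  \<comment> \<open>The finitely many subsolutions are fixed before the curves converge, so that
    only continuity of each single gain is needed.\<close>
  have sum_gain: "(\<Sum>k<Suc n. gain (p k) (G k) \<xi> (real k * h n) (real (Suc k) * h n)) \<le> M"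
    if sub: "\<And>k. k < Suc n \<Longrightarrow> subsolution (p k) (G k)" for n p G
  proof (rule LIMSEQ_le[OF _ m(2)])
    show "(\<lambda>j. \<Sum>k<Suc n. gain (p k) (G k) (\<zeta> j) (real k * h n) (real (Suc k) * h n)) \<longlonglongrightarrow>
        (\<Sum>k<Suc n. gain (p k) (G k) \<xi> (real k * h n) (real (Suc k) * h n))"
      using node by (intro tendsto_sum gain_limit[OF sub cont(1) \<zeta>(2) lim \<xi>(2)]) auto
    have "ereal (\<Sum>k<Suc n. gain (p k) (G k) (\<zeta> j) (real k * h n) (real (Suc k) * h n)) \<le> ereal (m j)" for j
      using gain_sum_le_action[OF \<zeta>(1,2) h(1,2) zero_less_Suc sub] m(1)[of j] by (rule order_trans)
    then show "\<exists>N. \<forall>j\<ge>N. (\<Sum>k<Suc n. gain (p k) (G k) (\<zeta> j) (real k * h n) (real (Suc k) * h n)) \<le> m j" by simp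
  qed
  obtain B where B: "B \<ge> 0" "subsolution (\<lambda>_ _. 0) (\<lambda>_. B)" by (rule trivial_subsolution)
  have gain0: "gain (\<lambda>_ _. 0) (\<lambda>_. B) \<xi> (real k * h n) (real (Suc k) * h n) = - B * h n" if "k < Suc n" for k n
  proof -
    have "\<xi> (real k * h n) \<in> network_set E" "\<xi> (real (Suc k) * h n) \<in> network_set E"
      using \<xi>(2) node[OF that] by (auto simp: image_subset_iff)
    then show ?thesis using h(1)[of n] by (simp add: gain_def algebra_simps)
  qed
  define A where "A = {x. subsolution (fst x) (snd x)}"
  have A: "((\<lambda>_ _. 0), (\<lambda>_. B)) \<in> A" using B(2) by (simp add: A_def)
  define g where "g n k x = gain (fst x) (snd x) \<xi> (real k * h n) (real (Suc k) * h n)" for n k x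
  define V where "V n k = (SUP x\<in>A. g n k x)" for n k
  \<comment> \<open>The sum over all cells is bounded by \<open>M\<close>; with the trivial
    subsolution on every other cell this bounds a single gain.\<close>
  have bdd: "bdd_above (g n k ` A)" if k: "k < Suc n" for n k
  proof (rule bdd_aboveI2)
    fix x assume x: "x \<in> A"
    let ?y = "\<lambda>i. if i = k then x else ((\<lambda>_ _. 0), (\<lambda>_. B))"
    have "?y i \<in> A" for i using x A by simp
    then have "(\<Sum>i<Suc n. g n i (?y i)) \<le> M"
      unfolding g_def by (intro sum_gain) (simp add: A_def)
    moreover have "(\<Sum>i<Suc n. g n i (?y i)) = g n k x + (\<Sum>i\<in>{..<Suc n} - {k}. g n i (?y i))"
      using k by (subst sum.remove[of _ k]) auto
    moreover have "(\<Sum>i\<in>{..<Suc n} - {k}. g n i (?y i)) = (\<Sum>i\<in>{..<Suc n} - {k}. - B * h n)"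
      by (intro sum.cong refl) (auto simp: g_def gain0 simp del: of_nat_Suc)
    ultimately show "g n k x \<le> M - (\<Sum>i\<in>{..<Suc n} - {k}. - B * h n)" by linarith
  qed
  have V_ge: "g n k x \<le> V n k" if "k < Suc n" "x \<in> A" for n k x
    unfolding V_def using that by (intro cSUP_upper bdd)
  have V_B: "- B * h n \<le> V n k" if "k < Suc n" for n k
    using V_ge[OF that A] gain0[OF that] by (simp add: g_def)
  \<comment> \<open>The cells may be optimized independently; each choice loses at most
    \<open>e / real (Suc n)\<close>.\<close>
  have sum_V: "(\<Sum>k<Suc n. V n k) \<le> M" for n
  proof (rule field_le_epsilon)
    fix e :: real assume "e > 0"
    have "\<exists>x. x \<in> A \<and> V n k - e / real (Suc n) < g n k x" if "k < Suc n" for k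
    proof -
      have "V n k - e / real (Suc n) < (SUP x\<in>A. g n k x)" using \<open>e > 0\<close> by (simp add: V_def)
      then show ?thesis using less_cSUP_iff[OF _ bdd[OF that]] A by blast
    qed
    then have "\<forall>k\<in>{..<Suc n}. \<exists>x. x \<in> A \<and> V n k - e / real (Suc n) < g n k x" by simp
    from bchoice[OF this] obtain x where x: "\<forall>k\<in>{..<Suc n}. x k \<in> A \<and> V n k - e / real (Suc n) < g n k (x k)" ..
    have "(\<Sum>k<Suc n. V n k) \<le> (\<Sum>k<Suc n. g n k (x k) + e / real (Suc n))"
    proof (rule sum_mono)
      fix k assume "k \<in> {..<Suc n}"
      then have "V n k - e / real (Suc n) < g n k (x k)" using x by blast
      then show "V n k \<le> g n k (x k) + e / real (Suc n)" by linarith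
    qed
    also have "\<dots> = (\<Sum>k<Suc n. g n k (x k)) + e" by (simp add: sum.distrib)
    also have "(\<Sum>k<Suc n. g n k (x k)) \<le> M"
      unfolding g_def using x by (intro sum_gain) (auto simp: A_def)
    finally show "(\<Sum>k<Suc n. V n k) \<le> M + e" by simp
  qed
  \<comment> \<open>The optimal rates as a step function. The shift by \<open>B\<close> makes it
    nonnegative, by \<open>V_B\<close>, as Fatou's lemma requires; half-open cells place each time
    of \<open>{0..<T}\<close> in exactly one of them.\<close>
  define w where "w n t = (\<Sum>k<Suc n. ennreal (V n k / h n + B) * indicator {real k * h n..<real (Suc k) * h n} t)" for n t
  have [measurable]: "w n \<in> borel_measurable lborel" for n unfolding w_def by measurable
  have w_int: "(\<integral>\<^sup>+t. w n t \<partial>lborel) \<le> ennreal (M + B * T)" for n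
  proof -
    have pos: "0 \<le> V n k / h n + B" if "k < Suc n" for k
      using V_B[OF that] h(1)[of n] by (simp add: field_simps)
    have "(\<integral>\<^sup>+t. w n t \<partial>lborel) = (\<Sum>k<Suc n. \<integral>\<^sup>+t. ennreal (V n k / h n + B) * indicator {real k * h n..<real (Suc k) * h n} t \<partial>lborel)"
      unfolding w_def by (rule nn_integral_sum) measurable
    also have "\<dots> = (\<Sum>k<Suc n. ennreal (V n k / h n + B) * ennreal (h n))"
    proof (intro sum.cong refl)
      fix k
      have "real (Suc k) * h n - real k * h n = h n" by (simp add: algebra_simps)
      moreover have "real k * h n \<le> real (Suc k) * h n" using h(1)[of n] by (intro mult_right_mono) auto
      ultimately have "emeasure lborel {real k * h n..<real (Suc k) * h n} = ennreal (h n)"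
        by (simp only: emeasure_lborel_Ico)
      then show "(\<integral>\<^sup>+t. ennreal (V n k / h n + B) * indicator {real k * h n..<real (Suc k) * h n} t \<partial>lborel)
         = ennreal (V n k / h n + B) * ennreal (h n)"
        by (subst nn_integral_cmult_indicator) simp_all
    qed
    also have "\<dots> = (\<Sum>k<Suc n. ennreal (V n k + B * h n))"
    proof (intro sum.cong refl)
      fix k assume "k \<in> {..<Suc n}"
      then show "ennreal (V n k / h n + B) * ennreal (h n) = ennreal (V n k + B * h n)"
        using pos[of k] h(1)[of n] by (simp add: ennreal_mult[symmetric] distrib_right)
    qed
    also have "\<dots> = ennreal (\<Sum>k<Suc n. V n k + B * h n)"
      using V_B[of _ n] by (intro sum_ennreal) (fastforce simp: minus_le_iff)
    also have "(\<Sum>k<Suc n. V n k + B * h n) = (\<Sum>k<Suc n. V n k) + B * T"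
      using h(2)[of n] by (simp add: sum.distrib algebra_simps del: sum.lessThan_Suc)
    also have "ennreal ((\<Sum>k<Suc n. V n k) + B * T) \<le> ennreal (M + B * T)"
      using sum_V by (intro ennreal_leI) simp
    finally show ?thesis .
  qed
  define W where "W t = liminf (\<lambda>n. w n t)" for t
  have [measurable]: "W \<in> borel_measurable lborel" unfolding W_def by measurable
  have "(\<integral>\<^sup>+t. W t \<partial>lborel) \<le> liminf (\<lambda>n. \<integral>\<^sup>+t. w n t \<partial>lborel)"
    unfolding W_def by (rule nn_integral_liminf) measurable
  also have "\<dots> \<le> ennreal (M + B * T)"
    using w_int by (intro Liminf_le) (auto intro: always_eventually)
  finally have W_int: "(\<integral>\<^sup>+t. W t \<partial>lborel) \<le> ennreal (M + B * T)" .
  obtain \<rho> N where N: "negligible N" "\<forall>t\<in>{0<..<T} - N. regular_time T \<xi> (\<rho> t) t"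
    using curve_integrand_AE[OF \<xi> T] by (elim exE conjE)
  \<comment> \<open>Once the mesh is below \<delta>, the cell that contains \<open>t\<close> carries
    a subsolution with rate at least \<open>r - e\<close>, so the optimal rate there is no
    smaller.\<close>
  have W_ge: "ennreal (r + B) \<le> W t" if t: "t \<in> {0<..<T} - N" and r: "integrand T \<xi> t = ereal r" for t r
  proof (rule ennreal_le_epsilon)
    fix e :: real assume "e > 0"
    have t': "t \<in> {0<..<T}" and reg: "regular_time T \<xi> (\<rho> t) t" using t N(2) by auto
    obtain p G \<delta> where pG: "subsolution p G" "\<delta> > 0"
      "\<forall>u v. 0 \<le> u \<longrightarrow> u \<le> t \<longrightarrow> t \<le> v \<longrightarrow> v \<le> T \<longrightarrow> v - u < \<delta> \<longrightarrow> (r - e) * (v - u) \<le> gain p G \<xi> u v"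
      using regular_time_gain[OF cont(2) \<xi>(2) t' reg r \<open>e > 0\<close>] by (elim exE conjE)
    obtain n0 :: nat where n0: "T / \<delta> < real n0" using reals_Archimedean2 by blast
    have "ennreal (r - e + B) \<le> w n t" if "n0 \<le> n" for n
    proof -
      have "T / \<delta> < real (Suc n)" using n0 that by linarith
      then have h_small: "h n < \<delta>" using pG(2) by (simp add: h_def field_simps)
      define k where "k = nat \<lfloor>t / h n\<rfloor>"
      have "0 \<le> t / h n" using t' h(1)[of n] by simp
      then have k: "real k \<le> t / h n" "t / h n < real k + 1" unfolding k_def by linarith+
      have k1: "real k * h n \<le> t" "t < real (Suc k) * h n"
        using k h(1)[of n] by (simp_all add: field_simps)
      have kn: "k < Suc n"
      proof (rule ccontr)
        assume "\<not> k < Suc n"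
        then have "real (Suc n) * h n \<le> real k * h n" using h(1)[of n] by (intro mult_right_mono) auto
        then show False using k1 h(2)[of n] t' by simp
      qed
      have step: "real (Suc k) * h n - real k * h n = h n" by (simp add: algebra_simps)
      have "(r - e) * (real (Suc k) * h n - real k * h n) \<le> gain p G \<xi> (real k * h n) (real (Suc k) * h n)"
        using node[OF kn] k1 h_small by (intro pG(3)[rule_format]) (auto simp: step simp del: of_nat_Suc)
      also have "\<dots> = g n k (p, G)" by (simp add: g_def)
      also have "\<dots> \<le> V n k" using pG(1) by (intro V_ge[OF kn]) (simp add: A_def)
      finally have "r - e + B \<le> V n k / h n + B" using h(1)[of n] unfolding step by (simp add: field_simps)
      then have "ennreal (r - e + B) \<le> ennreal (V n k / h n + B) * indicator {real k * h n..<real (Suc k) * h n} t"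
        using k1 by (simp add: ennreal_leI)
      also have "\<dots> \<le> w n t"
        unfolding w_def using kn by (intro member_le_sum[where f = "\<lambda>k. ennreal (V n k / h n + B) * indicator {real k * h n..<real (Suc k) * h n} t"]) auto
      finally show ?thesis .
    qed
    then have "\<forall>\<^sub>F n in sequentially. ennreal (r - e + B) \<le> w n t" by (rule eventually_sequentiallyI)
    then have "ennreal (r - e + B) \<le> W t" unfolding W_def by (rule Liminf_bounded)
    \<comment> \<open>\<open>ennreal\<close> sends negative numbers to zero, so the case in which
      subtracting \<open>e\<close> changes the sign is treated separately.\<close>
    have "ennreal (r + B) \<le> ennreal (r - e + B) + ennreal e"
    proof (cases "r - e + B \<ge> 0")
      case True
      then show ?thesis using \<open>e > 0\<close> by (simp add: ennreal_plus[symmetric] del: ennreal_plus)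
    next
      case False
      then have "ennreal (r + B) \<le> ennreal e" by (intro ennreal_leI) simp
      then show ?thesis by (simp add: add_increasing)
    qed
    also have "\<dots> \<le> W t + ennreal e" using \<open>ennreal (r - e + B) \<le> W t\<close> by (rule add_right_mono)
    finally show "ennreal (r + B) \<le> W t + ennreal e" .
  qed
  have "0 \<le> M + B * T"
  proof -
    have "- B * T \<le> (\<Sum>k<Suc 0. V 0 k)" using V_B[of 0 0] h(2)[of 0] by simp
    then show ?thesis using sum_V[of 0] by simp
  qed
  have W_fin: "AE t in lborel. W t \<noteq> \<infinity>"
    using W_int by (intro nn_integral_PInf_AE) (auto simp: top_unique)
  \<comment> \<open>A finite version of \<open>W\<close>. It is a measurable majorant of the shifted
    integrand, through which the action itself is bounded.\<close>
  define f where "f t = enn2real (W t)" for t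
  have [measurable]: "f \<in> borel_measurable lborel" unfolding f_def by measurable
  have f_nn: "(\<integral>\<^sup>+t. ennreal (f t) \<partial>lborel) \<le> ennreal (M + B * T)"
  proof -
    have "(\<integral>\<^sup>+t. ennreal (f t) \<partial>lborel) = (\<integral>\<^sup>+t. W t \<partial>lborel)"
      using W_fin by (intro nn_integral_cong_AE) (auto elim!: eventually_mono simp: f_def less_top)
    then show ?thesis using W_int by simp
  qed
  have f_pos: "0 \<le> f t" for t by (simp add: f_def)
  have f_int: "integrable lborel f"
    using f_nn f_pos by (intro integrableI_nonneg) (auto simp: le_less_trans[OF _ ennreal_less_top])
  have "ennreal (integral\<^sup>L lborel f) \<le> ennreal (M + B * T)"
    using f_nn f_pos f_int by (subst nn_integral_eq_integral[symmetric]) auto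
  then have "integral\<^sup>L lborel f \<le> M + B * T" using \<open>0 \<le> M + B * T\<close> by (simp add: ennreal_le_iff)
  moreover have "integral {0..T} f \<le> integral UNIV f"
  proof (rule integral_subset_le)
    show "f integrable_on UNIV" using f_int by (rule integrable_on_lborel)
    show "f integrable_on {0..T}"
      using integrable_lborel_imp_absolutely_integrable[OF f_int] by (rule set_lebesgue_integral_eq_integral(1))
  qed (use f_pos in auto)
  moreover have "integral UNIV f = integral\<^sup>L lborel f" using f_int by (rule integral_lborel)
  ultimately have f_le: "integral {0..T} f \<le> M + B * T" by simp
  have f_abs: "f absolutely_integrable_on {0..T}" by (rule integrable_lborel_imp_absolutely_integrable[OF f_int])
  have fB_abs: "(\<lambda>t. f t - B) absolutely_integrable_on {0..T}"
    using f_abs by (intro set_integral_diff(1)) (auto simp: absolutely_integrable_on_const)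
  have "AE t in lebesgue_on {0..T}. integrand T \<xi> t \<le> ereal (f t - B)"
  proof -
    have "AE t in lebesgue. W t \<noteq> \<infinity>" using W_fin by (rule AE_completion)
    then have "AE t in lebesgue_on {0..T}. W t \<noteq> \<infinity>" by (auto simp: AE_restrict_space_iff elim: eventually_mono)
    moreover have "AE t in lebesgue_on {0..T}. \<exists>r. integrand T \<xi> t = ereal r \<and> ennreal (r + B) \<le> W t"
    proof (rule AE_regular[OF N(1)])
      fix t assume t: "t \<in> {0<..<T} - N"
      then have t': "t \<in> {0<..<T}" and reg: "regular_time T \<xi> (\<rho> t) t" using N(2) by auto
      obtain r where "integrand T \<xi> t = ereal r"
        using regular_time_subsolution[OF \<xi>(2) t' reg zero_less_one] by (elim exE conjE)
      then show "\<exists>r. integrand T \<xi> t = ereal r \<and> ennreal (r + B) \<le> W t" using W_ge[OF t] by blast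
    qed auto
    ultimately show ?thesis
    proof eventually_elim
      case (elim t)
      then obtain r where r: "integrand T \<xi> t = ereal r" "ennreal (r + B) \<le> W t" by blast
      have "W t = ennreal (f t)" using elim(1) by (simp add: f_def less_top)
      then have "r + B \<le> f t" using r(2) f_pos[of t] by (simp add: ennreal_le_iff)
      then show ?case using r(1) by simp
    qed
  qed
  then have "action E H c T \<xi> \<le> ereal_integral 0 T (\<lambda>t. ereal (f t - B))"
    unfolding action_def by (rule ereal_integral_mono_AE)
  also have "\<dots> = ereal (integral {0..T} (\<lambda>t. f t - B))" by (rule ereal_integral_real[OF fB_abs])
  also have "integral {0..T} (\<lambda>t. f t - B) = integral {0..T} f - B * T"
    using set_lebesgue_integral_eq_integral(1)[OF f_abs] T
    by (subst Henstock_Kurzweil_Integration.integral_diff) auto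
  also have "ereal (integral {0..T} f - B * T) \<le> ereal M" using f_le by simp
  finally show ?thesis .
qed

end

section \<open>Existence of minimizers\<close>

lemma derivative_bounded_by_lipschitz:
  fixes \<sigma> :: "real \<Rightarrow> real"
  assumes \<sigma>: "(\<sigma> has_real_derivative l) (at t)" and "\<delta> > 0"
    and K: "\<And>u. \<bar>u - t\<bar> < \<delta> \<Longrightarrow> \<bar>\<sigma> u - \<sigma> t\<bar> \<le> K * \<bar>u - t\<bar>"
  shows "\<bar>l\<bar> \<le> K"
proof -
  have "((\<lambda>u. \<bar>(\<sigma> u - \<sigma> t) / (u - t)\<bar>) \<longlongrightarrow> \<bar>l\<bar>) (at t)"
    using \<sigma> by (intro tendsto_rabs) (simp add: has_field_derivative_iff)
  moreover have "\<forall>\<^sub>F u in at t. \<bar>(\<sigma> u - \<sigma> t) / (u - t)\<bar> \<le> K"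
    unfolding eventually_at
    using \<open>\<delta> > 0\<close> K by (intro exI[of _ \<delta>]) (auto simp: dist_real_def divide_le_eq)
  ultimately show ?thesis by (rule tendsto_upperbound) simp
qed

section \<open>Lipschitz curves between two points of the network\<close>

context network
begin

lemma arc_lipschitz:
  obtains \<Lambda> where "\<Lambda> \<ge> 0" "\<And>\<gamma>. \<gamma> \<in> E \<Longrightarrow> \<Lambda>-lipschitz_on {0..1} \<gamma>"
proof -
  obtain \<Lambda> where \<Lambda>: "\<Lambda> > 0" "\<And>\<gamma> s. \<gamma> \<in> E \<Longrightarrow> s \<in> {0..1} \<Longrightarrow> norm (velocity \<gamma> s) \<le> \<Lambda>"
    using velocity_bounded by blast
  have "\<Lambda>-lipschitz_on {0..1} \<gamma>" if \<gamma>: "\<gamma> \<in> E" for \<gamma>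
  proof (rule lipschitz_onI)
    fix s s' :: real assume s: "s \<in> {0..1}" "s' \<in> {0..1}"
    have "continuous_on {0..1} (\<lambda>u. velocity \<gamma> (s' + u * (s - s')))"
      using segment_unit_interval[OF s]
      by (intro continuous_on_compose2[OF continuous_velocity[OF \<gamma>]] continuous_intros) auto
    then have "norm (integral {0..1} (\<lambda>u. velocity \<gamma> (s' + u * (s - s')))) \<le> \<Lambda> * (1 - 0)"
      using \<Lambda>(2)[OF \<gamma> segment_unit_interval[OF s]] by (intro integral_bound) auto
    then have b: "norm (integral {0..1} (\<lambda>u. velocity \<gamma> (s' + u * (s - s')))) \<le> \<Lambda>" by simp
    then show "dist (\<gamma> s) (\<gamma> s') \<le> \<Lambda> * dist s s'"
      unfolding dist_norm arc_difference[OF \<gamma> s]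
      using mult_right_mono[OF b, of "\<bar>s - s'\<bar>"] by (simp add: dist_real_def mult.commute)
  qed (use \<Lambda>(1) in simp)
  moreover have "\<Lambda> \<ge> 0" using \<Lambda>(1) by simp
  ultimately show thesis by (rule_tac that)
qed

definition lipschitz_linked :: "'a \<Rightarrow> 'a \<Rightarrow> bool" where
  "lipschitz_linked x y \<longleftrightarrow> (\<exists>g L. L-lipschitz_on {0..1} g \<and> g ` {0..1} \<subseteq> network_set E \<and> g 0 = x \<and> g (1::real) = y)"

lemma lipschitz_linked_trans:
  assumes "lipschitz_linked x y" "lipschitz_linked y z"
  shows "lipschitz_linked x z"
proof -
  obtain f L where f: "L-lipschitz_on {0..1} f" "f ` {0..1} \<subseteq> network_set E" "f 0 = x" "f (1::real) = y"
    using assms(1) unfolding lipschitz_linked_def by (elim exE conjE)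
  obtain g K where g: "K-lipschitz_on {0..1} g" "g ` {0..1} \<subseteq> network_set E" "g 0 = y" "g (1::real) = z"
    using assms(2) unfolding lipschitz_linked_def by (elim exE conjE)
  \<comment> \<open>The factor 2 is due to running both curves at double speed on the two halves of
    the unit interval.\<close>
  define M where "M = max L K * 2"
  have L0: "L \<ge> 0" using f(1) lipschitz_on_nonneg by blast
  have LK: "L * d \<le> max L K * d" "K * d \<le> max L K * d" if "d \<ge> 0" for d
    using that by (auto intro: mult_right_mono)
  have "M-lipschitz_on {0..1/2} (\<lambda>t. f (2 * t))"
  proof (rule lipschitz_onI)
    fix s t :: real assume st: "s \<in> {0..1/2}" "t \<in> {0..1/2}"
    have "dist (f (2 * s)) (f (2 * t)) \<le> L * dist (2 * s) (2 * t)"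
      using st by (intro lipschitz_onD[OF f(1)]) auto
    also have "\<dots> \<le> max L K * dist (2 * s) (2 * t)" by (rule LK(1)) simp
    also have "dist (2 * s) (2 * t) = 2 * dist s t" by (auto simp: dist_real_def abs_if)
    also have "max L K * (2 * dist s t) = M * dist s t" by (simp add: M_def)
    finally show "dist (f (2 * s)) (f (2 * t)) \<le> M * dist s t" .
  qed (use L0 in \<open>simp add: M_def\<close>)
  moreover have "M-lipschitz_on {1/2..1} (\<lambda>t. g (2 * t - 1))"
  proof (rule lipschitz_onI)
    fix s t :: real assume st: "s \<in> {1/2..1}" "t \<in> {1/2..1}"
    have "dist (g (2 * s - 1)) (g (2 * t - 1)) \<le> K * dist (2 * s - 1) (2 * t - 1)"
      using st by (intro lipschitz_onD[OF g(1)]) auto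
    also have "\<dots> \<le> max L K * dist (2 * s - 1) (2 * t - 1)" by (rule LK(2)) simp
    also have "dist (2 * s - 1) (2 * t - 1) = 2 * dist s t" by (auto simp: dist_real_def abs_if)
    also have "max L K * (2 * dist s t) = M * dist s t" by (simp add: M_def)
    finally show "dist (g (2 * s - 1)) (g (2 * t - 1)) \<le> M * dist s t" .
  qed (use L0 in \<open>simp add: M_def\<close>)
  ultimately have "M-lipschitz_on {0..1} (\<lambda>t. if t \<le> 1/2 then f (2 * t) else g (2 * t - 1))"
    using f(4) g(3) by (intro lipschitz_on_concat) auto
  moreover have "(\<lambda>t. if t \<le> 1/2 then f (2 * t) else g (2 * t - 1)) ` {0..1} \<subseteq> network_set E"
    using f(2) g(2) by (auto simp: image_subset_iff)
  ultimately show ?thesis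
    unfolding lipschitz_linked_def using f(3) g(4)
    by (intro exI[of _ "\<lambda>t. if t \<le> 1/2 then f (2 * t) else g (2 * t - 1)"] exI[of _ M]) auto
qed

lemma lipschitz_linked_arc:
  assumes \<gamma>: "\<gamma> \<in> E" and s: "s \<in> {0..1}" "s' \<in> {0..1}"
  shows "lipschitz_linked (\<gamma> s) (\<gamma> s')"
proof -
  obtain \<Lambda> where \<Lambda>: "\<Lambda> \<ge> 0" "\<And>\<gamma>. \<gamma> \<in> E \<Longrightarrow> \<Lambda>-lipschitz_on {0..1} \<gamma>" using arc_lipschitz by blast
  have seg: "s + u * (s' - s) \<in> {0..1}" if "u \<in> {0..1}" for u
    using segment_unit_interval[OF s(2,1) that] .
  have "\<Lambda>-lipschitz_on {0..1} (\<lambda>u. \<gamma> (s + u * (s' - s)))"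
  proof (rule lipschitz_onI)
    fix u v :: real assume uv: "u \<in> {0..1}" "v \<in> {0..1}"
    have "dist (\<gamma> (s + u * (s' - s))) (\<gamma> (s + v * (s' - s))) \<le> \<Lambda> * dist (s + u * (s' - s)) (s + v * (s' - s))"
      using seg uv by (intro lipschitz_onD[OF \<Lambda>(2)[OF \<gamma>]])
    also have "dist (s + u * (s' - s)) (s + v * (s' - s)) = dist u v * \<bar>s' - s\<bar>"
    proof -
      have "(s + u * (s' - s)) - (s + v * (s' - s)) = (u - v) * (s' - s)" by (simp add: algebra_simps)
      then show ?thesis unfolding dist_real_def by (simp only: abs_mult)
    qed
    also have "\<dots> \<le> dist u v * 1" using s by (intro mult_left_mono) auto
    finally show "dist (\<gamma> (s + u * (s' - s))) (\<gamma> (s + v * (s' - s))) \<le> \<Lambda> * dist u v"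
      using \<Lambda>(1) by (simp add: mult_left_mono)
  qed (rule \<Lambda>(1))
  moreover have "(\<lambda>u. \<gamma> (s + u * (s' - s))) ` {0..1} \<subseteq> network_set E"
    using seg \<gamma> by (auto simp: network_set_def)
  ultimately show ?thesis
    unfolding lipschitz_linked_def by (intro exI[of _ "\<lambda>u. \<gamma> (s + u * (s' - s))"] exI[of _ \<Lambda>]) auto
qed

text \<open>Each point is joined to the start of an arc containing it, and the two starts by a chain
  of arcs, which exists since the network is connected.\<close>

lemma lipschitz_linked_network:
  assumes "x \<in> network_set E" "y \<in> network_set E"
  shows "lipschitz_linked x y"
proof -
  obtain \<gamma> s \<gamma>' s' where x: "\<gamma> \<in> E" "s \<in> {0..1}" "x = \<gamma> s" and y: "\<gamma>' \<in> E" "s' \<in> {0..1}" "y = \<gamma>' s'"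
    using assms by (auto simp: network_set_def)
  have "(\<gamma> 0, \<gamma>' 0) \<in> {(\<gamma> 0, \<gamma> 1) | \<gamma>. \<gamma> \<in> E}\<^sup>*"
    using x(1) y(1) by (intro connected_vertices) (auto simp: vertices_def)
  then have "lipschitz_linked (\<gamma> 0) (\<gamma>' 0)"
  proof (induction rule: rtrancl_induct)
    case base
    show ?case using lipschitz_linked_arc[OF x(1), of 0 0] by simp
  next
    case (step u v)
    then obtain \<gamma>'' where "\<gamma>'' \<in> E" "u = \<gamma>'' 0" "v = \<gamma>'' 1" by auto
    then have "lipschitz_linked u v" using lipschitz_linked_arc[of \<gamma>'' 0 1] by simp
    with step.IH show ?case by (rule lipschitz_linked_trans)
  qed
  moreover have "lipschitz_linked x (\<gamma> 0)" unfolding x(3) using x(1,2) by (intro lipschitz_linked_arc) auto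
  moreover have "lipschitz_linked (\<gamma>' 0) y" unfolding y(3) using y(1,2) by (intro lipschitz_linked_arc) auto
  ultimately show ?thesis using lipschitz_linked_trans by blast
qed

lemma lipschitz_curve_exists:
  fixes T :: real
  assumes "x \<in> network_set E" "y \<in> network_set E" and T: "T > 0"
  shows "\<exists>\<zeta> L. L-lipschitz_on {0..T} \<zeta> \<and> \<zeta> ` {0..T} \<subseteq> network_set E \<and> \<zeta> 0 = x \<and> \<zeta> T = y"
proof -
  obtain g L where g: "L-lipschitz_on {0..1} g" "g ` {0..1} \<subseteq> network_set E" "g 0 = x" "g (1::real) = y"
    using lipschitz_linked_network[OF assms(1,2)] unfolding lipschitz_linked_def by (elim exE conjE)
  have L0: "L \<ge> 0" using g(1) lipschitz_on_nonneg by blast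
  have "(L / T)-lipschitz_on {0..T} (\<lambda>t. g (t / T))"
  proof (rule lipschitz_onI)
    fix s t assume "s \<in> {0..T}" "t \<in> {0..T}"
    then have "dist (g (s / T)) (g (t / T)) \<le> L * dist (s / T) (t / T)"
      using T by (intro lipschitz_onD[OF g(1)]) auto
    also have "\<dots> = L / T * dist s t"
    proof -
      have "s / T - t / T = (s - t) / T" by (simp add: diff_divide_distrib)
      then show ?thesis using T unfolding dist_real_def by simp
    qed
    finally show "dist (g (s / T)) (g (t / T)) \<le> L / T * dist s t" .
  qed (use L0 T in simp)
  moreover have "(\<lambda>t. g (t / T)) ` {0..T} \<subseteq> network_set E"
    using g(2) T by (auto simp: image_subset_iff)
  ultimately show ?thesis
    using g(3,4) T by (intro exI[of _ "\<lambda>t. g (t / T)"] exI[of _ "L / T"]) auto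
qed

end

section \<open>Finiteness of the infimum and the direct method\<close>

context network_lagrangian
begin

text \<open>By the lower Lipschitz bound on arcs, the coordinate of a Lipschitz curve has speed at
  most L / \<kappa>, and Lagrangians are bounded at bounded speeds. Together with the connecting
  curves this shows that the infimum is below \<infinity>.\<close>

lemma lipschitz_finite_action:
  fixes \<zeta> :: "real \<Rightarrow> 'a"
  assumes \<zeta>: "L-lipschitz_on {0..T} \<zeta>" "\<zeta> ` {0..T} \<subseteq> network_set E" and T: "T > 0"
  shows "\<exists>K. action E H c T \<zeta> \<le> ereal K"
proof -
  have ac: "abs_continuous_on 0 T \<zeta>" using \<zeta>(1) by (rule lipschitz_on_imp_abs_continuous_on)
  obtain \<kappa> where \<kappa>: "\<kappa> > 0" "\<And>\<gamma> s s'. \<gamma> \<in> E \<Longrightarrow> s \<in> {0..1} \<Longrightarrow> s' \<in> {0..1} \<Longrightarrow> \<kappa> * \<bar>s - s'\<bar> \<le> norm (\<gamma> s - \<gamma> s')"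
    using bilipschitz by blast
  obtain C0 where C0: "\<And>\<gamma> s l. \<gamma> \<in> E \<Longrightarrow> s \<in> {0..1} \<Longrightarrow> \<bar>l\<bar> \<le> L / \<kappa> \<Longrightarrow> lagrangian \<gamma> s l \<le> C0"
    using lagrangian_bounded[of "L / \<kappa>"] by blast
  define C where "C = Max (insert C0 (c ` vertices E))"
  have fin: "finite (insert C0 (c ` vertices E))" using finite_vertices by simp
  have C: "C0 \<le> C" "\<And>v. v \<in> vertices E \<Longrightarrow> c v \<le> C"
    unfolding C_def by (rule Max_ge[OF fin], simp)+
  obtain \<rho> N where N: "negligible N" "\<forall>t\<in>{0<..<T} - N. regular_time T \<zeta> (\<rho> t) t"
    using curve_integrand_AE[OF ac \<zeta>(2) T] by (elim exE conjE)
  have "AE t in lebesgue_on {0..T}. integrand T \<zeta> t \<le> ereal C"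
  proof (rule AE_regular[OF N(1)])
    fix t assume t: "t \<in> {0<..<T} - N"
    then have reg: "regular_time T \<zeta> (\<rho> t) t" using N(2) by simp
    show "integrand T \<zeta> t \<le> ereal C"
    proof (cases "\<zeta> t \<in> vertices E")
      case True
      then show ?thesis using regular_time_vertex[OF reg True] C(2) by simp
    next
      case False
      obtain \<gamma> \<sigma> l \<delta> where *: "\<gamma> \<in> E" "\<delta> > 0" "\<forall>u. \<bar>u - t\<bar> < \<delta> \<longrightarrow> \<sigma> u \<in> {0<..<1} \<and> \<zeta> u = \<gamma> (\<sigma> u)"
        "(\<sigma> has_real_derivative l) (at t)" "integrand T \<zeta> t = ereal (lagrangian \<gamma> (\<sigma> t) l)"
        using regular_time_arc[OF reg False] by (elim exE conjE)
      define \<delta>' where "\<delta>' = min \<delta> (min t (T - t))"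
      have \<delta>': "\<delta>' > 0" using t *(2) by (simp add: \<delta>'_def)
      have "\<bar>\<sigma> u - \<sigma> t\<bar> \<le> L / \<kappa> * \<bar>u - t\<bar>" if u: "\<bar>u - t\<bar> < \<delta>'" for u
      proof -
        have su: "\<sigma> u \<in> {0..1}" "\<zeta> u = \<gamma> (\<sigma> u)" using *(3)[rule_format, of u] u by (auto simp: \<delta>'_def)
        have st: "\<sigma> t \<in> {0..1}" "\<zeta> t = \<gamma> (\<sigma> t)" using *(3)[rule_format, of t] *(2) by auto
        have "\<kappa> * \<bar>\<sigma> u - \<sigma> t\<bar> \<le> norm (\<zeta> u - \<zeta> t)" using \<kappa>(2)[OF *(1) su(1) st(1)] su st by simp
        also have "\<dots> \<le> L * \<bar>u - t\<bar>"
          using lipschitz_onD[OF \<zeta>(1), of u t] u t by (auto simp: \<delta>'_def dist_norm abs_if split: if_splits)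
        finally show ?thesis using \<kappa>(1) by (simp add: field_simps)
      qed
      then have "\<bar>l\<bar> \<le> L / \<kappa>" by (rule derivative_bounded_by_lipschitz[OF *(4) \<delta>'])
      moreover have "\<sigma> t \<in> {0..1}" using *(3)[rule_format, of t] *(2) by auto
      ultimately have "lagrangian \<gamma> (\<sigma> t) l \<le> C0" by (intro C0 *(1))
      then show ?thesis using *(5) C(1) by simp
    qed
  qed auto
  then have "action E H c T \<zeta> \<le> ereal_integral 0 T (\<lambda>_. ereal C)"
    unfolding action_def by (rule ereal_integral_mono_AE)
  also have "\<dots> = ereal (C * (T - 0))" using T by (intro ereal_integral_const) simp
  finally show ?thesis by blast
qed

lemma action_bounded_below:
  assumes T: "T > 0"
  shows "\<exists>K. \<forall>\<zeta>. ereal K \<le> action E H c T \<zeta>"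
proof -
  obtain B where B: "B \<ge> 0" "\<forall>T \<zeta> t. integrand T \<zeta> t \<ge> ereal (- B)"
    using integrand_bounded_below by (elim exE conjE)
  have "ereal (- B * (T - 0)) \<le> action E H c T \<zeta>" for \<zeta>
  proof -
    have "ereal (- B * (T - 0)) = ereal_integral 0 T (\<lambda>_. ereal (- B))" using T by (intro ereal_integral_const[symmetric]) simp
    also have "\<dots> \<le> action E H c T \<zeta>"
      unfolding action_def using B(2) by (intro ereal_integral_mono_AE always_eventually) auto
    finally show ?thesis .
  qed
  then show ?thesis by blast
qed

theorem minimizer_exists:
  assumes x: "x \<in> network_set E" and y: "y \<in> network_set E" and T: "T > 0"
  shows "\<exists>\<xi>. abs_continuous_on 0 T \<xi> \<and> \<xi> ` {0..T} \<subseteq> network_set E \<and> \<xi> 0 = x \<and> \<xi> T = y \<and>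
    (\<forall>\<zeta>. abs_continuous_on 0 T \<zeta> \<longrightarrow> \<zeta> 0 = x \<longrightarrow> \<zeta> T = y \<longrightarrow> action E H c T \<xi> \<le> action E H c T \<zeta>)"
proof -
  define \<A> where "\<A> = {\<zeta>. abs_continuous_on 0 T \<zeta> \<and> \<zeta> ` {0..T} \<subseteq> network_set E \<and> \<zeta> 0 = x \<and> \<zeta> T = y}"
  define I where "I = (INF \<zeta>\<in>\<A>. action E H c T \<zeta>)"
  obtain \<zeta>0 L where \<zeta>0: "L-lipschitz_on {0..T} \<zeta>0" "\<zeta>0 ` {0..T} \<subseteq> network_set E" "\<zeta>0 0 = x" "\<zeta>0 T = y"
    using lipschitz_curve_exists[OF x y T] by (elim exE conjE)
  have "\<zeta>0 \<in> \<A>" using \<zeta>0 by (simp add: \<A>_def lipschitz_on_imp_abs_continuous_on)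
  then have "I \<le> action E H c T \<zeta>0" unfolding I_def by (rule INF_lower)
  moreover obtain K where "action E H c T \<zeta>0 \<le> ereal K" using lipschitz_finite_action[OF \<zeta>0(1,2) T] by blast
  ultimately have "I \<le> ereal K" by (rule order_trans)
  moreover obtain K' where "\<And>\<zeta>. ereal K' \<le> action E H c T \<zeta>" using action_bounded_below[OF T] by blast
  then have "ereal K' \<le> I" unfolding I_def by (intro INF_greatest)
  \<comment> \<open>Finiteness of the infimum gives the minimizing sequence a common real bound on
    its actions, as \<open>uniformly_abs_continuous\<close> requires.\<close>
  ultimately obtain i where i: "I = ereal i" by (cases I) auto
  have "\<exists>\<zeta>. \<zeta> \<in> \<A> \<and> action E H c T \<zeta> \<le> ereal (i + 1 / real (Suc n))" for n
  proof -
    have "(INF \<zeta>\<in>\<A>. action E H c T \<zeta>) < ereal (i + 1 / real (Suc n))" using i by (simp add: I_def)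
    then obtain \<zeta> where "\<zeta> \<in> \<A>" "action E H c T \<zeta> < ereal (i + 1 / real (Suc n))" unfolding INF_less_iff by blast
    then show ?thesis by (intro exI[of _ \<zeta>]) simp
  qed
  then have "\<forall>n. \<exists>\<zeta>. \<zeta> \<in> \<A> \<and> action E H c T \<zeta> \<le> ereal (i + 1 / real (Suc n))" ..
  from choice[OF this] obtain \<zeta> where \<zeta>: "\<forall>n. \<zeta> n \<in> \<A> \<and> action E H c T (\<zeta> n) \<le> ereal (i + 1 / real (Suc n))" ..
  have \<zeta>_ac: "abs_continuous_on 0 T (\<zeta> n)" and \<zeta>_net: "\<zeta> n ` {0..T} \<subseteq> network_set E" and \<zeta>_ends: "\<zeta> n 0 = x" "\<zeta> n T = y" for n
    using \<zeta> by (auto simp: \<A>_def)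
  have \<zeta>_M: "action E H c T (\<zeta> n) \<le> ereal (i + 1)" for n
  proof -
    have "action E H c T (\<zeta> n) \<le> ereal (i + 1 / real (Suc n))" using \<zeta> by blast
    also have "\<dots> \<le> ereal (i + 1)" by (simp add: divide_le_eq)
    finally show ?thesis .
  qed
  obtain M where M: "\<And>z. z \<in> network_set E \<Longrightarrow> norm z \<le> M"
    using compact_imp_bounded[OF compact_network] unfolding bounded_iff by blast
  obtain \<xi> k where \<xi>: "continuous_on {0..T} \<xi>" "strict_mono (k :: nat \<Rightarrow> nat)"
    "\<And>e. 0 < e \<Longrightarrow> \<exists>N. \<forall>n t. n \<ge> N \<and> t \<in> {0..T} \<longrightarrow> norm (\<zeta> (k n) t - \<xi> t) < e"
  proof (rule Arzela_Ascoli[of "{0..T}" \<zeta> M])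
    show "norm (\<zeta> n t) \<le> M" if "t \<in> {0..T}" for n t using M \<zeta>_net[of n] that by (auto simp: image_subset_iff)
    fix t e :: real assume t: "t \<in> {0..T}" and e: "0 < e"
    \<comment> \<open>Families with a single interval turn uniform absolute continuity into
      equicontinuity.\<close>
    obtain \<delta> where \<delta>: "\<delta> > 0" "\<forall>\<zeta> (J :: unit set) l r. abs_continuous_on 0 T \<zeta> \<longrightarrow> \<zeta> ` {0..T} \<subseteq> network_set E \<longrightarrow>
       action E H c T \<zeta> \<le> ereal (i + 1) \<longrightarrow> interval_family 0 T J l r \<longrightarrow> (\<Sum>j\<in>J. r j - l j) < \<delta> \<longrightarrow>
       (\<Sum>j\<in>J. norm (\<zeta> (r j) - \<zeta> (l j))) < e"
      using uniformly_abs_continuous[OF T e, where M = "i + 1" and 'i = unit] by (elim exE conjE)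
    have close: "norm (\<zeta> n v - \<zeta> n u) < e" if "0 \<le> u" "u \<le> v" "v \<le> T" "v - u < \<delta>" for n u v
      using \<delta>(2)[rule_format, OF \<zeta>_ac \<zeta>_net \<zeta>_M, of "{()}" "\<lambda>_. u" "\<lambda>_. v" n] that by (simp add: interval_family_single)
    have "norm (\<zeta> n t - \<zeta> n u) < e" if "u \<in> {0..T}" "norm (t - u) < \<delta>" for n u
      using close[of u t n] close[of t u n] that t by (cases "u \<le> t") (auto simp: norm_minus_commute)
    then show "\<exists>d. 0 < d \<and> (\<forall>n u. u \<in> {0..T} \<and> norm (t - u) < d \<longrightarrow> norm (\<zeta> n t - \<zeta> n u) < e)"
      using \<delta>(1) by blast
  qed auto
  have lim: "(\<lambda>n. \<zeta> (k n) t) \<longlonglongrightarrow> \<xi> t" if "t \<in> {0..T}" for t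
    unfolding LIMSEQ_iff using \<xi>(3) that by blast
  have \<xi>_net: "\<xi> ` {0..T} \<subseteq> network_set E"
  proof
    fix z assume "z \<in> \<xi> ` {0..T}"
    then obtain t where t: "t \<in> {0..T}" "z = \<xi> t" by auto
    show "z \<in> network_set E" unfolding t(2)
      using \<zeta>_net t(1)
      by (intro closed_sequentially[OF compact_imp_closed[OF compact_network] _ lim[OF t(1)]]) (auto simp: image_subset_iff)
  qed
  have \<xi>_ends: "\<xi> 0 = x" "\<xi> T = y"
    using LIMSEQ_unique[OF lim[of 0]] LIMSEQ_unique[OF lim[of T]] \<zeta>_ends T by auto
  have \<xi>_ac: "abs_continuous_on 0 T \<xi>"
  proof (rule abs_continuous_onI)
    fix e :: real assume "e > 0"
    \<comment> \<open>The strict bound becomes weak in the limit, so half of \<open>e\<close> is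
      used for the sequence.\<close>
    then have e2: "e / 2 > 0" by simp
    obtain \<delta> where \<delta>: "\<delta> > 0" "\<forall>\<zeta> (J :: real set set) l r. abs_continuous_on 0 T \<zeta> \<longrightarrow> \<zeta> ` {0..T} \<subseteq> network_set E \<longrightarrow>
       action E H c T \<zeta> \<le> ereal (i + 1) \<longrightarrow> interval_family 0 T J l r \<longrightarrow> (\<Sum>j\<in>J. r j - l j) < \<delta> \<longrightarrow>
       (\<Sum>j\<in>J. norm (\<zeta> (r j) - \<zeta> (l j))) < e / 2"
      using uniformly_abs_continuous[OF T e2, where M = "i + 1" and 'i = "real set"] by (elim exE conjE)
    show "\<exists>\<delta>>0. \<forall>J c d. interval_family 0 T (J :: real set set) c d \<longrightarrow> (\<Sum>j\<in>J. d j - c j) < \<delta> \<longrightarrow>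
        (\<Sum>j\<in>J. norm (\<xi> (d j) - \<xi> (c j))) < e"
    proof (intro exI conjI allI impI)
      fix J :: "real set set" and l r assume J: "interval_family 0 T J l r" "(\<Sum>j\<in>J. r j - l j) < \<delta>"
      have "(\<lambda>n. \<Sum>j\<in>J. norm (\<zeta> (k n) (r j) - \<zeta> (k n) (l j))) \<longlonglongrightarrow> (\<Sum>j\<in>J. norm (\<xi> (r j) - \<xi> (l j)))"
        using J(1) by (intro tendsto_sum tendsto_norm tendsto_diff lim) (auto simp: interval_family_def intro: order_trans)
      moreover have "(\<Sum>j\<in>J. norm (\<zeta> (k n) (r j) - \<zeta> (k n) (l j))) \<le> e / 2" for n
        using \<delta>(2)[rule_format, OF \<zeta>_ac \<zeta>_net \<zeta>_M J, of "k n"] by simp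
      ultimately have "(\<Sum>j\<in>J. norm (\<xi> (r j) - \<xi> (l j))) \<le> e / 2"
        by (intro LIMSEQ_le_const2) auto
      then show "(\<Sum>j\<in>J. norm (\<xi> (r j) - \<xi> (l j))) < e" using \<open>e > 0\<close> by simp
    qed (rule \<delta>(1))
  qed
  have "(\<lambda>n. i + 1 / real (Suc (k n))) \<longlonglongrightarrow> i"
  proof -
    have "(\<lambda>n. 1 / real (Suc n)) \<longlonglongrightarrow> 0" by (rule LIMSEQ_inverse_real_of_nat[unfolded inverse_eq_divide])
    then have "(\<lambda>n. 1 / real (Suc (k n))) \<longlonglongrightarrow> 0"
      using LIMSEQ_subseq_LIMSEQ[OF _ \<xi>(2)] by (fastforce simp: o_def)
    then show ?thesis using tendsto_add[OF tendsto_const[of i]] by fastforce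
  qed
  then have "action E H c T \<xi> \<le> ereal i"
    using \<zeta> by (intro action_lower_semicontinuous[OF T \<zeta>_ac \<zeta>_net \<xi>_ac \<xi>_net lim]) auto
  then have \<xi>_min: "action E H c T \<xi> \<le> I" using i by simp
  have "action E H c T \<xi> \<le> action E H c T \<eta>"
    if \<eta>: "abs_continuous_on 0 T \<eta>" "\<eta> 0 = x" "\<eta> T = y" for \<eta>
  proof (cases "\<eta> ` {0..T} \<subseteq> network_set E")
    case True
    then have "I \<le> action E H c T \<eta>" unfolding I_def using \<eta> by (intro INF_lower) (simp add: \<A>_def)
    with \<xi>_min show ?thesis by (rule order_trans)
  next
    case False
    then show ?thesis using action_off_network[OF \<eta>(1) T] by simp
  qed
  then show ?thesis using \<xi>_ac \<xi>_net \<xi>_ends by blast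
qed

end

section \<open>Admissible minimizers\<close>

text \<open>\<open>vector_derivative\<close> is a choice from the set of derivatives, so curves with
  the same derivatives get the same value, even where none exists. Integrands therefore agree at
  every such time.\<close>

lemma vector_derivative_within_cong:
  fixes f g :: "real \<Rightarrow> 'b::real_normed_vector"
  assumes "d > 0" "t \<in> S" "\<And>u. u \<in> S \<Longrightarrow> dist u t < d \<Longrightarrow> f u = g u"
  shows "vector_derivative f (at t within S) = vector_derivative g (at t within S)"
proof -
  have "(f has_vector_derivative D) (at t within S) \<longleftrightarrow> (g has_vector_derivative D) (at t within S)" for D
    using has_vector_derivative_transform_within[of f D t S d g] has_vector_derivative_transform_within[of g D t S d f] assms
    by (metis (no_types, lifting))
  then show ?thesis unfolding vector_derivative_def by simp
qed

text \<open>The hat function, whose integer translates form a partition of unity.\<close>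

definition tent :: "real \<Rightarrow> real" where "tent x = max 0 (1 - \<bar>x\<bar>)"

lemma sum_tent:
  assumes "0 \<le> x" "x \<le> real n"
  shows "(\<Sum>k\<le>n. tent (x - real k)) = 1"
  using assms
proof (induction n)
  case 0
  then show ?case by (simp add: tent_def)
next
  case (Suc n)
  show ?case
  proof (cases "x \<le> real n")
    case True
    then show ?thesis using Suc by (simp add: tent_def)
  next
    case False
    have "(\<Sum>k\<le>n. tent (x - real k)) = (\<Sum>k\<in>{n}. tent (x - real k))"
      using False by (intro sum.mono_neutral_right) (auto simp: tent_def)
    then show ?thesis using False Suc.prems by (simp add: tent_def)
  qed
qed

lemma continuous_tent: "continuous_on S tent"
  unfolding tent_def by (intro continuous_intros)

text \<open>A momentum that works at one \<open>s\<close> works nearby. A Lebesgue number gives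
  constant choices on the supports of a partition of unity, and convexity of \<open>h s\<close>
  keeps their weighted average strictly below \<open>K\<close>.\<close>

lemma convex_continuous_selection:
  fixes h :: "real \<Rightarrow> real \<Rightarrow> real"
  assumes cont: "\<And>\<mu>. continuous_on {0..1} (\<lambda>s. h s \<mu>)" and conv: "\<And>s. s \<in> {0..1} \<Longrightarrow> convex_on UNIV (h s)"
    and ex: "\<And>s. s \<in> {0..1} \<Longrightarrow> \<exists>\<mu>. h s \<mu> < K"
  shows "\<exists>p. continuous_on {0..1} p \<and> (\<forall>s\<in>{0..1}. h s (p s) < K)"
proof -
  have "\<exists>U. open U \<and> U \<inter> {0..1} = (\<lambda>s. h s \<mu>) -` {..<K} \<inter> {0..1}" for \<mu>
    by (rule cont[of \<mu>, unfolded continuous_on_open_invariant, rule_format, OF open_lessThan])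
  then have "\<forall>\<mu>. \<exists>U. open U \<and> U \<inter> {0..1} = (\<lambda>s. h s \<mu>) -` {..<K} \<inter> {0..1}" ..
  from choice[OF this] obtain U where U: "\<forall>\<mu>. open (U \<mu>) \<and> U \<mu> \<inter> {0..1} = (\<lambda>s. h s \<mu>) -` {..<K} \<inter> {0..1}" ..
  have Ui: "s \<in> U \<mu> \<longleftrightarrow> h s \<mu> < K" if "s \<in> {0..1}" for s \<mu> using U that by blast
  have cov: "{0..1} \<subseteq> \<Union>(range U)" using ex Ui by blast
  have ne: "range U \<noteq> {}" by simp
  have op: "open B" if "B \<in> range U" for B using U that by blast
  have "\<exists>\<delta>>0. \<forall>T. T \<subseteq> {0..1} \<longrightarrow> diameter T < \<delta> \<longrightarrow> (\<exists>V\<in>range U. T \<subseteq> V)"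
  proof (rule Lebesgue_number_lemma[OF compact_Icc ne cov op])
    fix \<delta> :: real
    assume "0 < \<delta>" "\<And>T. T \<subseteq> {0..1} \<Longrightarrow> diameter T < \<delta> \<Longrightarrow> \<exists>V\<in>range U. T \<subseteq> V"
    then show ?thesis by (intro exI[of _ \<delta>] conjI allI impI)
  qed
  then obtain \<delta> where \<delta>: "\<delta> > 0" "\<forall>T. T \<subseteq> {0..1} \<longrightarrow> diameter T < \<delta> \<longrightarrow> (\<exists>V\<in>range U. T \<subseteq> V)"
    by (elim exE conjE)
  \<comment> \<open>A tent of the grid with mesh 1 / n has support of width 2 / n, which has to be
    below the Lebesgue number.\<close>
  obtain n :: nat where n: "n > 0" "2 / \<delta> < real n"
    using reals_Archimedean2[of "max 0 (2 / \<delta>)"] by (metis max_less_iff_conj of_nat_0_less_iff)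
  define J where "J k = {s \<in> {0..1}. \<bar>real n * s - real k\<bar> \<le> 1}" for k
  have "\<exists>\<mu>. \<forall>s\<in>J k. h s \<mu> < K" for k
  proof -
    have "\<bar>s - t\<bar> \<le> 2 / real n" if "s \<in> J k" "t \<in> J k" for s t
    proof -
      have "\<bar>real n * s - real n * t\<bar> \<le> 2" using that by (auto simp: J_def)
      then have "real n * \<bar>s - t\<bar> \<le> 2" by (simp flip: right_diff_distrib add: abs_mult)
      then show ?thesis using n by (simp add: field_simps)
    qed
    then have "diameter (J k) \<le> 2 / real n" by (intro diameter_le) (auto simp: dist_real_def)
    also have "2 / real n < \<delta>" using n \<delta>(1) by (simp add: field_simps)
    finally have "diameter (J k) < \<delta>" .
    moreover have "J k \<subseteq> {0..1}" by (auto simp: J_def)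
    ultimately obtain \<mu> where "J k \<subseteq> U \<mu>" using \<delta>(2)[rule_format, of "J k"] by blast
    then show ?thesis using Ui by (auto simp: J_def)
  qed
  then have "\<forall>k. \<exists>\<mu>. \<forall>s\<in>J k. h s \<mu> < K" ..
  from choice[OF this] obtain \<mu> where \<mu>: "\<forall>k. \<forall>s\<in>J k. h s (\<mu> k) < K" ..
  define p where "p s = (\<Sum>k\<le>n. tent (real n * s - real k) * \<mu> k)" for s
  have "continuous_on {0..1} p"
    unfolding p_def by (intro continuous_intros continuous_on_compose2[OF continuous_tent[of UNIV]]) auto
  moreover have "h s (p s) < K" if s: "s \<in> {0..1}" for s
  proof -
    let ?w = "\<lambda>k. tent (real n * s - real k)"
    have sum1: "(\<Sum>k\<le>n. ?w k) = 1" using s by (intro sum_tent) (auto simp: mult_left_le)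
    have "h s (p s) \<le> (\<Sum>k\<le>n. ?w k * h s (\<mu> k))"
      using convex_on_sum[OF _ _ conv[OF s] sum1, of \<mu>] by (simp add: p_def tent_def)
    also have "\<dots> < (\<Sum>k\<le>n. ?w k * K)"
    proof (rule sum_strict_mono_ex1)
      have in_J: "s \<in> J k" if "?w k > 0" for k using s that by (auto simp: J_def tent_def split: if_splits)
      show "\<forall>k\<in>{..n}. ?w k * h s (\<mu> k) \<le> ?w k * K"
      proof
        fix k
        show "?w k * h s (\<mu> k) \<le> ?w k * K"
        proof (cases "?w k > 0")
          case True
          then have "h s (\<mu> k) < K" using \<mu> in_J by blast
          then show ?thesis using True by (intro mult_left_mono) auto
        next
          case False
          then have "?w k = 0" by (simp add: tent_def)
          then show ?thesis by simp
        qed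
      qed
      \<comment> \<open>Strictness of the averaged inequality needs one positive weight, which
        exists because the weights add up to 1.\<close>
      have "\<exists>k\<in>{..n}. ?w k > 0"
      proof (rule ccontr)
        assume "\<not> (\<exists>k\<in>{..n}. ?w k > 0)"
        then have "(\<Sum>k\<le>n. ?w k) \<le> 0" by (intro sum_nonpos) (auto simp: not_less)
        then show False using sum1 by simp
      qed
      then obtain k where "k \<in> {..n}" "?w k > 0" by blast
      moreover from this have "h s (\<mu> k) < K" using \<mu> in_J by blast
      ultimately show "\<exists>k\<in>{..n}. ?w k * h s (\<mu> k) < ?w k * K" by (intro bexI[of _ k]) auto
    qed simp
    also have "\<dots> = K" using sum1 by (simp flip: sum_distrib_right)
    finally show ?thesis .
  qed
  ultimately show ?thesis by blast
qed

text \<open>A multiple of a bump supported in \<open>{0..\<eta>}\<close> corrects the mean. It is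
  applied on an initial piece of an arc that the curve in question never reaches.\<close>

lemma mean_zero_modification:
  fixes p :: "real \<Rightarrow> real"
  assumes p: "continuous_on {0..1} p" and \<eta>: "0 < \<eta>" "\<eta> \<le> 1"
  shows "\<exists>q. continuous_on {0..1} q \<and> integral {0..1} q = 0 \<and> (\<forall>s\<in>{\<eta>..1}. q s = p s)"
proof -
  define b where "b s = max 0 (\<eta> - s)" for s
  have b: "continuous_on {0..1} b" unfolding b_def by (intro continuous_intros)
  have "integral {0..1} b \<noteq> 0"
  proof
    assume "integral {0..1} b = 0"
    then have "\<forall>s\<in>{0..1}. b s = 0"
      using b by (subst (asm) integral_eq_0_iff) (auto simp: b_def)
    then have "b 0 = 0" by auto
    then show False using \<eta> by (simp add: b_def)
  qed
  define k where "k = - integral {0..1} p / integral {0..1} b"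
  have "integral {0..1} (\<lambda>s. p s + k * b s) = integral {0..1} p + k * integral {0..1} b"
    using p b by (simp add: Henstock_Kurzweil_Integration.integral_add integrable_continuous_interval continuous_on_mult_left)
  also have "\<dots> = 0" using \<open>integral {0..1} b \<noteq> 0\<close> by (simp add: k_def)
  finally show ?thesis
    using p b by (intro exI[of _ "\<lambda>s. p s + k * b s"]) (auto intro!: continuous_intros simp: b_def)
qed

text \<open>Increments of \<open>g\<close> are compared with those of \<open>f\<close> on a smaller
  interval, which cannot lengthen a family. This suits a curve stopped for some time at a point to
  which it returns.\<close>

lemma abs_continuous_on_shrink:
  fixes f g :: "real \<Rightarrow> 'b::euclidean_space"
  assumes f: "abs_continuous_on a b f"
    and g: "\<And>u v. a \<le> u \<Longrightarrow> u \<le> v \<Longrightarrow> v \<le> b \<Longrightarrow>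
      \<exists>u' v'. u \<le> u' \<and> u' \<le> v' \<and> v' \<le> v \<and> norm (g v - g u) \<le> norm (f v' - f u')"
  shows "abs_continuous_on a b g"
proof (rule abs_continuous_onI)
  fix \<epsilon> :: real assume "\<epsilon> > 0"
  from abs_continuous_onD[OF f \<open>\<epsilon> > 0\<close>, where 'i = "real set"]
  obtain \<delta> where \<delta>: "\<delta> > 0" "\<And>(J :: real set set) c d. interval_family a b J c d \<Longrightarrow> (\<Sum>j\<in>J. d j - c j) < \<delta> \<Longrightarrow>
        (\<Sum>j\<in>J. norm (f (d j) - f (c j))) < \<epsilon>" by blast
  show "\<exists>\<delta>>0. \<forall>J c d. interval_family a b (J :: real set set) c d \<longrightarrow> (\<Sum>j\<in>J. d j - c j) < \<delta> \<longrightarrow>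
        (\<Sum>j\<in>J. norm (g (d j) - g (c j))) < \<epsilon>"
  proof (intro exI conjI allI impI)
    fix J :: "real set set" and c d
    assume J: "interval_family a b J c d" "(\<Sum>j\<in>J. d j - c j) < \<delta>"
    have "\<forall>j\<in>J. \<exists>z. c j \<le> fst z \<and> fst z \<le> snd z \<and> snd z \<le> d j \<and> norm (g (d j) - g (c j)) \<le> norm (f (snd z) - f (fst z))"
      using J(1) g unfolding interval_family_def by simp
    from bchoice[OF this] obtain z where z: "\<forall>j\<in>J. c j \<le> fst (z j) \<and> fst (z j) \<le> snd (z j) \<and> snd (z j) \<le> d j \<and>
        norm (g (d j) - g (c j)) \<le> norm (f (snd (z j)) - f (fst (z j)))" ..
    have "interval_family a b J (\<lambda>j. fst (z j)) (\<lambda>j. snd (z j))"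
      using z by (intro interval_family_shrink[OF J(1)]) auto
    moreover have "(\<Sum>j\<in>J. snd (z j) - fst (z j)) \<le> (\<Sum>j\<in>J. d j - c j)"
      using z by (intro sum_mono) fastforce
    then have "(\<Sum>j\<in>J. snd (z j) - fst (z j)) < \<delta>" using J(2) by simp
    ultimately have "(\<Sum>j\<in>J. norm (f (snd (z j)) - f (fst (z j)))) < \<epsilon>" by (rule \<delta>(2))
    moreover have "(\<Sum>j\<in>J. norm (g (d j) - g (c j))) \<le> (\<Sum>j\<in>J. norm (f (snd (z j)) - f (fst (z j))))"
      using z by (intro sum_mono) auto
    ultimately show "(\<Sum>j\<in>J. norm (g (d j) - g (c j))) < \<epsilon>" by simp
  qed (rule \<delta>(1))
qed

section \<open>Comparison of loops with rests\<close>

context network_lagrangian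
begin

text \<open>The trace \<open>R\<close> of the loop misses the far end of every arc into
  \<open>v\<close>. An initial piece of each such arc is thus free for restoring mean zero, while
  along the rest the flux limiter allows a Hamiltonian below \<open>- c v + \<epsilon>\<close>. The
  loop is closed, so the potential difference is zero and only the constant \<open>G\<close> on
  \<open>R\<close> remains.\<close>

theorem loop_action:
  fixes \<zeta> :: "real \<Rightarrow> 'a"
  assumes \<zeta>: "abs_continuous_on 0 T \<zeta>" "\<zeta> ` {0..T} \<subseteq> network_set E" and T: "T > 0"
    and ab: "0 \<le> a" "a \<le> b" "b \<le> T" and v: "v \<in> vertices E" "\<zeta> a = v" "\<zeta> b = v"
    and only: "\<And>t. t \<in> {a..b} \<Longrightarrow> \<zeta> t \<in> vertices E \<Longrightarrow> \<zeta> t = v"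
  shows "ereal (c v * (b - a)) \<le> ereal_integral a b (integrand T \<zeta>)"
proof -
  have cont: "continuous_on {a..b} \<zeta>"
    using continuous_on_subset[OF abs_continuous_on_imp_continuous_on[OF \<zeta>(1)]] ab by auto
  have net: "\<zeta> ` {a..b} \<subseteq> network_set E" using \<zeta>(2) ab by (auto simp: image_subset_iff)
  define R where "R = \<zeta> ` {a..b}"
  have R: "compact R" "R \<noteq> {}" using cont ab by (auto simp: R_def intro: compact_continuous_image)
  have vR: "w = v" if "w \<in> vertices E" "w \<in> R" for w using only that by (auto simp: R_def)
  have lower: "ereal ((c v - \<epsilon>) * (b - a)) \<le> ereal_integral a b (integrand T \<zeta>)" if "\<epsilon> > 0" for \<epsilon>
  proof -
    have "\<exists>q. continuous_on {0..1} q \<and> integral {0..1} q = 0 \<and> (\<forall>s\<in>{0..1}. \<gamma> s \<in> R \<longrightarrow> H \<gamma> s (q s) < - c v + \<epsilon>)"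
      if \<gamma>: "\<gamma> \<in> arcs_into E v" for \<gamma>
    proof -
      have \<gamma>E: "\<gamma> \<in> E" "\<gamma> 1 = v" using \<gamma> by (auto simp: arcs_into_def)
      have ex: "\<exists>\<mu>. H \<gamma> s \<mu> < - c v + \<epsilon>" if "s \<in> {0..1}" for s
        using flux_limiter_subsolution[OF \<gamma>E that \<open>\<epsilon> > 0\<close>] by metis
      \<comment> \<open>The momenta supplied by the flux limiter depend on \<open>s\<close> in an
        arbitrary way; convexity of \<open>H\<close> makes a continuous choice possible.\<close>
      have "\<exists>p. continuous_on {0..1} p \<and> (\<forall>s\<in>{0..1}. H \<gamma> s (p s) < - c v + \<epsilon>)"
        by (rule convex_continuous_selection) (rule H_continuous_s[OF \<gamma>E(1)], rule H_convex[OF \<gamma>E(1)], assumption, rule ex)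
      then obtain p where p: "continuous_on {0..1} p" "\<forall>s\<in>{0..1}. H \<gamma> s (p s) < - c v + \<epsilon>"
        by (elim exE conjE)
      have "\<gamma> 0 \<in> vertices E" "\<gamma> 0 \<noteq> v" using no_loops[OF \<gamma>E(1)] \<gamma>E by (auto simp: vertices_def)
      then have "\<gamma> 0 \<in> - R" using vR by blast
      have "openin (top_of_set {0..1}) ({0..1} \<inter> \<gamma> -` (- R))"
        using continuous_arc[OF \<gamma>E(1)] open_Compl[OF compact_imp_closed[OF R(1)]] by (rule continuous_openin_preimage_gen)
      moreover have "0 \<in> {0..1} \<inter> \<gamma> -` (- R)" using \<open>\<gamma> 0 \<in> - R\<close> by simp
      ultimately obtain e where e: "e > 0" "ball 0 e \<inter> {0..1} \<subseteq> {0..1} \<inter> \<gamma> -` (- R)"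
        unfolding openin_contains_ball by blast
      define \<eta> where "\<eta> = min e 1"
      have \<eta>: "0 < \<eta>" "\<eta> \<le> 1" using e(1) by (auto simp: \<eta>_def)
      obtain q where q: "continuous_on {0..1} q" "integral {0..1} q = 0" "\<forall>s\<in>{\<eta>..1}. q s = p s"
        using mean_zero_modification[OF p(1) \<eta>] by (elim exE conjE)
      have "H \<gamma> s (q s) < - c v + \<epsilon>" if s: "s \<in> {0..1}" "\<gamma> s \<in> R" for s
      proof -
        have "s \<notin> ball 0 e" using e(2) s by blast
        then have "s \<in> {\<eta>..1}" using s(1) by (auto simp: \<eta>_def dist_real_def)
        then show ?thesis using q(3) p(2) s(1) by simp
      qed
      then show ?thesis using q(1,2) by blast
    qed
    then have "\<forall>\<gamma>\<in>arcs_into E v. \<exists>q. continuous_on {0..1} q \<and> integral {0..1} q = 0 \<and>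
      (\<forall>s\<in>{0..1}. \<gamma> s \<in> R \<longrightarrow> H \<gamma> s (q s) < - c v + \<epsilon>)" ..
    from bchoice[OF this] obtain q where q: "\<forall>\<gamma>\<in>arcs_into E v. continuous_on {0..1} (q \<gamma>) \<and> integral {0..1} (q \<gamma>) = 0 \<and>
      (\<forall>s\<in>{0..1}. \<gamma> s \<in> R \<longrightarrow> H \<gamma> s (q \<gamma> s) < - c v + \<epsilon>)" ..
    show ?thesis
    proof (rule subsolution_exists[OF R arcs_into_properties(1,2), of v q "- c v + \<epsilon>"])
      show "continuous_on {0..1} (q \<gamma>)" "integral {0..1} (q \<gamma>) = 0" if "\<gamma> \<in> arcs_into E v" for \<gamma>
        using q that by blast+
      show "H \<gamma> s (q \<gamma> s) < - c v + \<epsilon>" if "\<gamma> \<in> arcs_into E v" "s \<in> {0..1}" "\<gamma> s \<in> R" for \<gamma> s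
        using q that by blast
      show "- c w < - c v + \<epsilon>" if "w \<in> vertices E" "w \<in> R" for w using vR[OF that] \<open>\<epsilon> > 0\<close> by simp
      \<comment> \<open>To reach an arc that does not touch \<open>v\<close>, the loop would have to
        pass through an end of that arc, a vertex other than \<open>v\<close>.\<close>
      show "\<gamma> s \<notin> R" if \<gamma>: "\<gamma> \<in> E" "\<gamma> \<notin> arcs_into E v" "inverse_arc \<gamma> \<notin> arcs_into E v" and s: "s \<in> {0..1}" for \<gamma> s
      proof
        assume "\<gamma> s \<in> R"
        then obtain t where t0: "t \<in> {a..b}" "\<gamma> s = \<zeta> t" by (auto simp: R_def)
        then have "\<zeta> t \<in> \<gamma> ` {0..1}" using imageI[OF s, of \<gamma>] by simp
        note t = t0(1) this
        have no_v: "v \<notin> \<gamma> ` {0..1}" using arcs_into_properties(3)[OF \<gamma> v(1)] by blast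
        have "a \<in> {a..b}" using ab by simp
        moreover have "\<zeta> a \<notin> \<gamma> ` {0<..<1}" using no_v v(2) by auto
        ultimately obtain w where "w \<in> {a..b}" "\<zeta> w \<in> vertices E" "\<zeta> w \<in> \<gamma> ` {0..1}"
          by (rule vertex_between[OF cont net \<gamma>(1) t])
        then show False using only[of w] no_v by simp
      qed
      fix p G assume pG: "subsolution p G" "\<And>\<gamma>. \<gamma> \<in> arcs_into E v \<Longrightarrow> p \<gamma> = q \<gamma>" "\<And>x. x \<in> R \<Longrightarrow> G x = - c v + \<epsilon>"
      have "integral {a..b} (\<lambda>t. G (\<zeta> t)) = integral {a..b} (\<lambda>t. - c v + \<epsilon>)"
        using pG(3) by (intro integral_cong) (auto simp: R_def)
      also have "\<dots> = (- c v + \<epsilon>) * (b - a)" using ab by (simp add: mult.commute)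
      finally have "ereal ((c v - \<epsilon>) * (b - a)) = ereal (potential p (\<zeta> b) - potential p (\<zeta> a) - integral {a..b} (\<lambda>t. G (\<zeta> t)))"
        using v(2,3) by (simp add: algebra_simps)
      also have "\<dots> \<le> ereal_integral a b (integrand T \<zeta>)" by (rule action_ge_subsolution[OF pG(1) \<zeta> T ab])
      finally show "ereal ((c v - \<epsilon>) * (b - a)) \<le> ereal_integral a b (integrand T \<zeta>)" .
    qed
  qed
  show ?thesis
  proof (rule ereal_le_epsilon2)
    fix e :: real assume "e > 0"
    \<comment> \<open>The summand 1 in the denominator avoids division by zero when
      \<open>a = b\<close>.\<close>
    define \<epsilon> where "\<epsilon> = e / (b - a + 1)"
    have \<epsilon>: "\<epsilon> > 0" "\<epsilon> * (b - a) \<le> e" using \<open>e > 0\<close> ab by (auto simp: \<epsilon>_def field_simps)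
    have "ereal (c v * (b - a)) \<le> ereal ((c v - \<epsilon>) * (b - a)) + ereal e" using \<epsilon>(2) by (simp add: algebra_simps)
    also have "\<dots> \<le> ereal_integral a b (integrand T \<zeta>) + ereal e" using lower[OF \<epsilon>(1)] by (rule add_right_mono)
    finally show "ereal (c v * (b - a)) \<le> ereal_integral a b (integrand T \<zeta>) + ereal e" .
  qed
qed

lemma rest_at_vertex:
  fixes \<zeta> :: "real \<Rightarrow> 'a"
  assumes \<zeta>: "abs_continuous_on 0 T \<zeta>" "\<zeta> ` {0..T} \<subseteq> network_set E" and T: "T > 0"
    and ab: "0 \<le> a" "a \<le> b" "b \<le> T" and v: "v \<in> vertices E" "\<zeta> a = v" "\<zeta> b = v"
    and only: "\<And>t. t \<in> {a..b} \<Longrightarrow> \<zeta> t \<in> vertices E \<Longrightarrow> \<zeta> t = v"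
  defines "\<xi> \<equiv> \<lambda>t. if t \<in> {a..b} then v else \<zeta> t"
  shows "abs_continuous_on 0 T \<xi>" "\<xi> ` {0..T} \<subseteq> network_set E" "action E H c T \<xi> \<le> action E H c T \<zeta>"
proof -
  show "abs_continuous_on 0 T \<xi>"
  \<comment> \<open>If one end of the interval lies in \<open>{a..b}\<close>, the stopped curve has
    there the value of \<zeta> at \<open>a\<close> or \<open>b\<close>, whichever lies between the
    two times; the increment is then one of \<zeta> on a subinterval.\<close>
  proof (rule abs_continuous_on_shrink[OF \<zeta>(1)])
    fix s t assume st: "0 \<le> s" "s \<le> t" "t \<le> T"
    consider "s \<in> {a..b}" "t \<in> {a..b}" | "s \<in> {a..b}" "t \<notin> {a..b}" | "s \<notin> {a..b}" "t \<in> {a..b}" | "s \<notin> {a..b}" "t \<notin> {a..b}"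
      by blast
    then show "\<exists>u' v'. s \<le> u' \<and> u' \<le> v' \<and> v' \<le> t \<and> norm (\<xi> t - \<xi> s) \<le> norm (\<zeta> v' - \<zeta> u')"
    proof cases
      case 1 then show ?thesis using st by (intro exI[of _ s]) (auto simp: \<xi>_def)
    next
      case 2 then show ?thesis using st v by (intro exI[of _ b] exI[of _ t]) (auto simp: \<xi>_def)
    next
      case 3 then show ?thesis using st v by (intro exI[of _ s] exI[of _ a]) (auto simp: \<xi>_def)
    next
      case 4 then show ?thesis using st by (intro exI[of _ s] exI[of _ t]) (auto simp: \<xi>_def)
    qed
  qed
  show "\<xi> ` {0..T} \<subseteq> network_set E"
    using \<zeta>(2) v(1) vertices_subset by (auto simp: \<xi>_def image_subset_iff)
  \<comment> \<open>Derivatives are local: around a time outside the closed interval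
    \<open>{a..b}\<close> the two curves coincide.\<close>
  have same: "integrand T \<xi> t = integrand T \<zeta> t" if t: "t \<in> {0..T}" "t \<notin> {a..b}" for t
  proof -
    define d where "d = (if t < a then a - t else t - b)"
    have "d > 0" using t by (auto simp: d_def)
    moreover have "\<xi> u = \<zeta> u" if "dist u t < d" for u
      using that t by (auto simp: \<xi>_def d_def dist_real_def split: if_splits)
    ultimately have "vector_derivative \<xi> (at t within {0..T}) = vector_derivative \<zeta> (at t within {0..T})"
      using t(1) by (intro vector_derivative_within_cong[of d]) auto
    moreover have "\<xi> t = \<zeta> t" using t by (auto simp: \<xi>_def)
    ultimately show ?thesis by simp
  qed
  have rest: "integrand T \<xi> t = ereal (c v)" if t: "t \<in> {a<..<b}" for t
  proof -
    have "((\<lambda>_. v) has_vector_derivative 0) (at t)" by simp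
    then have "(\<xi> has_vector_derivative 0) (at t)"
      by (rule has_vector_derivative_transform_within_open[of _ _ _ "{a<..<b}"]) (use t in \<open>auto simp: \<xi>_def\<close>)
    then have "(\<xi> has_vector_derivative 0) (at t within {0..T})" by (rule has_vector_derivative_at_within)
    then have "vector_derivative \<xi> (at t within {0..T}) = 0"
      using t ab by (intro vector_derivative_within_closed_interval[OF T]) auto
    then show ?thesis using overall_lagrangian_vertex[OF v(1)] t by (simp add: \<xi>_def)
  qed
  obtain B where B: "B \<ge> 0" "\<forall>T \<zeta> t. integrand T \<zeta> t \<ge> ereal (- B)"
    using integrand_bounded_below by (elim exE conjE)
  have split: "action E H c T \<eta> = ereal_integral 0 a (integrand T \<eta>) + (ereal_integral a b (integrand T \<eta>) + ereal_integral b T (integrand T \<eta>))" for \<eta>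
    unfolding action_def using ab B(2) ereal_integral_split[of 0 a T B "integrand T \<eta>"] ereal_integral_split[of a b T B "integrand T \<eta>"] by simp
  have N: "negligible {a, b}" by simp
  have "ereal_integral 0 a (integrand T \<xi>) = ereal_integral 0 a (integrand T \<zeta>)"
  proof (rule ereal_integral_cong_AE, rule AE_regular[where T = a and N = "{a, b}"])
    show "integrand T \<xi> t = integrand T \<zeta> t" if "t \<in> {0<..<a} - {a, b}" for t using that ab by (intro same) auto
  qed auto
  moreover have "ereal_integral b T (integrand T \<xi>) = ereal_integral b T (integrand T \<zeta>)"
  proof (rule ereal_integral_cong_AE)
    have "AE t in lebesgue_on {b..T}. t \<in> {b..T} \<and> t \<noteq> b"
    proof -
      have "AE t in lebesgue. t \<noteq> b" by (rule AE_completion) (simp add: AE_lborel_singleton)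
      then show ?thesis by (auto simp: AE_restrict_space_iff elim: eventually_mono)
    qed
    then show "AE t in lebesgue_on {b..T}. integrand T \<xi> t = integrand T \<zeta> t"
      by (rule eventually_mono) (use ab in \<open>auto intro!: same\<close>)
  qed
  moreover have "ereal_integral a b (integrand T \<xi>) = ereal_integral a b (\<lambda>_. ereal (c v))"
  proof (rule ereal_integral_cong_AE)
    have "AE t in lebesgue_on {a..b}. t \<in> {a..b} \<and> t \<noteq> a \<and> t \<noteq> b"
    proof -
      have "AE t in lebesgue. t \<noteq> x" for x :: real by (rule AE_completion) (simp add: AE_lborel_singleton)
      from this[of a] this[of b] have "AE t in lebesgue. t \<noteq> a \<and> t \<noteq> b" by eventually_elim simp
      then show ?thesis by (auto simp: AE_restrict_space_iff elim: eventually_mono)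
    qed
    then show "AE t in lebesgue_on {a..b}. integrand T \<xi> t = ereal (c v)"
      by (rule eventually_mono) (auto intro!: rest)
  qed
  moreover have "ereal_integral a b (\<lambda>_. ereal (c v)) \<le> ereal_integral a b (integrand T \<zeta>)"
    using loop_action[OF \<zeta> T ab v only] ab by (simp add: ereal_integral_const)
  ultimately show "action E H c T \<xi> \<le> action E H c T \<zeta>"
    unfolding split by (intro add_mono) auto
qed

section \<open>Cutting a curve at its visits to vertices\<close>

lemma vertices_separated:
  obtains d where "d > 0" "\<And>v w. v \<in> vertices E \<Longrightarrow> w \<in> vertices E \<Longrightarrow> dist v w < d \<Longrightarrow> v = w"
proof -
  let ?D = "(\<lambda>(v, w). dist v w) ` {z \<in> vertices E \<times> vertices E. fst z \<noteq> snd z}"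
  have fin: "finite (insert 1 ?D)" using finite_vertices by (auto intro: finite_subset[of _ "vertices E \<times> vertices E"])
  have "Min (insert 1 ?D) > 0" using fin by (subst Min_gr_iff) auto
  moreover have "v = w" if "v \<in> vertices E" "w \<in> vertices E" "dist v w < Min (insert 1 ?D)" for v w
  proof (rule ccontr)
    assume "v \<noteq> w"
    then have "dist v w \<in> insert 1 ?D" using that(1,2) by (auto intro!: image_eqI[of _ _ "(v, w)"])
    then have "Min (insert 1 ?D) \<le> dist v w" using fin by (intro Min_le)
    then show False using that(3) by simp
  qed
  ultimately show thesis by (rule that)
qed

text \<open>On cells shorter than \<delta>, uniform continuity allows visits to at most one vertex.
  Cutting at the first and the last visit in each cell leaves finitely many pieces, although the
  curve may visit vertices infinitely often: everything between these two times counts as loops at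
  one vertex.\<close>

lemma vertex_times:
  fixes \<xi> :: "real \<Rightarrow> 'a"
  assumes cont: "continuous_on {0..T} \<xi>" and T: "T > 0" and meets: "\<exists>t\<in>{0..T}. \<xi> t \<in> vertices E"
  shows "\<exists>S. finite S \<and> S \<subseteq> {0..T} \<and> 0 \<in> S \<and> T \<in> S \<and> (\<forall>s\<in>S. s \<notin> {0, T} \<longrightarrow> \<xi> s \<in> vertices E) \<and>
    (\<forall>s\<in>S. \<forall>s'\<in>S. s < s' \<longrightarrow> {s<..<s'} \<inter> S = {} \<longrightarrow>
       (\<xi> ` {s<..<s'} \<inter> vertices E = {} \<and> \<xi> s \<noteq> \<xi> s') \<or>
       (\<exists>v\<in>vertices E. \<xi> s = v \<and> \<xi> s' = v \<and> (\<forall>t\<in>{s..s'}. \<xi> t \<in> vertices E \<longrightarrow> \<xi> t = v)))"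
proof -
  obtain d where d: "d > 0" "\<And>v w. v \<in> vertices E \<Longrightarrow> w \<in> vertices E \<Longrightarrow> dist v w < d \<Longrightarrow> v = w"
    using vertices_separated by blast
  have "uniformly_continuous_on {0..T} \<xi>" using cont by (intro compact_uniformly_continuous) auto
  then obtain \<delta> where \<delta>: "\<delta> > 0" "\<forall>s\<in>{0..T}. \<forall>t\<in>{0..T}. dist t s < \<delta> \<longrightarrow> dist (\<xi> t) (\<xi> s) < d"
    unfolding uniformly_continuous_on_def using d(1) by blast
  obtain n :: nat where n: "n > 0" "T / \<delta> < real n"
    using reals_Archimedean2[of "max 0 (T / \<delta>)"] by (metis max_less_iff_conj of_nat_0_less_iff)
  define h where "h = T / real n"
  have h: "h > 0" "h < \<delta>" "real n * h = T" using n T \<delta>(1) by (auto simp: h_def field_simps)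
  define Z where "Z k = {t \<in> {real k * h..real (Suc k) * h} \<inter> {0..T}. \<xi> t \<in> vertices E}" for k
  have Z_same: "\<xi> s = \<xi> t" if "s \<in> Z k" "t \<in> Z k" for s t k
  proof -
    have "dist s t \<le> h" using that unfolding Z_def dist_real_def by (auto simp: algebra_simps abs_le_iff)
    then have "dist (\<xi> s) (\<xi> t) < d" using \<delta>(2) h(2) that by (auto simp: Z_def)
    then show ?thesis using d(2) that by (auto simp: Z_def)
  qed
  have Z_ends: "Inf (Z k) \<in> Z k" "Sup (Z k) \<in> Z k" "\<And>t. t \<in> Z k \<Longrightarrow> Inf (Z k) \<le> t \<and> t \<le> Sup (Z k)" if "Z k \<noteq> {}" for k
  proof -
    have "closed (vertices E)" using finite_vertices by (rule finite_imp_closed)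
    then have "closed ({0..T} \<inter> \<xi> -` vertices E)" using cont by (intro continuous_closed_preimage) auto
    then have "closed ({real k * h..real (Suc k) * h} \<inter> ({0..T} \<inter> \<xi> -` vertices E))" by (rule closed_Int[OF closed_atLeastAtMost])
    moreover have "{real k * h..real (Suc k) * h} \<inter> ({0..T} \<inter> \<xi> -` vertices E) = Z k" by (auto simp: Z_def)
    ultimately have cl: "closed (Z k)" by simp
    have bdd: "bdd_below (Z k)" "bdd_above (Z k)" by (auto simp: Z_def intro!: bdd_belowI[of _ 0] bdd_aboveI[of _ T])
    show "Inf (Z k) \<in> Z k" using that bdd(1) cl by (rule closed_contains_Inf)
    show "Sup (Z k) \<in> Z k" using that bdd(2) cl by (rule closed_contains_Sup)
    show "Inf (Z k) \<le> t \<and> t \<le> Sup (Z k)" if "t \<in> Z k" for t using that bdd by (auto intro: cInf_lower cSup_upper)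
  qed
  \<comment> \<open>The first and last visits; they are attained because the set of visits in a cell
    is closed.\<close>
  define A where "A = (\<Union>k\<in>{k. k < n \<and> Z k \<noteq> {}}. {Inf (Z k), Sup (Z k)})"
  have A_Z: "\<exists>k. s \<in> Z k" if "s \<in> A" for s using that Z_ends(1,2) by (auto simp: A_def)
  define S where "S = {0, T} \<union> A"
  have S: "finite S" "0 \<in> S" "T \<in> S" by (auto simp: S_def A_def)
  have S_sub: "S \<subseteq> {0..T}" using A_Z T by (force simp: S_def Z_def)
  have S_vert: "\<xi> s \<in> vertices E" if "s \<in> S" "s \<notin> {0, T}" for s
    using that A_Z[of s] by (auto simp: S_def Z_def)
  have step: "(\<xi> ` {s<..<s'} \<inter> vertices E = {} \<and> \<xi> s \<noteq> \<xi> s') \<or>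
       (\<exists>v\<in>vertices E. \<xi> s = v \<and> \<xi> s' = v \<and> (\<forall>t\<in>{s..s'}. \<xi> t \<in> vertices E \<longrightarrow> \<xi> t = v))"
    if s: "s \<in> S" "s' \<in> S" "s < s'" and gap: "{s<..<s'} \<inter> S = {}" for s s'
  proof (cases "\<xi> ` {s<..<s'} \<inter> vertices E = {}")
    case free: True
    have free': "\<xi> r \<notin> vertices E" if "s < r" "r < s'" for r
    proof -
      have "\<xi> r \<in> \<xi> ` {s<..<s'}" using that by (intro imageI) auto
      then show ?thesis using free by blast
    qed
    show ?thesis
    proof (cases "\<xi> s = \<xi> s'")
      case True
      \<comment> \<open>Inner cutting points are visits. If the common value were not a vertex, the
        piece would be the whole of \<open>{0..T}\<close> and contain no visit, which
        \<open>meets\<close> excludes.\<close>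
      have "\<xi> s \<in> vertices E"
      proof (rule ccontr)
        assume no: "\<xi> s \<notin> vertices E"
        then have "s \<in> {0, T}" "s' \<in> {0, T}" using S_vert s True by metis+
        then have "s = 0" "s' = T" using s(3) S_sub s(1,2) by auto
        have "\<xi> t \<notin> vertices E" if "t \<in> {0..T}" for t
          using that free'[of t] no True \<open>s = 0\<close> \<open>s' = T\<close> by (cases "t = 0 \<or> t = T") auto
        then show False using meets by blast
      qed
      moreover have "\<xi> t = \<xi> s" if "t \<in> {s..s'}" "\<xi> t \<in> vertices E" for t
        using that free'[of t] True by (cases "t = s \<or> t = s'") auto
      ultimately show ?thesis using True by auto
    qed (use free in simp)
  next
    case False
    then obtain t where t: "s < t" "t < s'" "\<xi> t \<in> vertices E" by auto
    have t0T: "0 \<le> t" "t < T" using t S_sub s(1,2) by force+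
    define k where "k = nat \<lfloor>t / h\<rfloor>"
    have "0 \<le> t / h" using t0T h(1) by simp
    then have k: "real k \<le> t / h" "t / h < real k + 1" unfolding k_def by linarith+
    have k1: "real k * h \<le> t" "t < real (Suc k) * h" using k h(1) by (simp_all add: field_simps)
    have kn: "k < n"
    proof (rule ccontr)
      assume "\<not> k < n"
      then have "real n * h \<le> real k * h" using h(1) by (intro mult_right_mono) auto
      then show False using k1 h(3) t0T by simp
    qed
    have tZ: "t \<in> Z k" using k1 t0T t(3) by (auto simp: Z_def)
    then have Zne: "Z k \<noteq> {}" by auto
    have inS: "Inf (Z k) \<in> S" "Sup (Z k) \<in> S" using kn Zne by (auto simp: S_def A_def)
    have le: "Inf (Z k) \<le> t" "t \<le> Sup (Z k)" using Z_ends(3)[OF Zne tZ] by auto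
    \<comment> \<open>A visit strictly inside the piece belongs to cell \<open>k\<close>. The first
      and last visits of that cell are cutting points, so they cannot lie inside the piece; hence
      the whole piece lies between them, within the cell.\<close>
    have a: "Inf (Z k) \<le> s"
    proof (rule ccontr)
      assume "\<not> Inf (Z k) \<le> s"
      then have "Inf (Z k) \<in> {s<..<s'} \<inter> S" using le(1) t(2) inS(1) by auto
      then show False using gap by simp
    qed
    have b: "s' \<le> Sup (Z k)"
    proof (rule ccontr)
      assume "\<not> s' \<le> Sup (Z k)"
      then have "Sup (Z k) \<in> {s<..<s'} \<inter> S" using le(2) t(1) inS(2) by auto
      then show False using gap by simp
    qed
    have range: "r \<in> {real k * h..real (Suc k) * h} \<inter> {0..T}" if "r \<in> {s..s'}" for r
      using that a b Z_ends(1,2)[OF Zne] by (auto simp: Z_def)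
    have "\<xi> s \<in> vertices E"
    proof (cases "s \<in> {0, T}")
      case True
      then have "s = 0" using s(3) S_sub s(2) by auto
      then have "s = Inf (Z k)" using a S_sub inS(1) by auto
      then show ?thesis using Z_ends(1)[OF Zne] by (simp add: Z_def)
    qed (use S_vert s(1) in blast)
    then have sZ: "s \<in> Z k" using range[of s] s(3) by (auto simp: Z_def)
    have "\<xi> s' \<in> vertices E"
    proof (cases "s' \<in> {0, T}")
      case True
      then have "s' = T" using s(3) S_sub s(1) by auto
      then have "s' = Sup (Z k)" using b S_sub inS(2) by auto
      then show ?thesis using Z_ends(2)[OF Zne] by (simp add: Z_def)
    qed (use S_vert s(2) in blast)
    then have s'Z: "s' \<in> Z k" using range[of s'] s(3) by (auto simp: Z_def)
    have "\<xi> r = \<xi> s" if "r \<in> {s..s'}" "\<xi> r \<in> vertices E" for r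
      using range[OF that(1)] that(2) by (intro Z_same[OF _ sZ]) (auto simp: Z_def)
    then show ?thesis using \<open>\<xi> s \<in> vertices E\<close> Z_same[OF s'Z sZ] by (intro disjI2 bexI[of _ "\<xi> s"]) auto
  qed
  show ?thesis using S S_sub S_vert step by (intro exI[of _ S] conjI ballI impI) auto
qed

lemma finite_set_enumeration:
  fixes S :: "real set"
  assumes S: "finite S" "S \<subseteq> {a..b}" "a \<in> S" "b \<in> S" and ab: "a < b"
  obtains m :: nat and t where "2 \<le> m" "t 1 = a" "t m = b" "strict_mono_on {1..m} t"
    "\<And>i. i \<in> {1..m} \<Longrightarrow> t i \<in> S" "\<And>i. i \<in> {1..m-1} \<Longrightarrow> {t i<..<t (i + 1)} \<inter> S = {}"
proof -
  define xs where "xs = sorted_list_of_set S"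
  define m where "m = length xs"
  \<comment> \<open>Lists count from 0, whereas the partitions in \<open>admissible\<close> count
    from 1.\<close>
  define t where "t i = xs ! (i - 1)" for i
  have set_xs: "set xs = S" using S(1) by (simp add: xs_def)
  have "sorted_wrt (<) xs" by (simp add: xs_def)
  then have less: "xs ! i < xs ! j" if "i < j" "j < m" for i j
    using sorted_wrt_nth_less that by (simp add: m_def)
  have inS: "t i \<in> S" if "i \<in> {1..m}" for i
    using that set_xs nth_mem[of "i - 1" xs] by (auto simp: t_def m_def)
  have mono: "strict_mono_on {1..m} t"
    unfolding strict_mono_on_def t_def using less by auto
  have idx: "\<exists>i\<in>{1..m}. t i = s" if "s \<in> S" for s
  proof -
    have "s \<in> set xs" using that set_xs by simp
    then obtain j where "j < m" "xs ! j = s" unfolding in_set_conv_nth m_def by blast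
    then show ?thesis by (intro bexI[of _ "Suc j"]) (auto simp: t_def)
  qed
  obtain i where i: "i \<in> {1..m}" "t i = a" using idx[OF S(3)] by blast
  obtain j where j: "j \<in> {1..m}" "t j = b" using idx[OF S(4)] by blast
  have "i = 1"
  proof (rule ccontr)
    assume "i \<noteq> 1"
    then have "t 1 < t i" using i(1) by (intro strict_mono_onD[OF mono]) auto
    moreover have "t 1 \<in> S" using i(1) by (intro inS) auto
    ultimately show False using i(2) S(2) by auto
  qed
  have "j = m"
  proof (rule ccontr)
    assume "j \<noteq> m"
    then have "t j < t m" using j(1) by (intro strict_mono_onD[OF mono]) auto
    moreover have "t m \<in> S" using j(1) by (intro inS) auto
    ultimately show False using j(2) S(2) by auto
  qed
  have "2 \<le> m" using i j \<open>i = 1\<close> \<open>j = m\<close> ab by (cases "m = 1") auto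
  moreover have "{t i<..<t (i + 1)} \<inter> S = {}" if i: "i \<in> {1..m-1}" for i
  proof (rule ccontr)
    assume "{t i<..<t (i + 1)} \<inter> S \<noteq> {}"
    then obtain s where s: "t i < s" "s < t (i + 1)" "s \<in> S" by auto
    then obtain l where l: "l \<in> {1..m}" "t l = s" using idx by blast
    have "i < l"
    proof (rule ccontr)
      assume "\<not> i < l"
      then have "t l \<le> t i" using l(1) i by (intro strict_mono_on_leD[OF mono]) auto
      then show False using l(2) s(1) by simp
    qed
    moreover have "l < i + 1"
    proof (rule ccontr)
      assume "\<not> l < i + 1"
      then have "t (i + 1) \<le> t l" using l(1) i by (intro strict_mono_on_leD[OF mono]) auto
      then show False using l(2) s(2) by simp
    qed
    ultimately show False by simp
  qed
  ultimately show thesis using \<open>i = 1\<close> \<open>j = m\<close> i(2) j(2) mono inS by (intro that[of m t]) auto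
qed

text \<open>The pieces that are loops are replaced one by one, from left to right. Each step keeps
  the values at all cutting points and does not raise the action.\<close>

lemma admissible_modification:
  fixes \<xi> :: "real \<Rightarrow> 'a"
  assumes \<xi>: "abs_continuous_on 0 T \<xi>" "\<xi> ` {0..T} \<subseteq> network_set E" and T: "T > 0"
    and meets: "\<exists>t\<in>{0..T}. \<xi> t \<in> vertices E"
  shows "\<exists>\<zeta>. admissible E T \<zeta> \<and> \<zeta> 0 = \<xi> 0 \<and> \<zeta> T = \<xi> T \<and> action E H c T \<zeta> \<le> action E H c T \<xi>"
proof -
  obtain S where S: "finite S" "S \<subseteq> {0..T}" "0 \<in> S" "T \<in> S" and S_vert: "\<forall>s\<in>S. s \<notin> {0, T} \<longrightarrow> \<xi> s \<in> vertices E"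
    and S_step: "\<forall>s\<in>S. \<forall>s'\<in>S. s < s' \<longrightarrow> {s<..<s'} \<inter> S = {} \<longrightarrow>
       (\<xi> ` {s<..<s'} \<inter> vertices E = {} \<and> \<xi> s \<noteq> \<xi> s') \<or>
       (\<exists>v\<in>vertices E. \<xi> s = v \<and> \<xi> s' = v \<and> (\<forall>t\<in>{s..s'}. \<xi> t \<in> vertices E \<longrightarrow> \<xi> t = v))"
    using vertex_times[OF abs_continuous_on_imp_continuous_on[OF \<xi>(1)] T meets] by (elim exE conjE)
  show ?thesis
  proof (rule finite_set_enumeration[OF S T])
    fix m :: nat and t
    assume m: "2 \<le> m" and t1: "t 1 = 0" and tm: "t m = T" and mono: "strict_mono_on {1..m} t"
      and tS: "\<And>i. i \<in> {1..m} \<Longrightarrow> t i \<in> S" and gap: "\<And>i. i \<in> {1..m-1} \<Longrightarrow> {t i<..<t (i + 1)} \<inter> S = {}"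
    have t_le: "t i \<le> t j" if "i \<in> {1..m}" "j \<in> {1..m}" "i \<le> j" for i j
      using strict_mono_on_leD[OF mono that] .
    have t_less: "t i < t j" if "i \<in> {1..m}" "j \<in> {1..m}" "i < j" for i j
      using strict_mono_onD[OF mono that] .
    have t_range: "0 \<le> t i" "t i \<le> T" if "i \<in> {1..m}" for i using tS[OF that] S(2) by auto
    define loop where "loop i \<longleftrightarrow> (\<exists>v\<in>vertices E. \<xi> (t i) = v \<and> \<xi> (t (i + 1)) = v \<and>
       (\<forall>s\<in>{t i..t (i + 1)}. \<xi> s \<in> vertices E \<longrightarrow> \<xi> s = v))" for i
    have loop_or: "loop i \<or> (\<xi> ` {t i<..<t (i + 1)} \<inter> vertices E = {} \<and> \<xi> (t i) \<noteq> \<xi> (t (i + 1)))"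
      if "i \<in> {1..m-1}" for i
    proof -
      have i: "i \<in> {1..m}" "i + 1 \<in> {1..m}" using that by auto
      have "t i < t (i + 1)" using i by (intro t_less) auto
      from S_step[rule_format, OF tS[OF i(1)] tS[OF i(2)] this gap[OF that]]
      show ?thesis unfolding loop_def by (rule disj_commute[THEN iffD1])
    qed
    \<comment> \<open>After \<open>k\<close> pieces the new curve is known on each of them and still
      equals \<xi> to the right of \<open>t (k + 1)\<close>, so the assumptions of
      \<open>rest_at_vertex\<close> on the next piece can be read off from \<xi>.\<close>
    have "k \<le> m - 1 \<Longrightarrow> \<exists>\<zeta>. abs_continuous_on 0 T \<zeta> \<and> \<zeta> ` {0..T} \<subseteq> network_set E \<and>
        action E H c T \<zeta> \<le> action E H c T \<xi> \<and> (\<forall>s\<in>{t (k + 1)..T}. \<zeta> s = \<xi> s) \<and>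
        (\<forall>i\<in>{1..k}. \<forall>s\<in>{t i..t (i + 1)}. \<zeta> s = (if loop i then \<xi> (t i) else \<xi> s))" for k
    proof (induction k)
      case 0
      show ?case using \<xi> by (intro exI[of _ \<xi>]) simp
    next
      case (Suc k)
      then obtain \<zeta> where \<zeta>: "abs_continuous_on 0 T \<zeta>" "\<zeta> ` {0..T} \<subseteq> network_set E"
        "action E H c T \<zeta> \<le> action E H c T \<xi>" "\<forall>s\<in>{t (k + 1)..T}. \<zeta> s = \<xi> s"
        "\<forall>i\<in>{1..k}. \<forall>s\<in>{t i..t (i + 1)}. \<zeta> s = (if loop i then \<xi> (t i) else \<xi> s)"
        using Suc_leD by (elim impE meta_impE exE conjE) blast
      have idx: "k + 1 \<in> {1..m}" "k + 2 \<in> {1..m}" using Suc.prems m by auto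
      have kk: "t (k + 1) < t (k + 2)" using idx by (intro t_less) auto
      show ?case
      proof (cases "loop (k + 1)")
        case True
        then obtain v where v: "v \<in> vertices E" "\<xi> (t (k + 1)) = v" "\<xi> (t (k + 2)) = v"
          "\<forall>s\<in>{t (k + 1)..t (k + 2)}. \<xi> s \<in> vertices E \<longrightarrow> \<xi> s = v"
          by (auto simp: loop_def)
        define \<eta> where "\<eta> s = (if s \<in> {t (k + 1)..t (k + 2)} then v else \<zeta> s)" for s
        have eq: "\<zeta> s = \<xi> s" if "s \<in> {t (k + 1)..t (k + 2)}" for s
          using \<zeta>(4) that t_range(2)[OF idx(2)] by auto
        have ab: "0 \<le> t (k + 1)" "t (k + 1) \<le> t (k + 2)" "t (k + 2) \<le> T" using t_range idx kk by auto
        have ends: "\<zeta> (t (k + 1)) = v" "\<zeta> (t (k + 2)) = v" using eq kk v(2,3) by auto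
        have only: "\<zeta> s = v" if "s \<in> {t (k + 1)..t (k + 2)}" "\<zeta> s \<in> vertices E" for s
          using eq[OF that(1)] v(4) that by simp
        note \<eta> = rest_at_vertex[OF \<zeta>(1,2) T ab v(1) ends only, folded \<eta>_def[abs_def]]
        have "\<eta> s = \<xi> s" if "s \<in> {t (k + 2)..T}" for s
          using \<zeta>(4) that kk v(3) by (cases "s = t (k + 2)") (auto simp: \<eta>_def)
        moreover have "\<eta> s = (if loop i then \<xi> (t i) else \<xi> s)"
          if i: "i \<in> {1..Suc k}" and s: "s \<in> {t i..t (i + 1)}" for i s
        proof (cases "i = k + 1")
          case True
          then show ?thesis using s v(2) \<open>loop (k + 1)\<close> by (simp add: \<eta>_def)
        next
          case False
          then have ik: "i \<in> {1..k}" using i by auto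
          have old: "\<zeta> s = (if loop i then \<xi> (t i) else \<xi> s)" using \<zeta>(5) ik s by blast
          have "t (i + 1) \<le> t (k + 1)" using ik idx by (intro t_le) auto
          \<comment> \<open>Neighbouring closed pieces share an end point; the value there is
            \<open>v\<close> before and after the replacement.\<close>
          then have "s < t (k + 1) \<or> s = t (k + 1)" using s by auto
          then show ?thesis
          proof
            assume "s < t (k + 1)"
            then show ?thesis using old by (simp add: \<eta>_def)
          next
            assume "s = t (k + 1)"
            then have "\<eta> s = \<zeta> s" using kk ends(1) by (simp add: \<eta>_def)
            then show ?thesis using old by simp
          qed
        qed
        ultimately show ?thesis
          using \<eta> \<zeta>(3) by (intro exI[of _ \<eta>]) (auto intro: order_trans)
      next
        case False
        have "\<zeta> s = (if loop i then \<xi> (t i) else \<xi> s)"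
          if i: "i \<in> {1..Suc k}" and s: "s \<in> {t i..t (i + 1)}" for i s
        proof (cases "i = k + 1")
          case True
          then show ?thesis using s \<zeta>(4) False t_range(2)[OF idx(2)] by auto
        next
          case False
          then show ?thesis using \<zeta>(5) i s by auto
        qed
        then show ?thesis using \<zeta>(1-4) kk by (intro exI[of _ \<zeta>]) auto
      qed
    qed
    from this[of "m - 1"] obtain \<zeta> where \<zeta>: "abs_continuous_on 0 T \<zeta>" "\<zeta> ` {0..T} \<subseteq> network_set E"
      "action E H c T \<zeta> \<le> action E H c T \<xi>" "\<forall>s\<in>{t (m - 1 + 1)..T}. \<zeta> s = \<xi> s"
      "\<forall>i\<in>{1..m - 1}. \<forall>s\<in>{t i..t (i + 1)}. \<zeta> s = (if loop i then \<xi> (t i) else \<xi> s)"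
      by (elim meta_impE exE conjE) auto
    have node: "\<zeta> (t i) = \<xi> (t i)" if "i \<in> {1..m - 1}" for i
      using \<zeta>(5) that t_le[of i "i + 1"] by auto
    have "\<zeta> T = \<xi> T" using \<zeta>(4) tm m by simp
    moreover have "\<zeta> 0 = \<xi> 0" using node[of 1] t1 m by simp
    moreover have "admissible E T \<zeta>"
      unfolding admissible_def
    proof (intro conjI exI[of _ m] exI[of _ t] ballI)
      show "\<zeta> (t i) \<in> vertices E" if i: "i \<in> {2..m-1}" for i
      proof -
        have "t 1 < t i" "t i < t m" using i by (auto intro!: t_less)
        then have "t i \<notin> {0, T}" using t1 tm by auto
        then have "\<xi> (t i) \<in> vertices E" using S_vert tS[of i] i by auto
        then show ?thesis using node[of i] i by auto
      qed
      fix i assume i: "i \<in> {1..m-1}"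
      have t_i: "t i \<le> t (i + 1)" using i by (intro t_le) auto
      show "(\<zeta> ` {t i<..<t (i + 1)} \<inter> vertices E = {} \<and> \<zeta> (t i) \<noteq> \<zeta> (t (i + 1))) \<or>
           (\<exists>v\<in>vertices E. \<forall>s\<in>{t i<..<t (i + 1)}. \<zeta> s = v)"
      proof (cases "loop i")
        case True
        then have "\<xi> (t i) \<in> vertices E" by (auto simp: loop_def)
        moreover have "\<forall>s\<in>{t i<..<t (i + 1)}. \<zeta> s = \<xi> (t i)" using \<zeta>(5) i True by auto
        ultimately show ?thesis by blast
      next
        case False
        then have eq: "\<zeta> s = \<xi> s" if "s \<in> {t i..t (i + 1)}" for s using \<zeta>(5) i that by auto
        have "\<xi> ` {t i<..<t (i + 1)} \<inter> vertices E = {}" "\<xi> (t i) \<noteq> \<xi> (t (i + 1))" using loop_or[OF i] False by auto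
        moreover have "\<zeta> ` {t i<..<t (i + 1)} = \<xi> ` {t i<..<t (i + 1)}" using eq by (intro image_cong) auto
        ultimately show ?thesis using eq t_i by auto
      qed
    qed (use \<zeta>(1,2) m t1 tm mono in auto)
    ultimately show ?thesis using \<zeta>(3) by blast
  qed
qed

text \<open>The partition with the single cell \<open>{0..T}\<close> is a witness; the different end
  points are what the definition requires of a cell free of vertices.\<close>

lemma admissible_avoiding_vertices:
  fixes \<xi> :: "real \<Rightarrow> 'a"
  assumes "abs_continuous_on 0 T \<xi>" "\<xi> ` {0..T} \<subseteq> network_set E" "T > 0"
    and "\<xi> ` {0..T} \<inter> vertices E = {}" "\<xi> 0 \<noteq> \<xi> T"
  shows "admissible E T \<xi>"
proof -
  define t where "t i = (if i = 1 then 0 else T)" for i :: nat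
  have "\<xi> ` {0<..<T} \<subseteq> \<xi> ` {0..T}" by (intro image_mono) auto
  then have "\<xi> ` {0<..<T} \<inter> vertices E = {}" using assms(4) by blast
  then show ?thesis
    unfolding admissible_def using assms(1-3,5)
    by (intro conjI exI[of _ "2::nat"] exI[of _ t]) (auto simp: t_def strict_mono_on_def)
qed

end

(* The last conjunct says that the minimizer is admissible, except possibly when x = y is
   not a vertex and the minimizer never meets a vertex: no admissible curve joins x = y to
   itself without meeting a vertex, although such a curve (e.g. a constant one) can be the
   unique minimizer. *)

theorem theorem5p2:
  fixes E :: "(real ^ 'n) curve set"
    and H :: "(real ^ 'n) curve \<Rightarrow> real \<Rightarrow> real \<Rightarrow> real"
    and c :: "real ^ 'n \<Rightarrow> real"
    and x y :: "real ^ 'n" and T :: real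
  assumes "network_hamiltonian E H"
    and "flux_limiter E H c"
    and "x \<in> network_set E" and "y \<in> network_set E" and "T > 0"
  shows "\<exists>\<xi>. abs_continuous_on 0 T \<xi> \<and> \<xi> ` {0..T} \<subseteq> network_set E \<and>
           \<xi> 0 = x \<and> \<xi> T = y \<and>
           (\<forall>\<zeta>. abs_continuous_on 0 T \<zeta> \<longrightarrow> \<zeta> 0 = x \<longrightarrow> \<zeta> T = y \<longrightarrow>
              action E H c T \<xi> \<le> action E H c T \<zeta>) \<and>
           (admissible E T \<xi> \<or> (x = y \<and> \<xi> ` {0..T} \<inter> vertices E = {}))"
proof -
  interpret network_lagrangian E H c
    using assms(1,2) by (simp add: network_lagrangian_def network_lagrangian_axioms_def)
  obtain \<xi> where \<xi>: "abs_continuous_on 0 T \<xi>" "\<xi> ` {0..T} \<subseteq> network_set E" "\<xi> 0 = x" "\<xi> T = y"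
    and min: "\<forall>\<zeta>. abs_continuous_on 0 T \<zeta> \<longrightarrow> \<zeta> 0 = x \<longrightarrow> \<zeta> T = y \<longrightarrow> action E H c T \<xi> \<le> action E H c T \<zeta>"
    using minimizer_exists[OF assms(3-5)] by (elim exE conjE)
  show ?thesis
  \<comment> \<open>Rests are available only at vertices, so a minimizer that meets none is kept as
    it is.\<close>
  proof (cases "\<xi> ` {0..T} \<inter> vertices E = {}")
    case True
    then have "admissible E T \<xi> \<or> (x = y \<and> \<xi> ` {0..T} \<inter> vertices E = {})"
      using admissible_avoiding_vertices[OF \<xi>(1,2) assms(5) True] \<xi>(3,4) by auto
    then show ?thesis using \<xi> min by (intro exI[of _ \<xi>] conjI)
  next
    case False
    then have "\<exists>t\<in>{0..T}. \<xi> t \<in> vertices E" by blast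
    then obtain \<zeta> where \<zeta>: "admissible E T \<zeta>" "\<zeta> 0 = \<xi> 0" "\<zeta> T = \<xi> T" "action E H c T \<zeta> \<le> action E H c T \<xi>"
      using admissible_modification[OF \<xi>(1,2) assms(5)] by blast
    have "abs_continuous_on 0 T \<zeta>"
      by (rule \<zeta>(1)[unfolded admissible_def, THEN conjunct1])
    moreover have "\<zeta> ` {0..T} \<subseteq> network_set E"
      by (rule \<zeta>(1)[unfolded admissible_def, THEN conjunct2, THEN conjunct1])
    moreover have "\<forall>\<eta>. abs_continuous_on 0 T \<eta> \<longrightarrow> \<eta> 0 = x \<longrightarrow> \<eta> T = y \<longrightarrow> action E H c T \<zeta> \<le> action E H c T \<eta>"
      using min \<zeta>(4) order_trans by blast
    ultimately show ?thesis using \<zeta>(1-3) \<xi>(3,4) by (intro exI[of _ \<zeta>] conjI disjI1) simp_all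
  qed
qed

end
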